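(* Let $\lambda$ be a nonempty partition with at most $n$ parts. Then $$\mathfrak{K}^{(\beta)}_\lambda(x_1,\dots,x_n)=\sum_{T\in\mathrm{QSV}_n(\lambda)}\beta^{|T|-|\lambda|}\,\mathcal{G}^{(\beta)}_{\mathrm{rev}(\mathrm{wt}(T))}(x_1,\dots,x_n).$$
   Context: Lehmer code: for a permutation $w$, $L(w)_i=\#\{j>i: w(i)>w(j)\}$. For a partition $\lambda=(\lambda_1\ge\lambda_2\ge\dots)$ with at most $n$ parts (padded by zeros), let $w$ be the unique (Grassmannian) permutation with $L(w)=(\lambda_n,\lambda_{n-1},\dots,\lambda_1,0,0,\dots)$, and set $\mathfrak{K}^{(\beta)}_\lambda(x_1,\dots,x_n):=\mathfrak{K}^{(\beta)}_w$, where $\mathfrak{K}^{(\beta)}_w=\sum_{P\in\mathrm{PD}(w)}\beta^{\mathrm{ex}(P)}x^{\mathrm{wt}(P)}$ is the $\beta$-Grothendieck polynomial (pipe dreams $P$: fillings of cells $(i,j)$ by crosses/elbows with finitely many crosses; reduction keeps only the southwestmost cross between each pair of pipes; permutation of $P$ is that of its reduction, i.e. Demazure product convention; $\mathrm{ex}(P)$ = number of crosses of $P$ minus those of its reduction; $\mathrm{wt}(P)_i$ = number of crosses in row $i$; equivalently this is the Fomin–Kirillov $\beta$-Grothendieck polynomial, equal to Lascoux–Schützenberger's at $\beta=-1$). A set-valued tableau of shape $\lambda$ fills each box of the English Young diagram of $\lambda$ with a nonempty finite set of positive integers so that the minimum of the box immediately right of a box with set $A$ is $\ge\max A$, and the minimum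 of the box immediately below is $>\max A$. $\mathrm{wt}(T)$ is the weak composition of length $n$ whose $i$th entry is the number of boxes containing $i$; $|T|$ is the total number of entries; $|\lambda|$ the number of boxes. $T$ is quasi-Yamanouchi if for every $i>1$ occurring in $T$ there is a box containing $i$ lying in a column weakly left of a different box containing $i-1$. $\mathrm{QSV}_n(\lambda)$ is the set of quasi-Yamanouchi set-valued tableaux of shape $\lambda$ with entries in $\{1,\dots,n\}$. $\mathrm{rev}(c)$ reverses a length-$n$ weak composition. Glide polynomials: a weak komposition is a weak composition whose positive entries are colored black or red, $\mathrm{ex}(b)$ = number of red entries, $\mathtt{flat}(a)$ = nonzero entries of $a$. For $a$ of length $n$ with nonzero entries exactly at positions $n_1<\dots<n_\ell$, $b$ is a glide of $a$ if there exist $0=i_0<\dots<i_\ell$ with $i_j\le n_j$, $b_k=0$ for $k>i_\ell$, and for each $j$: $b_{i_{j-1}+1}+\dots+b_{i_j}=\mathtt{flat}(a)_j+\#\{\text{red entries among } b_{i_{j-1}+1},\dots,b_{i_j}\}$ and the first nonzero entry among them is black. $\mathcal{G}^{(\beta)}_a=\sum_b\beta^{\mathrm{ex}(b)}x^b$ over glides $b$ of $a$. *)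

theory Defs
  imports Main
begin

text \<open>Permutations are functions nat => nat, bijective, fixing 0 (positions start at 1),
  with finite support.\<close>

definition is_perm :: "(nat \<Rightarrow> nat) \<Rightarrow> bool" where
  "is_perm w \<longleftrightarrow> bij w \<and> w 0 = 0 \<and> finite {i. w i \<noteq> i}"

definition lehmer :: "(nat \<Rightarrow> nat) \<Rightarrow> nat \<Rightarrow> nat" where
  "lehmer w i = card {j. i < j \<and> w j < w i}"

definition inv_count :: "(nat \<Rightarrow> nat) \<Rightarrow> nat" where
  "inv_count w = card {(i, j). 0 < i \<and> i < j \<and> w j < w i}"

definition is_partition :: "nat list \<Rightarrow> bool" where
  "is_partition lam \<longleftrightarrow> sorted_wrt (\<ge>) lam \<and> (\<forall>v\<in>set lam. 0 < v)"

definition part_entry :: "nat list \<Rightarrow> nat \<Rightarrow> nat" where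
  "part_entry lam k = (if 1 \<le> k \<and> k \<le> length lam then lam ! (k - 1) else 0)"

definition grassmannian_of :: "nat \<Rightarrow> nat list \<Rightarrow> (nat \<Rightarrow> nat) \<Rightarrow> bool" where
  "grassmannian_of n lam w \<longleftrightarrow> is_perm w \<and>
     (\<forall>i\<ge>1. lehmer w i = (if i \<le> n then part_entry lam (n + 1 - i) else 0))"

definition simple_transp :: "nat \<Rightarrow> nat \<Rightarrow> nat" where
  "simple_transp a k = (if k = a then Suc a else if k = Suc a then a else k)"

definition demazure_step :: "(nat \<Rightarrow> nat) \<Rightarrow> nat \<Rightarrow> (nat \<Rightarrow> nat)" where
  "demazure_step w a = (if w (Suc a) < w a then w else w \<circ> simple_transp a)"

definition demazure :: "nat list \<Rightarrow> (nat \<Rightarrow> nat)" where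
  "demazure ws = foldl demazure_step id ws"

text \<open>A pipe dream is a finite set of cross cells (i,j), i,j >= 1 (row i, column j).
  Reading word: rows top to bottom, each row right to left, a cross at (i,j)
  contributing the letter i+j-1.\<close>

definition is_pipe_dream :: "(nat \<times> nat) set \<Rightarrow> bool" where
  "is_pipe_dream P \<longleftrightarrow> finite P \<and> (\<forall>(i, j)\<in>P. 1 \<le> i \<and> 1 \<le> j)"

definition reading_word :: "(nat \<times> nat) set \<Rightarrow> nat list" where
  "reading_word P = concat (map (\<lambda>i. map (\<lambda>j. i + j - 1) (rev (sorted_list_of_set {j. (i, j) \<in> P})))
      (sorted_list_of_set (fst ` P)))"

definition pd_perm :: "(nat \<times> nat) set \<Rightarrow> (nat \<Rightarrow> nat)" where
  "pd_perm P = demazure (reading_word P)"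

definition PD :: "(nat \<Rightarrow> nat) \<Rightarrow> (nat \<times> nat) set set" where
  "PD w = {P. is_pipe_dream P \<and> pd_perm P = w}"

text \<open>ex(P) = #crosses of P - #crosses of its reduction = card P - inv(w).
  Evaluation of the beta-Grothendieck polynomial at beta and x = (x_1, x_2, ...).\<close>

definition groth :: "(nat \<Rightarrow> nat) \<Rightarrow> 'a::comm_ring_1 \<Rightarrow> (nat \<Rightarrow> 'a) \<Rightarrow> 'a" where
  "groth w \<beta> x = (\<Sum>P\<in>PD w. \<beta> ^ (card P - inv_count w) * (\<Prod>(i, j)\<in>P. x i))"

definition diagram :: "nat list \<Rightarrow> (nat \<times> nat) set" where
  "diagram lam = {(r, c). 1 \<le> r \<and> r \<le> length lam \<and> 1 \<le> c \<and> c \<le> lam ! (r - 1)}"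

definition is_svt :: "nat \<Rightarrow> nat list \<Rightarrow> (nat \<times> nat \<Rightarrow> nat set) \<Rightarrow> bool" where
  "is_svt n lam T \<longleftrightarrow>
     (\<forall>b. b \<notin> diagram lam \<longrightarrow> T b = {}) \<and>
     (\<forall>b\<in>diagram lam. T b \<noteq> {} \<and> T b \<subseteq> {1..n}) \<and>
     (\<forall>r c. (r, c) \<in> diagram lam \<and> (r, Suc c) \<in> diagram lam \<longrightarrow> Max (T (r, c)) \<le> Min (T (r, Suc c))) \<and>
     (\<forall>r c. (r, c) \<in> diagram lam \<and> (Suc r, c) \<in> diagram lam \<longrightarrow> Max (T (r, c)) < Min (T (Suc r, c)))"

definition quasi_yamanouchi :: "nat list \<Rightarrow> (nat \<times> nat \<Rightarrow> nat set) \<Rightarrow> bool" where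
  "quasi_yamanouchi lam T \<longleftrightarrow>
     (\<forall>i>1. (\<exists>b\<in>diagram lam. i \<in> T b) \<longrightarrow>
        (\<exists>b\<in>diagram lam. \<exists>b'\<in>diagram lam. b \<noteq> b' \<and> i \<in> T b \<and> (i - 1) \<in> T b' \<and> snd b \<le> snd b'))"

definition QSV :: "nat \<Rightarrow> nat list \<Rightarrow> (nat \<times> nat \<Rightarrow> nat set) set" where
  "QSV n lam = {T. is_svt n lam T \<and> quasi_yamanouchi lam T}"

definition svt_wt :: "nat \<Rightarrow> nat list \<Rightarrow> (nat \<times> nat \<Rightarrow> nat set) \<Rightarrow> nat list" where
  "svt_wt n lam T = map (\<lambda>i. card {b \<in> diagram lam. i \<in> T b}) [1..<n + 1]"

definition svt_size :: "nat list \<Rightarrow> (nat \<times> nat \<Rightarrow> nat set) \<Rightarrow> nat" where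
  "svt_size lam T = (\<Sum>b\<in>diagram lam. card (T b))"

text \<open>Weak compositions of length n are lists of length n (position k is entry k-1).
  A weak komposition is a pair (b, R) where R is the set of positions of red entries
  (a subset of the positions of positive entries of b).\<close>

definition nz_positions :: "nat list \<Rightarrow> nat list" where
  "nz_positions a = filter (\<lambda>k. 0 < a ! (k - 1)) [1..<length a + 1]"

definition flat :: "nat list \<Rightarrow> nat list" where
  "flat a = filter (\<lambda>v. 0 < v) a"

definition is_glide :: "nat list \<Rightarrow> nat list \<Rightarrow> nat set \<Rightarrow> bool" where
  "is_glide a b R \<longleftrightarrow> length b = length a \<and>
     R \<subseteq> {k. 1 \<le> k \<and> k \<le> length b \<and> 0 < b ! (k - 1)} \<and>
     (let ps = nz_positions a; f = flat a; l = length f in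
      \<exists>i :: nat \<Rightarrow> nat. i 0 = 0 \<and> (\<forall>j<l. i j < i (Suc j)) \<and>
        (\<forall>j\<in>{1..l}. i j \<le> ps ! (j - 1)) \<and>
        (\<forall>k. i l < k \<and> k \<le> length b \<longrightarrow> b ! (k - 1) = 0) \<and>
        (\<forall>j\<in>{1..l}.
           (\<Sum>k\<in>{i (j - 1)<..i j}. b ! (k - 1)) = f ! (j - 1) + card (R \<inter> {i (j - 1)<..i j}) \<and>
           (\<exists>k\<in>{i (j - 1)<..i j}. 0 < b ! (k - 1) \<and> k \<notin> R \<and>
              (\<forall>k'\<in>{i (j - 1)<..<k}. b ! (k' - 1) = 0))))"

definition glide_poly :: "nat list \<Rightarrow> 'a::comm_ring_1 \<Rightarrow> (nat \<Rightarrow> 'a) \<Rightarrow> 'a" where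
  "glide_poly a \<beta> x = (\<Sum>(b, R)\<in>{(b, R). is_glide a b R}.
       \<beta> ^ card R * (\<Prod>k\<in>{1..length b}. x k ^ (b ! (k - 1))))"

end

(*
  A pipe dream of a Grassmannian permutation is read backwards, one cross at a time, through the
  left Demazure action.  No intermediate permutation may have a descent other than n (right descents
  survive left Demazure multiplication), so each intermediate permutation is again Grassmannian and a
  cross of letter a acts on its partition at the diagonal of content a - n: it either adds the addable
  box there or, if the diagonal ends in a corner, leaves the partition unchanged.  Recording
  n + 1 - (row of the cross) in that box turns the pipe dream into a set-valued tableau, in which the
  entry v in box (r, c) comes from the cross (n + 1 - v, v + c - r).

  To expand the sum over set-valued tableaux, merge successive occurring values u < u' unless some
  u'-box lies weakly left of a different u-box; this yields a quasi-Yamanouchi tableau Q.  Order the N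
  entries of Q by (value, column).  The tableaux merging to Q correspond to sequences
  L_0, ..., L_{N-1} of nonempty sets with max L_k \<le> min L_{k+1}, strictly where the value in Q jumps.
  Counting the occurrences b_v of v, and coloring v red if v < max L_k for some L_k containing v,
  turns such sequences into the glides of the reversed weight of Q; the sequence is recovered from
  L_k = {v. S_v \<le> k < S_v + b_v}, where S_v sums b_u - [u red] over u < v.
*)
theory Submission
  imports Defs
begin

section \<open>Left Demazure multiplication\<close>

text \<open>Removing the first letter of a word turns right Demazure multiplication into a left
  action because left and right steps commute. A left step by a looks only at the positions of the
  values a and a + 1, so it touches at most one box. The cross of an entry v in box (r, c) has
  letter (n + 1 - v) + (v + c - r) - 1 = n + c - r: the letter sees only the content, the row only
  the entry. This is where the coordinates in \<open>cells\<close> and the reversal of weights come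
  from. The first cross belongs to the largest entry, and among equal entries to the one of greatest
  content, so peeling always happens at a corner. For the second half the obstacle is that the
  merged tableau must be recoverable from the given one. Merging is therefore stated as a labelling
  subject to local conditions, and these have exactly one solution on the occurring values. A red
  value has one more occurrence than there are sets ending in it, because it is non-maximal in
  exactly one set; this matches the red correction in the block sums of a glide.\<close>

definition lstep :: "nat \<Rightarrow> (nat \<Rightarrow> nat) \<Rightarrow> nat \<Rightarrow> nat" where
  "lstep a u = (if inv u (Suc a) < inv u a then u else simple_transp a \<circ> u)"

lemma simple_transp_involutory [simp]: "simple_transp a (simple_transp a k) = k"
  by (auto simp: simple_transp_def)

lemma bij_simple_transp: "bij (simple_transp a)"
  by (rule o_bij[of "simple_transp a"]) auto

lemma inv_simple_transp [simp]: "inv (simple_transp a) = simple_transp a"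
  by (rule inv_equality) auto

lemma bij_demazure_step: "bij u \<Longrightarrow> bij (demazure_step u b)"
  by (auto simp: demazure_step_def intro: bij_comp bij_simple_transp)

text \<open>The two steps interfere only if a and a + 1 sit at the positions b and b + 1. In
  increasing order there, s_a u = u s_b, and whichever step comes second is idle; in decreasing
  order both are idle. In every other case neither step changes the comparison that the other one
  tests.\<close>

lemma demazure_step_lstep:
  assumes u: "bij u"
  shows "demazure_step (lstep a u) b = lstep a (demazure_step u b)"
proof -
  define p q where "p = inv u a" and "q = inv u (Suc a)"
  have up: "u p = a" and uq: "u q = Suc a"
    using u by (simp_all add: p_def q_def bij_is_surj surj_f_inv_f)
  have inj: "u x = u y \<longleftrightarrow> x = y" for x y
    using u by (simp add: bij_is_inj inj_eq)
  have invs: "inv (u \<circ> simple_transp b) x = simple_transp b (inv u x)" for x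
    using u by (simp add: o_inv_distrib bij_simple_transp)
  have pq: "p \<noteq> q" using up uq by auto
  have ub: "u (Suc b) \<noteq> u b" using inj by simp
  have a_eq: "u x = a \<longleftrightarrow> x = p" "u x = Suc a \<longleftrightarrow> x = q" for x
    using inj[of x p] inj[of x q] up uq by auto
  have mono: "simple_transp a x < simple_transp a y \<longleftrightarrow> x < y"
    if "{x, y} \<noteq> {a, Suc a}" for x y
    using that by (auto simp: simple_transp_def)
  have mono_b: "simple_transp b x < simple_transp b y \<longleftrightarrow> x < y"
    if "{x, y} \<noteq> {b, Suc b}" for x y
    using that by (auto simp: simple_transp_def)
  show ?thesis
  proof (cases "{p, q} = {b, Suc b}")
    case True
    then consider "p = b" "q = Suc b" | "p = Suc b" "q = b" by (auto simp: doubleton_eq_iff)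
    then show ?thesis
    proof cases
      case 1
      have "simple_transp a \<circ> u = u \<circ> simple_transp b"
        using 1 up uq by (simp add: fun_eq_iff simple_transp_def) (metis a_eq)
       
      then show ?thesis
        using 1 up uq
        by (auto simp: demazure_step_def lstep_def invs simp flip: p_def q_def)
           (auto simp: simple_transp_def)
    next
      case 2
      then show ?thesis
        using up uq by (auto simp: demazure_step_def lstep_def simp flip: p_def q_def)
    qed
  next
    case False
    have False': "{u (Suc b), u b} \<noteq> {a, Suc a}"
      using False a_eq by (auto simp: doubleton_eq_iff)
    have "{q, p} \<noteq> {b, Suc b}" using False by (simp add: insert_commute)
    then show ?thesis
      using mono[OF False'] mono_b[of q p]
      by (auto simp: demazure_step_def lstep_def invs o_assoc simp flip: p_def q_def)
  qed
qed

text \<open>Commutation carries the step of the first letter through all later right steps; on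
  \<open>id\<close> left and right steps agree.\<close>

lemma demazure_Cons: "demazure (a # ws) = lstep a (demazure ws)"
proof -
  have "bij u \<Longrightarrow> foldl demazure_step (lstep a u) ws = lstep a (foldl demazure_step u ws)" for u
    by (induction ws arbitrary: u) (simp_all add: demazure_step_lstep bij_demazure_step)
  from this[of id] show ?thesis
    by (simp add: demazure_def demazure_step_def lstep_def)
qed

lemma demazure_Nil [simp]: "demazure [] = id"
  by (simp add: demazure_def)

section \<open>Peeling crosses off a pipe dream in reading order\<close>

definition first_cell :: "(nat \<times> nat) set \<Rightarrow> nat \<times> nat \<Rightarrow> bool" where
  "first_cell P p \<longleftrightarrow> p \<in> P \<and> (\<forall>(i, j)\<in>P. fst p < i \<or> fst p = i \<and> j \<le> snd p)"

lemma ex_first_cell: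
  assumes "finite P" "P \<noteq> {}"
  shows "\<exists>p. first_cell P p"
proof -
  define i where "i = Min (fst ` P)"
  define j where "j = Max {j. (i, j) \<in> P}"
  have fin: "finite {j. (i, j) \<in> P}"
    by (rule finite_subset[of _ "snd ` P"]) (use assms in force)+
  have "i \<in> fst ` P" unfolding i_def using assms by (intro Min_in) auto
  then have "{j. (i, j) \<in> P} \<noteq> {}" by auto
  then have "(i, j) \<in> P" using Max_in[OF fin] by (simp add: j_def)
  moreover have "i < i' \<or> i = i' \<and> j' \<le> j" if "(i', j') \<in> P" for i' j'
  proof -
    have "i \<le> i'" unfolding i_def using assms that by (auto intro!: Min_le image_eqI[of _ fst])
    moreover have "j' \<le> j" if "i = i'"
      unfolding j_def using fin \<open>(i', j') \<in> P\<close> that by (intro Max_ge) auto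
    ultimately show ?thesis by linarith
  qed
  ultimately show ?thesis by (auto simp: first_cell_def)
qed

lemma sorted_list_of_set_insert_greatest:
  assumes "finite A" "\<And>y::nat. y \<in> A \<Longrightarrow> y < x"
  shows "sorted_list_of_set (insert x A) = sorted_list_of_set A @ [x]"
  using assms by (intro sorted_list_of_set.idem_if_sorted_distinct[symmetric, THEN trans[OF _ arg_cong[of _ _ sorted_list_of_set]], symmetric])
     (auto simp: sorted_append less_imp_le)

lemma reading_word_first_cell:
  assumes fin: "finite P" and first: "first_cell P (i, j)"
  shows "reading_word P = (i + j - 1) # reading_word (P - {(i, j)})"
proof -
  define P' where "P' = P - {(i, j)}"
  define row where "row P i = map (\<lambda>j. i + j - 1) (rev (sorted_list_of_set {j. (i, j) \<in> P}))"
    for i :: nat and P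
  have P: "P = insert (i, j) P'" using first by (auto simp: P'_def first_cell_def)
  have less: "i < i' \<or> i = i' \<and> j' < j" if "(i', j') \<in> P'" for i' j'
    using first that by (force simp: P'_def first_cell_def)
  have finP': "finite P'" using fin by (simp add: P'_def)
  have rw: "reading_word P = concat (map (row P) (sorted_list_of_set (fst ` P)))" for P
    by (simp add: reading_word_def row_def[abs_def])
  have rowi: "row P i = (i + j - 1) # row P' i"
  proof -
    have "{j. (i, j) \<in> P} = insert j {j. (i, j) \<in> P'}" by (auto simp: P)
    moreover have "finite {j. (i, j) \<in> P'}"
      by (rule finite_subset[of _ "snd ` P'"]) (use finP' in force)+
    moreover have "y < j" if "(i, y) \<in> P'" for y using less[OF that] by simp
    ultimately have "sorted_list_of_set {j. (i, j) \<in> P} = sorted_list_of_set {j. (i, j) \<in> P'} @ [j]"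
      using sorted_list_of_set_insert_greatest[of "{j. (i, j) \<in> P'}" j] by simp
    then show ?thesis by (simp add: row_def)
  qed
  have row_other: "row P k = row P' k" if "k \<noteq> i" for k
    using that by (simp add: row_def P)
  \<comment> \<open>The rows strictly below i are unaffected. Row i is kept apart because it
    disappears from the row list if its only cross is removed.\<close>
  define K where "K = fst ` P' - {i}"
  have K: "finite K" "\<forall>k\<in>K. i < k" using finP' by (auto simp: K_def dest: less)
  have sK: "sorted_list_of_set (insert i K) = i # sorted_list_of_set K"
    using K by (subst sorted_list_of_set_insert_remove)
               (auto simp: insort_is_Cons less_imp_le intro!: arg_cong[of _ _ sorted_list_of_set])
  have fP: "fst ` P = insert i K" by (auto simp: P K_def)
  have mapK: "map (row P) (sorted_list_of_set K) = map (row P') (sorted_list_of_set K)"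
    using K by (intro map_cong refl) (auto intro: row_other)
  have "reading_word P' = row P' i @ concat (map (row P') (sorted_list_of_set K))"
  proof (cases "i \<in> fst ` P'")
    case True
    then have "fst ` P' = insert i K" by (auto simp: K_def)
    then show ?thesis by (simp add: rw sK)
  next
    case False
    then have "fst ` P' = K" "{j. (i, j) \<in> P'} = {}" by (auto simp: K_def image_iff)
    then show ?thesis by (simp add: rw row_def)
  qed
  then show ?thesis
    unfolding P'_def[symmetric] by (simp add: rw[of P] fP sK mapK rowi)
qed

lemma pd_perm_first_cell:
  "finite P \<Longrightarrow> first_cell P (i, j) \<Longrightarrow> pd_perm P = lstep (i + j - 1) (pd_perm (P - {(i, j)}))"
  by (simp add: pd_perm_def reading_word_first_cell demazure_Cons)

lemma pd_perm_empty [simp]: "pd_perm {} = id"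
  by (simp add: pd_perm_def reading_word_def)

section \<open>Set-valued tableaux and their cells\<close>

definition shape :: "(nat \<times> nat \<Rightarrow> nat set) \<Rightarrow> (nat \<times> nat) set" where
  "shape T = {b. T b \<noteq> {}}"

text \<open>The shape is read off the filling instead of being prescribed, so that a filling can
  shrink or grow entry by entry. Comparing single entries rather than \<open>Max\<close> and
  \<open>Min\<close> makes the conditions vacuous at empty boxes; closure to the upper left says
  that the shape is a partition diagram.\<close>

definition svt_filling :: "nat \<Rightarrow> (nat \<times> nat \<Rightarrow> nat set) \<Rightarrow> bool" where
  "svt_filling n T \<longleftrightarrow> finite (shape T) \<and> (\<forall>b. T b \<subseteq> {1..n}) \<and>
     (\<forall>r c. (r, c) \<in> shape T \<longrightarrow> 1 \<le> r \<and> 1 \<le> c) \<and>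
     (\<forall>r c r' c'. (r, c) \<in> shape T \<longrightarrow> 1 \<le> r' \<longrightarrow> r' \<le> r \<longrightarrow> 1 \<le> c' \<longrightarrow> c' \<le> c \<longrightarrow> (r', c') \<in> shape T) \<and>
     (\<forall>r c v v'. v \<in> T (r, c) \<longrightarrow> v' \<in> T (r, Suc c) \<longrightarrow> v \<le> v') \<and>
     (\<forall>r c v v'. v \<in> T (r, c) \<longrightarrow> v' \<in> T (Suc r, c) \<longrightarrow> v < v')"

lemma mem_shapeI: "v \<in> T b \<Longrightarrow> b \<in> shape T"
  by (auto simp: shape_def)

lemma svt_filling_memD:
  assumes "svt_filling n T" "v \<in> T (r, c)"
  shows "1 \<le> v" "v \<le> n" "1 \<le> r" "1 \<le> c"
proof -
  have "T (r, c) \<subseteq> {1..n}" using assms(1) unfolding svt_filling_def by blast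
  then show "1 \<le> v" "v \<le> n" using assms(2) by auto
  show "1 \<le> r" "1 \<le> c" using assms mem_shapeI[of v T "(r, c)"] unfolding svt_filling_def by blast+
qed

lemma svt_filling_shape_pos: "svt_filling n T \<Longrightarrow> (r, c) \<in> shape T \<Longrightarrow> 1 \<le> r \<and> 1 \<le> c"
  unfolding svt_filling_def by blast

lemma svt_filling_shapeD:
  assumes "svt_filling n T" "(r, c) \<in> shape T" "1 \<le> r'" "r' \<le> r" "1 \<le> c'" "c' \<le> c"
  shows "(r', c') \<in> shape T"
  using assms unfolding svt_filling_def by blast

lemma svt_filling_ideal:
  assumes "svt_filling n T" "v \<in> T (r, c)" "1 \<le> r'" "r' \<le> r" "1 \<le> c'" "c' \<le> c"
  shows "(r', c') \<in> shape T"
  using svt_filling_shapeD[OF assms(1) _ assms(3-6)] mem_shapeI[of v T "(r, c)"] assms(2) by blast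

lemma svt_filling_row_le:
  assumes T: "svt_filling n T"
  shows "v \<in> T (r, c) \<Longrightarrow> v' \<in> T (r, Suc (c + d)) \<Longrightarrow> v \<le> v'"
proof (induction d arbitrary: v')
  case 0
  then show ?case using T unfolding svt_filling_def by simp
next
  case (Suc d)
  have "1 \<le> r" "1 \<le> c" using svt_filling_memD[OF T] Suc.prems by blast+
  then have "(r, Suc (c + d)) \<in> shape T"
    using svt_filling_ideal[OF T Suc.prems(2)] by simp
  then obtain x where x: "x \<in> T (r, Suc (c + d))" by (auto simp: shape_def)
  then have "v \<le> x" using Suc by blast
  also have "x \<le> v'" using T x Suc.prems(2) unfolding svt_filling_def add_Suc_right by blast
  finally show ?case .
qed

lemma svt_filling_col_less:
  assumes T: "svt_filling n T"
  shows "v \<in> T (r, c) \<Longrightarrow> v' \<in> T (Suc (r + d), c) \<Longrightarrow> v + d < v'"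
proof (induction d arbitrary: v')
  case 0
  then show ?case using T unfolding svt_filling_def by simp
next
  case (Suc d)
  have "1 \<le> r" "1 \<le> c" using svt_filling_memD[OF T] Suc.prems by blast+
  then have "(Suc (r + d), c) \<in> shape T"
    using svt_filling_ideal[OF T Suc.prems(2)] by simp
  then obtain x where x: "x \<in> T (Suc (r + d), c)" by (auto simp: shape_def)
  then have "v + d < x" using Suc by blast
  moreover have "x < v'" using T x Suc.prems(2) unfolding svt_filling_def add_Suc_right by blast
  ultimately show ?case by simp
qed

text \<open>The comparison passes through the box (r', c), which is filled because the shape is
  closed to the upper left; each row descended raises the entry by at least one.\<close>

lemma svt_filling_entry_le:
  assumes T: "svt_filling n T" and v: "v \<in> T (r, c)" and v': "v' \<in> T (r', c')"
    and le: "r \<le> r'" "c \<le> c'" "(r, c) \<noteq> (r', c')"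
  shows "v + (r' - r) \<le> v'"
proof -
  have row: "x \<le> v'" if "x \<in> T (r', c)" "c < c'" for x
    using svt_filling_row_le[OF T that(1), of v' "c' - c - 1"] v' that(2) by simp
  have col: "v + (r' - r) \<le> x" if "x \<in> T (r', c)" "r < r'" for x
    using svt_filling_col_less[OF T v, of x "r' - r - 1"] that by simp
  consider "r = r'" "c < c'" | "r < r'" "c = c'" | "r < r'" "c < c'" using le by force
  then show ?thesis
  proof cases
    case 1
    then show ?thesis using row v by simp
  next
    case 2
    then show ?thesis using col v' by simp
  next
    case 3
    have "1 \<le> r" "1 \<le> c" using svt_filling_memD[OF T v] by blast+
    then have "(r', c) \<in> shape T" using svt_filling_ideal[OF T v'] 3 by simp
    then obtain x where "x \<in> T (r', c)" by (auto simp: shape_def)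
    then show ?thesis using row[of x] col[of x] 3 by simp
  qed
qed

text \<open>Columns increase strictly from row 1 on. The bound keeps \<open>v + c - r\<close> free
  of truncation and at least c, hence a genuine column index.\<close>

lemma svt_filling_row_le_entry:
  assumes T: "svt_filling n T" and v: "v \<in> T (r, c)"
  shows "r \<le> v"
proof (cases "r = 1")
  case False
  have rc: "1 \<le> r" "1 \<le> c" using svt_filling_memD[OF T v] by blast+
  then have "(1, c) \<in> shape T" using svt_filling_ideal[OF T v] by simp
  then obtain x where x: "x \<in> T (1, c)" by (auto simp: shape_def)
  show ?thesis
    using svt_filling_entry_le[OF T x v] svt_filling_memD[OF T x] rc False by simp
qed (use svt_filling_memD[OF T v] in simp)

definition cells :: "nat \<Rightarrow> (nat \<times> nat \<Rightarrow> nat set) \<Rightarrow> (nat \<times> nat) set" where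
  "cells n T = {(n + 1 - v, v + c - r) | v r c. v \<in> T (r, c)}"

text \<open>Along a diagonal of a tableau the entries strictly increase.\<close>

lemma cell_eq_iff:
  assumes T: "svt_filling n T" and v: "v \<in> T (r, c)" and v': "v' \<in> T (r', c')"
  shows "(n + 1 - v, v + c - r) = (n + 1 - v', v' + c' - r') \<longleftrightarrow> v = v' \<and> r = r' \<and> c = c'"
    (is "?L \<longleftrightarrow> ?R")
proof
  assume ?L
  moreover have "v \<le> n" "v' \<le> n" "r \<le> v" "r' \<le> v'"
    using svt_filling_memD[OF T] svt_filling_row_le_entry[OF T] v v' by blast+
  ultimately have eq: "v = v'" "c + r' = c' + r" by auto
  have "r = r'"
  proof (rule ccontr)
    assume "r \<noteq> r'"
    then consider "r < r'" "c < c'" | "r' < r" "c' < c" using eq by linarith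
    then show False
      using svt_filling_entry_le[OF T v v'] svt_filling_entry_le[OF T v' v] eq(1) by cases auto
  qed
  then show ?R using eq by simp
qed simp

lemma cells_conv_image:
  "cells n T = (\<lambda>((r, c), v). (n + 1 - v, v + c - r)) ` Sigma (shape T) T"
  by (force simp: cells_def shape_def)

lemma inj_on_cell:
  "svt_filling n T \<Longrightarrow> inj_on (\<lambda>((r, c), v). (n + 1 - v, v + c - r)) (Sigma (shape T) T)"
  using cell_eq_iff[of n T] by (fastforce intro!: inj_onI)

lemma svt_filling_finite: "svt_filling n T \<Longrightarrow> finite (T b)"
  unfolding svt_filling_def by (meson finite_atLeastAtMost finite_subset)

lemma is_pipe_dream_cells:
  assumes T: "svt_filling n T"
  shows "is_pipe_dream (cells n T)"
proof -
  have "finite (Sigma (shape T) T)"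
    using T svt_filling_finite[OF T] by (auto simp: svt_filling_def)
  moreover have "1 \<le> n + 1 - v \<and> 1 \<le> v + c - r" if "v \<in> T (r, c)" for v r c
    using svt_filling_memD[OF T that] svt_filling_row_le_entry[OF T that] by linarith
  ultimately show ?thesis
    unfolding is_pipe_dream_def by (auto simp: cells_conv_image shape_def)
qed

lemma cells_eq_empty_iff: "cells n T = {} \<longleftrightarrow> (\<forall>b. T b = {})"
  by (auto simp: cells_def)

text \<open>The smallest row means the largest entry v, and the rightmost cross in it means the
  greatest content. A filled box to the right or below would hold an entry violating this, so the
  box of v is a corner, and emptying it would still leave a partition shape.\<close>

lemma svt_filling_remove_first:
  assumes T: "svt_filling n T" and first: "first_cell (cells n T) (i, j)"
  obtains v r c where "v \<in> T (r, c)" "i = n + 1 - v" "j = v + c - r"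
    "(r, Suc c) \<notin> shape T" "(Suc r, c) \<notin> shape T"
    "svt_filling n (T((r, c) := T (r, c) - {v}))"
    "cells n (T((r, c) := T (r, c) - {v})) = cells n T - {(i, j)}"
proof -
  obtain v r c where v: "v \<in> T (r, c)" and i: "i = n + 1 - v" and j: "j = v + c - r"
    using first by (auto simp: first_cell_def cells_def)
  have lex: "v' < v \<or> v' = v \<and> c' + r \<le> c + r'" if "v' \<in> T (r', c')" for v' r' c'
  proof -
    have "(n + 1 - v', v' + c' - r') \<in> cells n T" using that by (auto simp: cells_def)
    then have "n + 1 - v < n + 1 - v' \<or> n + 1 - v = n + 1 - v' \<and> v' + c' - r' \<le> v + c - r"
      using first by (auto simp: first_cell_def i j)
    moreover have "v \<le> n" "v' \<le> n" "r \<le> v" "r' \<le> v'"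
      using svt_filling_memD[OF T] svt_filling_row_le_entry[OF T] v that by blast+
    ultimately show ?thesis by linarith
  qed
  have right: "(r, Suc c) \<notin> shape T"
  proof
    assume "(r, Suc c) \<in> shape T"
    then obtain x where x: "x \<in> T (r, Suc c)" by (auto simp: shape_def)
    then show False using lex[OF x] svt_filling_entry_le[OF T v x] by simp
  qed
  have below: "(Suc r, c) \<notin> shape T"
  proof
    assume "(Suc r, c) \<in> shape T"
    then obtain x where x: "x \<in> T (Suc r, c)" by (auto simp: shape_def)
    then show False using lex[OF x] svt_filling_entry_le[OF T v x] by simp
  qed
  define T' where "T' = T((r, c) := T (r, c) - {v})"
  have sub: "T' b \<subseteq> T b" for b by (auto simp: T'_def)
  then have shape_sub: "shape T' \<subseteq> shape T" by (force simp: shape_def)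
  have shape': "b \<in> shape T'" if "b \<in> shape T" "b \<noteq> (r, c)" for b
    using that by (simp add: T'_def shape_def)
  have corner: "\<not> (r \<le> r' \<and> c \<le> c')" if "(r', c') \<in> shape T" "(r', c') \<noteq> (r, c)" for r' c'
  proof
    assume le: "r \<le> r' \<and> c \<le> c'"
    have "1 \<le> r" "1 \<le> c" using svt_filling_memD[OF T v] by blast+
    then show False
      using svt_filling_shapeD[OF T that(1), of "Suc r" c] svt_filling_shapeD[OF T that(1), of r "Suc c"]
        right below le that(2) by fastforce
  qed
  have "svt_filling n T'"
    unfolding svt_filling_def
  proof (intro conjI allI impI)
    show "finite (shape T')" using T finite_subset[OF shape_sub] by (simp add: svt_filling_def)
    show "T' b \<subseteq> {1..n}" for b using T sub[of b] unfolding svt_filling_def by blast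
    show "1 \<le> r'" "1 \<le> c'" if "(r', c') \<in> shape T'" for r' c'
      using T that shape_sub unfolding svt_filling_def by blast+
    show "(r'', c'') \<in> shape T'"
      if *: "(r', c') \<in> shape T'" "1 \<le> r''" "r'' \<le> r'" "1 \<le> c''" "c'' \<le> c'" for r' c' r'' c''
    proof (cases "(r', c') = (r, c) \<or> (r'', c'') \<noteq> (r, c)")
      case True
      have "(r'', c'') \<in> shape T" using svt_filling_shapeD[OF T _ *(2-)] * shape_sub by blast
      then show ?thesis using shape'[of "(r'', c'')"] True * by fastforce
    next
      case False
      then show ?thesis using corner[of r' c'] * shape_sub by auto
    qed
    show "x \<le> x'" if "x \<in> T' (r', c')" "x' \<in> T' (r', Suc c')" for x x' r' c'
      using T that sub unfolding svt_filling_def by blast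
    show "x < x'" if "x \<in> T' (r', c')" "x' \<in> T' (Suc r', c')" for x x' r' c'
      using T that sub unfolding svt_filling_def by blast
  qed
  moreover have "cells n T' = cells n T - {(i, j)}"
  proof (intro equalityI subsetI)
    fix p assume "p \<in> cells n T'"
    then obtain x r' c' where x: "x \<in> T' (r', c')" and p: "p = (n + 1 - x, x + c' - r')"
      by (auto simp: cells_def)
    have x': "x \<in> T (r', c')" using x sub by blast
    have "\<not> (x = v \<and> r' = r \<and> c' = c)" using x by (auto simp: T'_def)
    then have "p \<noteq> (i, j)" unfolding p i j using cell_eq_iff[OF T x' v] by blast
    then show "p \<in> cells n T - {(i, j)}" using x' p by (auto simp: cells_def)
  next
    fix p assume "p \<in> cells n T - {(i, j)}"
    then obtain x r' c' where x: "x \<in> T (r', c')" and p: "p = (n + 1 - x, x + c' - r')" "p \<noteq> (i, j)"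
      by (auto simp: cells_def)
    then have "x \<in> T' (r', c')" by (auto simp: T'_def i j)
    then show "p \<in> cells n T'" using p by (auto simp: cells_def)
  qed
  ultimately show ?thesis using that[OF v i j right below] by (simp add: T'_def)
qed

text \<open>Converse of the removal, for a corner or an addable box. The strict inequality of
  contents in \<open>lex\<close> rules out an equal entry directly above while permitting one
  directly to the left.\<close>

lemma svt_filling_insert:
  assumes T: "svt_filling n T" and rc: "1 \<le> r" "1 \<le> c" and vn: "1 \<le> v" "v \<le> n"
    and right: "(r, Suc c) \<notin> shape T" and below: "(Suc r, c) \<notin> shape T"
    and ideal: "\<And>r' c'. 1 \<le> r' \<Longrightarrow> r' \<le> r \<Longrightarrow> 1 \<le> c' \<Longrightarrow> c' \<le> c \<Longrightarrow> (r', c') \<noteq> (r, c) \<Longrightarrow> (r', c') \<in> shape T"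
    and lex: "\<And>v' r' c'. v' \<in> T (r', c') \<Longrightarrow> v' < v \<or> v' = v \<and> c' + r < c + r'"
  defines "T' \<equiv> T((r, c) := insert v (T (r, c)))"
  shows "svt_filling n T'" "shape T' = insert (r, c) (shape T)"
    "cells n T' = insert (n + 1 - v, v + c - r) (cells n T)"
proof -
  show shape': "shape T' = insert (r, c) (shape T)" by (auto simp: shape_def T'_def)
  show "cells n T' = insert (n + 1 - v, v + c - r) (cells n T)"
  proof (intro equalityI subsetI)
    fix p assume "p \<in> insert (n + 1 - v, v + c - r) (cells n T)"
    then consider "p = (n + 1 - v, v + c - r)" | "p \<in> cells n T" by blast
    then show "p \<in> cells n T'"
    proof cases
      case 1
      moreover have "v \<in> T' (r, c)" by (simp add: T'_def)
      ultimately show ?thesis unfolding cells_def by blast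
    next
      case 2
      moreover have "T b \<subseteq> T' b" for b by (auto simp: T'_def)
      ultimately show ?thesis unfolding cells_def by blast
    qed
  qed (auto simp: cells_def T'_def split: if_splits)
  show "svt_filling n T'"
    unfolding svt_filling_def
  proof (intro conjI allI impI)
    show "finite (shape T')" using T by (simp add: shape' svt_filling_def)
    show "T' b \<subseteq> {1..n}" for b
    proof -
      have "T b \<subseteq> {1..n}" using T unfolding svt_filling_def by blast
      then show ?thesis using vn by (auto simp: T'_def)
    qed
    show "1 \<le> r'" "1 \<le> c'" if "(r', c') \<in> shape T'" for r' c'
      using svt_filling_shape_pos[OF T, of r' c'] that rc unfolding shape' by blast+
    show "(r'', c'') \<in> shape T'"
      if *: "(r', c') \<in> shape T'" "1 \<le> r''" "r'' \<le> r'" "1 \<le> c''" "c'' \<le> c'" for r' c' r'' c''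
      using ideal[of r'' c''] svt_filling_shapeD[OF T _ *(2-)] *
      by (cases "(r', c') = (r, c)") (auto simp: shape')
    show "x \<le> x'" if "x \<in> T' (r', c')" "x' \<in> T' (r', Suc c')" for x x' r' c'
    proof -
      consider "(r', c') = (r, c)" | "(r', Suc c') = (r, c)" "x' = v"
        | "x \<in> T (r', c')" "x' \<in> T (r', Suc c')"
        using \<open>x \<in> T' (r', c')\<close> \<open>x' \<in> T' (r', Suc c')\<close> by (auto simp: T'_def split: if_splits)
      then show ?thesis
      proof cases
        case 1
        then show ?thesis using that right by (auto simp: T'_def shape_def)
      next
        case 2
        then have "x \<in> T (r', c')" using that by (auto simp: T'_def)
        then show ?thesis using lex[of x r' c'] 2 by auto
      next
        case 3
        then show ?thesis using T unfolding svt_filling_def by blast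
      qed
    qed
    show "x < x'" if "x \<in> T' (r', c')" "x' \<in> T' (Suc r', c')" for x x' r' c'
    proof -
      consider "(r', c') = (r, c)" | "(Suc r', c') = (r, c)" "x' = v"
        | "x \<in> T (r', c')" "x' \<in> T (Suc r', c')"
        using \<open>x \<in> T' (r', c')\<close> \<open>x' \<in> T' (Suc r', c')\<close> by (auto simp: T'_def split: if_splits)
      then show ?thesis
      proof cases
        case 1
        then show ?thesis using that below by (auto simp: T'_def shape_def)
      next
        case 2
        then have "x \<in> T (r', c')" using that by (auto simp: T'_def)
        then show ?thesis using lex[of x r' c'] 2 by auto
      next
        case 3
        then show ?thesis using T unfolding svt_filling_def by blast
      qed
    qed
  qed
qed

section \<open>Pipe dreams of Grassmannian permutations\<close>

lemma pipe_dream_induct [consumes 1, case_names empty first]: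
  assumes "is_pipe_dream P"
    and "Q {}"
    and "\<And>P i j. is_pipe_dream P \<Longrightarrow> first_cell P (i, j) \<Longrightarrow> Q (P - {(i, j)}) \<Longrightarrow> Q P"
  shows "Q P"
  using assms(1)
proof (induction "card P" arbitrary: P rule: less_induct)
  case less
  show ?case
  proof (cases "P = {}")
    case False
    have fin: "finite P" using less.prems by (simp add: is_pipe_dream_def)
    obtain i j where ij: "first_cell P (i, j)" using ex_first_cell[OF fin False] by auto
    then have mem: "(i, j) \<in> P" by (simp add: first_cell_def)
    have "Q (P - {(i, j)})"
    proof (rule less.hyps)
      show "card (P - {(i, j)}) < card P" using fin mem by (rule card_Diff1_less)
      show "is_pipe_dream (P - {(i, j)})" using less.prems by (auto simp: is_pipe_dream_def)
    qed
    then show ?thesis using assms(3) less.prems ij by blast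
  qed (use assms(2) in simp)
qed

section \<open>Grassmannian permutations, their partitions and the left action\<close>

definition grassmannian :: "nat \<Rightarrow> (nat \<Rightarrow> nat) \<Rightarrow> bool" where
  "grassmannian n u \<longleftrightarrow> is_perm u \<and> (\<forall>k\<ge>1. k \<noteq> n \<longrightarrow> u k < u (Suc k))"

text \<open>Row r measures how far u exceeds the identity at position n + 1 - r, so the largest part
  belongs to position n. The inequality is additive to avoid truncated subtraction.\<close>

definition grass_shape :: "nat \<Rightarrow> (nat \<Rightarrow> nat) \<Rightarrow> (nat \<times> nat) set" where
  "grass_shape n u = {(r, c). 1 \<le> r \<and> r \<le> n \<and> 1 \<le> c \<and> c + (n + 1 - r) \<le> u (n + 1 - r)}"

lemma is_perm_id [simp]: "is_perm id"
  by (simp add: is_perm_def)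

lemma is_perm_eq_iff: "is_perm u \<Longrightarrow> u x = u y \<longleftrightarrow> x = y"
  by (simp add: is_perm_def bij_is_inj inj_eq)

lemma is_perm_pos: "is_perm u \<Longrightarrow> 1 \<le> k \<Longrightarrow> 1 \<le> u k"
  using is_perm_eq_iff[of u k 0] by (auto simp: is_perm_def)

lemma is_perm_simple_transp_comp:
  assumes "is_perm u" "1 \<le> a"
  shows "is_perm (simple_transp a \<circ> u)"
proof -
  have "{i. (simple_transp a \<circ> u) i \<noteq> i} \<subseteq> {i. u i \<noteq> i} \<union> {a, Suc a}"
    by (auto simp: simple_transp_def)
  then have "finite {i. (simple_transp a \<circ> u) i \<noteq> i}"
    using assms finite_subset by (fastforce simp: is_perm_def)
  then show ?thesis
    using assms by (auto simp: is_perm_def simple_transp_def intro: bij_comp bij_simple_transp)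
qed

lemma lstep_cases:
  assumes u: "is_perm u" and "1 \<le> a"
  obtains (stay) k m where "u k = a" "u m = Suc a" "m < k" "1 \<le> m" "lstep a u = u"
  | (swap) k m where "u k = a" "u m = Suc a" "k < m" "1 \<le> k" "lstep a u = simple_transp a \<circ> u"
proof -
  define k m where "k = inv u a" and "m = inv u (Suc a)"
  have "surj u" using u by (simp add: is_perm_def bij_is_surj)
  then have *: "u k = a" "u m = Suc a" by (simp_all add: k_def m_def surj_f_inv_f)
  moreover have "k \<noteq> m" "1 \<le> k" "1 \<le> m"
    using * u \<open>1 \<le> a\<close> by (auto simp: is_perm_def Suc_le_eq intro!: gr0I)
  ultimately show ?thesis
    using stay[of k m] swap[of k m]
    by (cases "k < m") (simp_all add: lstep_def k_def[symmetric] m_def[symmetric])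
qed

lemma is_perm_lstep: "is_perm u \<Longrightarrow> 1 \<le> a \<Longrightarrow> is_perm (lstep a u)"
  by (simp add: lstep_def is_perm_simple_transp_comp)

lemma first_cellD: "is_pipe_dream P \<Longrightarrow> first_cell P (i, j) \<Longrightarrow> (i, j) \<in> P \<and> 1 \<le> i \<and> 1 \<le> j"
  by (auto simp: is_pipe_dream_def first_cell_def)

lemma pd_perm_first:
  "is_pipe_dream P \<Longrightarrow> first_cell P (i, j) \<Longrightarrow> pd_perm P = lstep (i + j - 1) (pd_perm (P - {(i, j)}))"
  by (simp add: is_pipe_dream_def pd_perm_first_cell)

lemma is_perm_pd_perm: "is_pipe_dream P \<Longrightarrow> is_perm (pd_perm P)"
proof (induction rule: pipe_dream_induct)
  case (first P i j)
  then have "1 \<le> i + j - 1" using first_cellD[of P i j] by linarith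
  then show ?case using first by (simp only: pd_perm_first is_perm_lstep)
qed (simp only: pd_perm_empty is_perm_id)

lemma grassmannian_low:
  assumes u: "grassmannian n u" and "1 \<le> k"
  shows "k + d \<le> n \<Longrightarrow> u k + d \<le> u (k + d)"
proof (induction d)
  case (Suc d)
  then have "u (k + d) < u (Suc (k + d))"
    using u \<open>1 \<le> k\<close> by (simp add: grassmannian_def)
  then show ?case using Suc by simp
qed simp

lemma grassmannian_low_diff:
  assumes "grassmannian n u" "1 \<le> k" "k \<le> m" "m \<le> n"
  shows "u k + (m - k) \<le> u m"
  using grassmannian_low[OF assms(1,2), of "m - k"] assms by simp

lemma grassmannian_high:
  assumes u: "grassmannian n u" and "n < k"
  shows "u k + d \<le> u (k + d)"
proof (induction d)
  case (Suc d)
  have "u (k + d) < u (Suc (k + d))"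
    using u \<open>n < k\<close> by (simp add: grassmannian_def)
  then show ?case using Suc by simp
qed simp

lemma grassmannian_high_less:
  assumes "grassmannian n u" "n < k" "k < m"
  shows "u k < u m"
  using grassmannian_high[OF assms(1,2), of "m - k"] assms(3) by simp

lemma grassmannian_ge:
  assumes u: "grassmannian n u" and k: "1 \<le> k" "k \<le> n"
  shows "k \<le> u k"
proof -
  have "1 \<le> u 1" using u is_perm_pos[of u 1] by (simp add: grassmannian_def)
  then show ?thesis using grassmannian_low_diff[OF u, of 1 k] k by simp
qed

lemma grassmannian_descent:
  assumes "grassmannian n u" "1 \<le> k" "k < m" "u m < u k"
  shows "k \<le> n" "n < m"
proof -
  show "n < m" using grassmannian_low_diff[of n u k m] assms by (cases "n < m") auto
  show "k \<le> n" using grassmannian_high_less[of n u k m] assms by (cases "k \<le> n") auto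
qed

lemma grass_shape_ideal:
  assumes u: "grassmannian n u" and "(r, c) \<in> grass_shape n u"
    and "1 \<le> r'" "r' \<le> r" "1 \<le> c'" "c' \<le> c"
  shows "(r', c') \<in> grass_shape n u"
proof -
  have r: "1 \<le> r" "r \<le> n" "c + (n + 1 - r) \<le> u (n + 1 - r)"
    using assms(2) by (auto simp: grass_shape_def)
  have "u (n + 1 - r) + (n + 1 - r' - (n + 1 - r)) \<le> u (n + 1 - r')"
    by (rule grassmannian_low_diff[OF u]) (use r assms in linarith)+
  then have "c' + (n + 1 - r') \<le> u (n + 1 - r')" using r assms by linarith
  then show ?thesis using r assms by (simp add: grass_shape_def)
qed

text \<open>A left step never destroys a descent: exchanging the values a and a + 1 alters only the
  comparison between these two, and it happens only when a stands to the left of a + 1. A forbidden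
  descent of u would persist.\<close>

lemma grassmannian_lstepD:
  assumes u: "is_perm u" and a: "1 \<le> a" and g: "grassmannian n (lstep a u)"
  shows "grassmannian n u"
  using u a
proof (cases rule: lstep_cases)
  case (swap k m)
  show ?thesis
    unfolding grassmannian_def
  proof (intro conjI allI impI u)
    fix b assume b: "b \<ge> 1" "b \<noteq> n"
    then have "simple_transp a (u b) < simple_transp a (u (Suc b))"
      using g swap by (simp add: grassmannian_def)
    moreover have "\<not> (u b = Suc a \<and> u (Suc b) = a)"
      using swap is_perm_eq_iff[OF u, of b m] is_perm_eq_iff[OF u, of "Suc b" k] by auto
    ultimately show "u b < u (Suc b)"
      by (auto simp: simple_transp_def split: if_splits)
  qed
qed (use g in simp)

text \<open>The exchanged values lie in different increasing runs, so neither run is broken. Among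
  the first n positions only position k changes, from a to a + 1, which lengthens one row by one
  box.\<close>

lemma grassmannian_swap:
  assumes g: "grassmannian n u" and km: "u k = a" "u m = Suc a" "1 \<le> k" "k \<le> n" "n < m"
  shows "grassmannian n (simple_transp a \<circ> u)"
    "grass_shape n (simple_transp a \<circ> u) = insert (n + 1 - k, a + 1 - k) (grass_shape n u)"
proof -
  have u: "is_perm u" using g by (simp add: grassmannian_def)
  have eq: "u x = a \<longleftrightarrow> x = k" "u x = Suc a \<longleftrightarrow> x = m" for x
    using km is_perm_eq_iff[OF u, of x k] is_perm_eq_iff[OF u, of x m] by auto
  have ka: "k \<le> a" using grassmannian_ge[OF g km(3,4)] km by simp
  show "grassmannian n (simple_transp a \<circ> u)"
    unfolding grassmannian_def
  proof (intro conjI allI impI)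
    show "is_perm (simple_transp a \<circ> u)" using u ka km by (intro is_perm_simple_transp_comp) auto
    fix b assume b: "b \<ge> 1" "b \<noteq> n"
    then have "u b < u (Suc b)" using g by (simp add: grassmannian_def)
    moreover have "\<not> (u b = a \<and> u (Suc b) = Suc a)"
      using b km unfolding eq by auto
    ultimately show "(simple_transp a \<circ> u) b < (simple_transp a \<circ> u) (Suc b)"
      by (auto simp: simple_transp_def)
  qed
  have low: "simple_transp a (u x) = (if x = k then Suc a else u x)" if "x \<le> n" for x
    using that km by (auto simp: simple_transp_def eq)
  show "grass_shape n (simple_transp a \<circ> u) = insert (n + 1 - k, a + 1 - k) (grass_shape n u)"
  proof (rule set_eqI)
    fix p :: "nat \<times> nat"
    obtain r c where p: "p = (r, c)" by fastforce
    show "p \<in> grass_shape n (simple_transp a \<circ> u) \<longleftrightarrow> p \<in> insert (n + 1 - k, a + 1 - k) (grass_shape n u)"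
    proof (cases "1 \<le> r \<and> r \<le> n")
      case True
      have "simple_transp a (u (n + 1 - r)) = (if n + 1 - r = k then Suc a else u (n + 1 - r))"
        by (intro low) (use True in linarith)
      moreover have "n + 1 - r = k \<longleftrightarrow> r = n + 1 - k" using True km by auto
      ultimately show ?thesis
        using True km ka unfolding p by (auto simp: grass_shape_def)
    next
      case False
      then show ?thesis using km unfolding p by (auto simp: grass_shape_def)
    qed
  qed
qed

section \<open>From pipe dreams to fillings and back\<close>

lemma grass_shape_id [simp]: "grass_shape n id = {}"
  by (auto simp: grass_shape_def)

lemma grassmannian_id [simp]: "grassmannian n id"
  by (simp add: grassmannian_def)

text \<open>Without its first cross the pipe dream still has a Grassmannian permutation u, so
  induction gives a filling of the rest. The cross returns as the entry n + 1 - i in the row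
  belonging to a position p \<le> n: p holds a + 1 if the step is idle and a if it is
  effective.\<close>

lemma ex_svt_filling_of_pipe_dream:
  assumes "is_pipe_dream P" "grassmannian n (pd_perm P)"
  shows "\<exists>T. svt_filling n T \<and> cells n T = P \<and> shape T = grass_shape n (pd_perm P)"
  using assms
proof (induction rule: pipe_dream_induct)
  case empty
  have "svt_filling n (\<lambda>_. {})" by (simp add: svt_filling_def shape_def)
  moreover have "cells n (\<lambda>_. {}) = {}" "shape (\<lambda>_. {}) = {}" by (auto simp: cells_def shape_def)
  ultimately show ?case unfolding pd_perm_empty grass_shape_id by blast
next
  case (first P i j)
  define P' where "P' = P - {(i, j)}"
  define u where "u = pd_perm P'"
  define a where "a = i + j - 1"
  have ij: "(i, j) \<in> P" "1 \<le> i" "1 \<le> j" using first_cellD[OF first(1,2)] by auto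
  then have a: "1 \<le> a" "i \<le> a" by (simp_all add: a_def)
  have "is_pipe_dream P'" using first(1) by (auto simp: is_pipe_dream_def P'_def)
  then have u: "is_perm u" by (simp add: u_def is_perm_pd_perm)
  have pdP: "pd_perm P = lstep a u"
    using pd_perm_first[OF first(1,2)] by (simp add: a_def u_def P'_def)
  then have g: "grassmannian n u" using grassmannian_lstepD[OF u a(1)] first.prems by simp
  then obtain T where T: "svt_filling n T" "cells n T = P'" "shape T = grass_shape n u"
    using first.IH by (auto simp: u_def P'_def)
  have cell: "i < n + 1 - v' \<or> i = n + 1 - v' \<and> v' + c' - r' < j" if "v' \<in> T (r', c')" for v' r' c'
  proof -
    have "(n + 1 - v', v' + c' - r') \<in> P'" using that T(2) by (auto simp: cells_def)
    then show ?thesis using first(2) by (fastforce simp: first_cell_def P'_def)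
  qed
  have i_le: "i \<le> n" if "P' \<noteq> {}"
  proof -
    obtain v' r' c' where "v' \<in> T (r', c')"
      using \<open>P' \<noteq> {}\<close> T(2) unfolding cells_def by blast
    then show ?thesis using cell svt_filling_memD[OF T(1)] by fastforce
  qed
  \<comment> \<open>Shared by both cases. The bounds on \<open>u p\<close> and
    \<open>u (p - 1)\<close> say that the box (n + 1 - p, a + 1 - p) has no box of the shape to its
    right and none below it.\<close>
  have extend: "\<exists>T. svt_filling n T \<and> cells n T = P \<and> shape T = insert (n + 1 - p, a + 1 - p) (grass_shape n u)"
    if p: "1 \<le> p" "p \<le> n" "p \<le> a" "i \<le> n"
      and up: "u p \<le> a + 1" "1 < p \<Longrightarrow> u (p - 1) < a"
      and ideal: "\<And>r' c'. 1 \<le> r' \<Longrightarrow> r' \<le> n + 1 - p \<Longrightarrow> 1 \<le> c' \<Longrightarrow> c' \<le> a + 1 - p \<Longrightarrow>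
         (r', c') \<noteq> (n + 1 - p, a + 1 - p) \<Longrightarrow> (r', c') \<in> shape T"
    for p
  proof -
    define r c v where "r = n + 1 - p" and "c = a + 1 - p" and "v = n + 1 - i"
    have v: "n + 1 - v = i" "v + c - r = j" using p ij by (auto simp: r_def c_def v_def a_def)
    have lex: "v' < v \<or> v' = v \<and> c' + r < c + r'" if "v' \<in> T (r', c')" for v' r' c'
    proof -
      have "v' \<le> n" "r' \<le> v'"
        using svt_filling_memD[OF T(1) that] svt_filling_row_le_entry[OF T(1) that] by auto
      then show ?thesis using cell[OF that] v p by (auto simp: v_def r_def c_def)
    qed
    have right: "(r, Suc c) \<notin> shape T"
      using p up by (auto simp: T(3) grass_shape_def r_def c_def)
    have below: "(Suc r, c) \<notin> shape T"
    proof (cases "1 < p")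
      case True
      then show ?thesis using p up by (auto simp: T(3) grass_shape_def r_def c_def)
    next
      case False
      then have "p = 1" using p by simp
      then show ?thesis by (simp add: T(3) grass_shape_def r_def)
    qed
    have rcv: "1 \<le> r" "1 \<le> c" "1 \<le> v" "v \<le> n" using p ij by (auto simp: r_def c_def v_def)
    note ins = svt_filling_insert[OF T(1) rcv right below ideal[folded r_def c_def] lex]
    have "cells n (T((r, c) := insert v (T (r, c)))) = P"
      using ins(3) v T(2) ij by (auto simp: P'_def)
    then show ?thesis
      using ins(1,2) T(3) by (auto simp: r_def c_def)
  qed
  from u a(1) show ?case
  proof (cases rule: lstep_cases)
    case (stay k m)
    have km: "m \<le> n" "n < k" using grassmannian_descent[OF g, of m k] stay by auto
    have up: "u (m - 1) < a \<and> m - 1 \<le> u (m - 1)" if "1 < m"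
    proof -
      have "u (m - 1) + (m - (m - 1)) \<le> u m"
        by (rule grassmannian_low_diff[OF g]) (use that km in linarith)+
      then have "u (m - 1) < Suc a" using that stay by simp
      moreover have "u (m - 1) \<noteq> a"
        using is_perm_eq_iff[OF u, of "m - 1" k] stay km by auto
      moreover have "m - 1 \<le> u (m - 1)"
        by (rule grassmannian_ge[OF g]) (use that km in linarith)+
      ultimately show ?thesis by linarith
    qed
    then have ma: "m \<le> a" using a by (cases "1 < m") auto
    have "P' \<noteq> {}" using stay by (auto simp: u_def)
    have in_shape: "(n + 1 - m, a + 1 - m) \<in> grass_shape n u"
      using ma km stay by (auto simp: grass_shape_def)
    have "\<exists>T. svt_filling n T \<and> cells n T = P \<and> shape T = insert (n + 1 - m, a + 1 - m) (grass_shape n u)"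
    proof (rule extend)
      show "i \<le> n" using i_le \<open>P' \<noteq> {}\<close> .
      fix r' c' assume "1 \<le> r'" "r' \<le> n + 1 - m" "1 \<le> c'" "c' \<le> a + 1 - m"
      then show "(r', c') \<in> shape T" using grass_shape_ideal[OF g in_shape] T(3) by simp
    qed (use stay km ma up in auto)
    then show ?thesis using in_shape stay pdP by (simp add: insert_absorb)
  next
    case (swap k m)
    define w where "w = simple_transp a \<circ> u"
    have w: "pd_perm P = w" using swap pdP by (simp add: w_def)
    have "w k = Suc a" "w m = a" using swap by (simp_all add: w_def simple_transp_def)
    then have km: "k \<le> n" "n < m"
      using grassmannian_descent[of n w k m] first.prems w swap by auto
    have ka: "k \<le> a" using grassmannian_ge[OF g, of k] swap km by simp
    have "\<exists>T. svt_filling n T \<and> cells n T = P \<and> shape T = insert (n + 1 - k, a + 1 - k) (grass_shape n u)"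
    proof (rule extend)
      show "i \<le> n"
      \<comment> \<open>If no other cross exists, u is the identity and i \<le> a = k \<le> n.
        Otherwise the first cross lies weakly above crosses that are known to lie in rows up to
        n.\<close>
      proof (cases "P' = {}")
        case True
        then have "k = a" using swap by (simp add: u_def)
        then show ?thesis using a km by simp
      qed (rule i_le)
      show "u (k - 1) < a" if "1 < k"
      proof -
        have "u (k - 1) + (k - (k - 1)) \<le> u k"
          by (rule grassmannian_low_diff[OF g]) (use that km in linarith)+
        then show ?thesis using that swap by simp
      qed
      fix r' c' assume *: "1 \<le> r'" "r' \<le> n + 1 - k" "1 \<le> c'" "c' \<le> a + 1 - k"
        "(r', c') \<noteq> (n + 1 - k, a + 1 - k)"
      show "(r', c') \<in> shape T"
      proof (cases "r' = n + 1 - k")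
        case True
        then show ?thesis using * km ka swap by (auto simp: T(3) grass_shape_def)
      next
        case False
        define p where "p = n + 1 - r'"
        have p: "k < p" "p \<le> n" using * False by (auto simp: p_def)
        \<comment> \<open>The rows above reach far enough: \<open>u (Suc k)\<close> exceeds a and is
          not a + 1, whose position m is beyond n, so it is at least a + 2.\<close>
        have "u k + 1 \<le> u (Suc k)" using grassmannian_low_diff[OF g, of k "Suc k"] swap p by simp
        moreover have "u (Suc k) \<noteq> Suc a"
          using is_perm_eq_iff[OF u, of "Suc k" m] swap p km by auto
        moreover have "u (Suc k) + (p - Suc k) \<le> u p"
          using grassmannian_low_diff[OF g, of "Suc k" p] p by simp
        ultimately have "c' + p \<le> u p" using * p ka swap by simp
        moreover have "r' \<le> n" using * swap(4) by linarith
        ultimately show ?thesis using * by (auto simp: T(3) grass_shape_def p_def)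
      qed
    qed (use swap km ka in auto)
    moreover have "grass_shape n w = insert (n + 1 - k, a + 1 - k) (grass_shape n u)"
      unfolding w_def by (rule grassmannian_swap(2)[OF g]) (use swap km in auto)
    ultimately show ?thesis unfolding w by metis
  qed
qed

text \<open>The entry of the first cross sits in a corner (r, c) with n + c - r = a. If the box
  stays filled without this entry, the step by a must be idle; if it becomes empty, the step must
  add it again. The neighbours of (r, c) locate the values a and a + 1 accordingly.\<close>

lemma grassmannian_pd_perm_cells:
  assumes "svt_filling n T"
  shows "grassmannian n (pd_perm (cells n T)) \<and> shape T = grass_shape n (pd_perm (cells n T))"
proof -
  have "is_pipe_dream P \<Longrightarrow> svt_filling n T \<Longrightarrow> cells n T = P \<Longrightarrow>
      grassmannian n (pd_perm P) \<and> shape T = grass_shape n (pd_perm P)" for P T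
  proof (induction arbitrary: T rule: pipe_dream_induct)
    case empty
    then have "shape T = {}" by (simp add: cells_eq_empty_iff shape_def)
    then show ?case unfolding pd_perm_empty grass_shape_id using grassmannian_id by blast
  next
    case (first P i j)
    have T: "svt_filling n T" by fact
    obtain v r c where v: "v \<in> T (r, c)" and ij: "i = n + 1 - v" "j = v + c - r"
      and right: "(r, Suc c) \<notin> shape T" and below: "(Suc r, c) \<notin> shape T"
      and rem: "svt_filling n (T((r, c) := T (r, c) - {v}))"
        "cells n (T((r, c) := T (r, c) - {v})) = cells n T - {(i, j)}"
      using svt_filling_remove_first[OF T, of i j] first.hyps(2) first.prems(2) by blast
    define T' where "T' = T((r, c) := T (r, c) - {v})"
    define u where "u = pd_perm (P - {(i, j)})"
    define a where "a = n + c - r"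
    define p where "p = n + 1 - r"
    have vr: "1 \<le> r" "1 \<le> c" "r \<le> v" "v \<le> n"
      using svt_filling_memD[OF T v] svt_filling_row_le_entry[OF T v] by auto
    have p: "1 \<le> p" "p \<le> n" and pa: "p + c = a + 1" and pr: "n + 1 - p = r"
      using vr by (auto simp: p_def a_def)
    have IH: "grassmannian n u" "shape T' = grass_shape n u"
    proof -
      have "cells n T' = P - {(i, j)}" unfolding T'_def rem(2) first.prems(2) ..
      then show "grassmannian n u" "shape T' = grass_shape n u"
        using first.IH[of T'] rem(1) unfolding u_def T'_def by blast+
    qed
    have u: "is_perm u" using IH by (simp add: grassmannian_def)
    have shT: "shape T = insert (r, c) (shape T')" using v by (auto simp: shape_def T'_def)
    have "i + j - 1 = a" using vr by (simp add: ij a_def)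
    then have pdP: "pd_perm P = lstep a u"
      using pd_perm_first[OF first.hyps(1,2)] by (simp add: u_def)
    have a: "1 \<le> a" using vr by (simp add: a_def)
    obtain k m where km: "u k = a" "u m = Suc a" "1 \<le> k" "1 \<le> m"
      and stay: "m < k \<Longrightarrow> lstep a u = u" and swap: "k < m \<Longrightarrow> lstep a u = simple_transp a \<circ> u"
    proof -
      from u a show ?thesis
      proof (cases rule: lstep_cases)
        case (stay k m)
        then show ?thesis using that[of k m] by simp
      next
        case (swap k m)
        then show ?thesis using that[of k m] by simp
      qed
    qed
    have mem: "(n + 1 - q, c') \<in> shape T' \<longleftrightarrow> c' + q \<le> u q" if "1 \<le> q" "q \<le> n" "1 \<le> c'" for q c'
      using that by (auto simp: IH(2) grass_shape_def)
    show ?case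
    proof (cases "(r, c) \<in> shape T'")
      case True
      have "(r, Suc c) \<notin> shape T'" using right shT by blast
      then have "u p = Suc a" using True mem[of p c] mem[of p "Suc c"] p pr pa vr by auto
      then have pm: "p = m" using is_perm_eq_iff[OF u, of p m] km by simp
      \<comment> \<open>If a stood to the left of a + 1, it would sit at position m - 1, and row r +
        1 would reach column c, against \<open>below\<close>.\<close>
      have "m < k"
      proof (rule ccontr)
        assume "\<not> m < k"
        then have "k < m" using km by (cases "k = m") auto
        then have "u k + (m - 1 - k) \<le> u (m - 1)" "u (m - 1) + 1 \<le> u m"
          using grassmannian_low_diff[OF IH(1), of k "m - 1"]
            grassmannian_low_diff[OF IH(1), of "m - 1" m] km p pm by auto
        then have "u (m - 1) = a" "1 \<le> m - 1" using km \<open>k < m\<close> by auto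
        then have "(n + 1 - (m - 1), c) \<in> shape T'"
          using mem[of "m - 1" c] p pm pa vr by simp
        moreover have "n + 1 - (m - 1) = Suc r" using pm p pr \<open>1 \<le> m - 1\<close> by simp
        ultimately show False using below shT by auto
      qed
      then show ?thesis using IH True stay shT pdP by (simp add: insert_absorb)
    next
      case False
      then have lt: "u p < c + p" using mem[of p c] p pr vr by auto
      have "c - 1 + p \<le> u p"
      proof (cases "c = 1")
        case True
        then show ?thesis using grassmannian_ge[OF IH(1), of p] p by simp
      next
        case c1: False
        then have "(r, c - 1) \<in> shape T" using svt_filling_ideal[OF T v, of r "c - 1"] vr by simp
        then have "(r, c - 1) \<in> shape T'" using shT c1 vr by auto
        then show ?thesis using mem[of p "c - 1"] p pr vr c1 by simp
      qed
      then have "u p = a" using lt pa by simp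
      then have pk: "p = k" using is_perm_eq_iff[OF u, of p k] km by simp
      \<comment> \<open>If a + 1 stood among the first n positions, it would directly follow a, at k
        + 1, and row r - 1 would be too short to contain the box above (r, c).\<close>
      have nm: "n < m"
      proof (rule ccontr)
        assume "\<not> n < m"
        moreover have "k < m"
          using calculation grassmannian_low_diff[OF IH(1), of m k] km pk p by (cases "k < m") auto
        ultimately have "u k + 1 \<le> u (Suc k)" "u (Suc k) + (m - Suc k) \<le> u m"
          using grassmannian_low_diff[OF IH(1), of k "Suc k"]
            grassmannian_low_diff[OF IH(1), of "Suc k" m] km by auto
        then have sk: "u (Suc k) = Suc a" "Suc k \<le> n" using km \<open>k < m\<close> \<open>\<not> n < m\<close> by auto
        then have "(r - 1, c) \<in> shape T"
          using svt_filling_ideal[OF T v, of "r - 1" c] vr pk by (simp add: p_def)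
        moreover have "n + 1 - Suc k = r - 1" "r - 1 \<noteq> r" using pk pr vr by auto
        ultimately have "(n + 1 - Suc k, c) \<in> shape T'" using shT by auto
        then show False using mem[of "Suc k" c] sk vr pk pa by simp
      qed
      have "grassmannian n (simple_transp a \<circ> u)"
        "grass_shape n (simple_transp a \<circ> u) = insert (n + 1 - k, a + 1 - k) (grass_shape n u)"
        using grassmannian_swap[OF IH(1) km(1,2)] km(3) pk p nm by auto
      moreover have "(n + 1 - k, a + 1 - k) = (r, c)" using pk pr pa by auto
      moreover have "pd_perm P = simple_transp a \<circ> u" using swap pk p nm pdP by simp
      ultimately show ?thesis using shT IH(2) by (simp only: simp_thms)
    qed
  qed
  from this[OF is_pipe_dream_cells[OF assms] assms refl] show ?thesis .
qed

text \<open>Both fillings lose the same first cross, which fixes the entry and the diagonal. If the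
  two boxes differed, the right neighbour of the upper left one would be filled in the other
  filling, hence in both, although that box is a corner.\<close>

lemma cells_inj:
  assumes "svt_filling n T" "svt_filling n T'" "cells n T = cells n T'"
  shows "T = T'"
proof -
  have "is_pipe_dream P \<Longrightarrow> svt_filling n T1 \<Longrightarrow> svt_filling n T2 \<Longrightarrow> cells n T1 = P \<Longrightarrow> cells n T2 = P
     \<Longrightarrow> T1 = T2" for P T1 T2
  proof (induction arbitrary: T1 T2 rule: pipe_dream_induct)
    case empty
    then show ?case by (simp add: cells_eq_empty_iff fun_eq_iff)
  next
    case (first P i j)
    obtain v1 r1 c1 where 1: "v1 \<in> T1 (r1, c1)" "i = n + 1 - v1" "j = v1 + c1 - r1"
      "(r1, Suc c1) \<notin> shape T1" "(Suc r1, c1) \<notin> shape T1"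
      "svt_filling n (T1((r1, c1) := T1 (r1, c1) - {v1}))"
      "cells n (T1((r1, c1) := T1 (r1, c1) - {v1})) = cells n T1 - {(i, j)}"
      using svt_filling_remove_first[OF first.prems(1), of i j] first.hyps(2) first.prems(3) by blast
    obtain v2 r2 c2 where 2: "v2 \<in> T2 (r2, c2)" "i = n + 1 - v2" "j = v2 + c2 - r2"
      "(r2, Suc c2) \<notin> shape T2" "(Suc r2, c2) \<notin> shape T2"
      "svt_filling n (T2((r2, c2) := T2 (r2, c2) - {v2}))"
      "cells n (T2((r2, c2) := T2 (r2, c2) - {v2})) = cells n T2 - {(i, j)}"
      using svt_filling_remove_first[OF first.prems(2), of i j] first.hyps(2) first.prems(4) by blast
    have eq: "T1((r1, c1) := T1 (r1, c1) - {v1}) = T2((r2, c2) := T2 (r2, c2) - {v2})"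
      using first.IH[OF 1(6) 2(6) 1(7)[unfolded first.prems] 2(7)[unfolded first.prems]] .
    have b: "1 \<le> r1" "1 \<le> c1" "r1 \<le> v1" "v1 \<le> n" "1 \<le> r2" "1 \<le> c2" "r2 \<le> v2" "v2 \<le> n"
      using svt_filling_memD[OF first.prems(1) 1(1)] svt_filling_row_le_entry[OF first.prems(1) 1(1)]
        svt_filling_memD[OF first.prems(2) 2(1)] svt_filling_row_le_entry[OF first.prems(2) 2(1)] by auto
    have v: "v1 = v2" "c1 + r2 = c2 + r1" using b 1(2,3) 2(2,3) by auto
    have sh1: "x \<in> shape T1" if "x \<in> shape T2" "x \<noteq> (r2, c2)" for x
      using fun_cong[OF eq, of x] that by (auto simp: shape_def split: if_splits)
    have sh2: "x \<in> shape T2" if "x \<in> shape T1" "x \<noteq> (r1, c1)" for x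
      using fun_cong[OF eq, of x] that by (auto simp: shape_def split: if_splits)
    have "r1 = r2"
    proof (rule ccontr)
      assume "r1 \<noteq> r2"
      then consider "r1 < r2" "c1 < c2" | "r2 < r1" "c2 < c1" using v by linarith
      then show False
      proof cases
        case 1
        then show ?thesis
          using svt_filling_ideal[OF first.prems(2) 2(1), of r1 "Suc c1"] sh1[of "(r1, Suc c1)"]
            \<open>(r1, Suc c1) \<notin> shape T1\<close> b by auto
      next
        case 2
        then show ?thesis
          using svt_filling_ideal[OF first.prems(1) 1(1), of r2 "Suc c2"] sh2[of "(r2, Suc c2)"]
            \<open>(r2, Suc c2) \<notin> shape T2\<close> b by auto
      qed
    qed
    then have rc: "r1 = r2" "c1 = c2" using v by auto
    show ?case
    proof (rule ext)
      fix x
      show "T1 x = T2 x"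
        using fun_cong[OF eq, of x] 1(1) 2(1) v rc by (auto split: if_splits)
    qed
  qed
  from this[OF is_pipe_dream_cells[OF assms(1)] assms(1,2) refl assms(3)[symmetric]] show ?thesis .
qed

section \<open>Set-valued tableaux as fillings of a partition diagram\<close>

lemma part_entry_antimono:
  assumes "is_partition lam" "1 \<le> k" "k \<le> m"
  shows "part_entry lam m \<le> part_entry lam k"
  using assms sorted_wrt_nth_less[of "(\<ge>)" lam "k - 1" "m - 1"]
  by (cases "k = m") (auto simp: part_entry_def is_partition_def)

lemma diagram_conv_part_entry: "diagram lam = {(r, c). 1 \<le> r \<and> 1 \<le> c \<and> c \<le> part_entry lam r}"
  by (auto simp: diagram_def part_entry_def split: if_splits)

lemma finite_diagram [simp]: "finite (diagram lam)"
proof -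
  have "diagram lam = (SIGMA r:{1..length lam}. {1..lam ! (r - 1)})"
    by (auto simp: diagram_def)
  then show ?thesis by simp
qed

lemma is_svt_iff:
  assumes "is_partition lam"
  shows "is_svt n lam T \<longleftrightarrow> svt_filling n T \<and> shape T = diagram lam"
proof
  assume T: "is_svt n lam T"
  then have sh: "shape T = diagram lam" by (auto simp: shape_def is_svt_def)
  have ent: "T b \<subseteq> {1..n}" for b using T unfolding is_svt_def by blast
  then have fin: "finite (T b)" for b by (meson finite_atLeastAtMost finite_subset)
  have "svt_filling n T"
    unfolding svt_filling_def
  proof (intro conjI allI impI)
    show "finite (shape T)" by (simp add: sh)
    show "T b \<subseteq> {1..n}" for b by (rule ent)
    show "1 \<le> r" "1 \<le> c" if "(r, c) \<in> shape T" for r c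
      using that by (auto simp: sh diagram_def)
    show "(r', c') \<in> shape T"
      if "(r, c) \<in> shape T" "1 \<le> r'" "r' \<le> r" "1 \<le> c'" "c' \<le> c" for r c r' c'
      using part_entry_antimono[OF assms that(2,3)] that by (auto simp: sh diagram_conv_part_entry)
    show "v \<le> v'" if v: "v \<in> T (r, c)" "v' \<in> T (r, Suc c)" for r c v v'
    proof -
      have "v \<le> Max (T (r, c))" using fin v by simp
      also have "\<dots> \<le> Min (T (r, Suc c))"
        using T mem_shapeI[of v T] mem_shapeI[of v' T] v unfolding sh is_svt_def by blast
      also have "\<dots> \<le> v'" using fin v by simp
      finally show ?thesis .
    qed
    show "v < v'" if v: "v \<in> T (r, c)" "v' \<in> T (Suc r, c)" for r c v v'
    proof -
      have "v \<le> Max (T (r, c))" using fin v by simp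
      also have "\<dots> < Min (T (Suc r, c))"
        using T mem_shapeI[of v T] mem_shapeI[of v' T] v unfolding sh is_svt_def by blast
      also have "\<dots> \<le> v'" using fin v by simp
      finally show ?thesis .
    qed
  qed
  then show "svt_filling n T \<and> shape T = diagram lam" using sh by blast
next
  assume "svt_filling n T \<and> shape T = diagram lam"
  then have T: "svt_filling n T" and sh: "shape T = diagram lam" by auto
  have fin: "finite (T b)" for b by (rule svt_filling_finite[OF T])
  show "is_svt n lam T"
    unfolding is_svt_def
  proof (intro conjI allI impI ballI)
    show "T b = {}" if "b \<notin> diagram lam" for b using that by (simp add: sh[symmetric] shape_def)
    show ne: "T b \<noteq> {}" if "b \<in> diagram lam" for b using that by (simp add: sh[symmetric] shape_def)
    show "T b \<subseteq> {1..n}" for b using T unfolding svt_filling_def by blast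
    show "Max (T (r, c)) \<le> Min (T (r, Suc c))"
      if "(r, c) \<in> diagram lam \<and> (r, Suc c) \<in> diagram lam" for r c
    proof -
      have "Max (T (r, c)) \<in> T (r, c)" "Min (T (r, Suc c)) \<in> T (r, Suc c)"
        using fin ne that by (auto intro: Max_in Min_in)
      then show ?thesis using T unfolding svt_filling_def by blast
    qed
    show "Max (T (r, c)) < Min (T (Suc r, c))"
      if "(r, c) \<in> diagram lam \<and> (Suc r, c) \<in> diagram lam" for r c
    proof -
      have "Max (T (r, c)) \<in> T (r, c)" "Min (T (Suc r, c)) \<in> T (Suc r, c)"
        using fin ne that by (auto intro: Max_in Min_in)
      then show ?thesis using T unfolding svt_filling_def by blast
    qed
  qed
qed

lemma finite_is_svt: "finite {T. is_svt n lam T}"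
proof (rule finite_subset)
  show "{T. is_svt n lam T} \<subseteq>
      {T. \<forall>b. (b \<in> diagram lam \<longrightarrow> T b \<in> Pow {1..n}) \<and> (b \<notin> diagram lam \<longrightarrow> T b = {})}"
    by (auto simp: is_svt_def)
  show "finite {T. \<forall>b. (b \<in> diagram lam \<longrightarrow> T b \<in> Pow {1..n}) \<and> (b \<notin> diagram lam \<longrightarrow> T b = {})}"
    by (rule finite_set_of_finite_funs) auto
qed

text \<open>The shape fixes the values at positions up to n. Beyond n both permutations increase: at
  the first difference, the smaller value could occur in the other permutation only at a later
  position, after a larger value.\<close>

lemma grassmannian_eqI:
  assumes u: "grassmannian n u" and w: "grassmannian n w" and sh: "grass_shape n u = grass_shape n w"
  shows "u = w"
proof -
  have pu: "is_perm u" and pw: "is_perm w" using u w by (simp_all add: grassmannian_def)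
  have low: "u k = w k" if "k \<le> n" for k
  proof (cases "k = 0")
    case True
    then show ?thesis using pu pw by (simp add: is_perm_def)
  next
    case False
    have *: "c + k \<le> u k \<longleftrightarrow> c + k \<le> w k" if "1 \<le> c" for c
    proof -
      have "(n + 1 - k, c) \<in> grass_shape n u \<longleftrightarrow> (n + 1 - k, c) \<in> grass_shape n w" by (simp add: sh)
      then show ?thesis using that False \<open>k \<le> n\<close> by (auto simp: grass_shape_def)
    qed
    have "k \<le> u k" "k \<le> w k" using grassmannian_ge[OF u] grassmannian_ge[OF w] False that by auto
    then show ?thesis using *[of "u k - k"] *[of "w k - k"] by arith
  qed
  have wlog: "\<not> u k < w k"
    if g: "grassmannian n u" "grassmannian n w" "\<And>j. j < k \<Longrightarrow> u j = w j" "\<And>j. j \<le> n \<Longrightarrow> u j = w j" for u w k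
  proof
    assume less: "u k < w k"
    have pu: "is_perm u" and pw: "is_perm w" using g by (simp_all add: grassmannian_def)
    obtain k' where k': "w k' = u k" using pw bij_is_surj[of w] unfolding is_perm_def surj_def by metis
    have "\<not> k' < k" using g(3)[of k'] k' is_perm_eq_iff[OF pu, of k' k] by auto
    moreover have "k' \<noteq> k" using less k' by auto
    moreover have "n < k" using less g(4)[of k] by (cases "n < k") auto
    ultimately have "w k < w k'" using grassmannian_high_less[OF g(2)] by simp
    then show False using less k' by simp
  qed
  have "u k = w k" for k
  proof (induction k rule: less_induct)
    case (less k)
    then show ?case using wlog[OF u w, of k] wlog[OF w u, of k] low by (metis linorder_neqE_nat)
  qed
  then show ?thesis by blast
qed

section \<open>The permutation with prescribed Lehmer code\<close>

context
  fixes n :: nat and lam :: "nat list" and w :: "nat \<Rightarrow> nat"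
  assumes lam: "is_partition lam" and len: "length lam \<le> n" and w: "grassmannian_of n lam w"
begin

lemma grassmannian_of_perm: "is_perm w"
  using w by (simp add: grassmannian_of_def)

lemma lehmer_eq: "1 \<le> i \<Longrightarrow> lehmer w i = (if i \<le> n then part_entry lam (n + 1 - i) else 0)"
  using w by (simp add: grassmannian_of_def)

lemma finite_lehmer_set: "finite {j. i < j \<and> w j < w i}"
proof (rule finite_subset)
  show "{j. i < j \<and> w j < w i} \<subseteq> w -` {..<w i}" by auto
  show "finite (w -` {..<w i})"
    using grassmannian_of_perm by (intro finite_vimageI) (auto simp: is_perm_def bij_is_inj)
qed

text \<open>A descent at k makes the Lehmer code drop strictly from k to k + 1, whereas the given
  code is weakly increasing up to n and zero afterwards.\<close>

lemma grassmannian_of_grassmannian: "grassmannian n w"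
  unfolding grassmannian_def
proof (intro conjI allI impI grassmannian_of_perm)
  fix k assume k: "k \<ge> 1" "k \<noteq> n"
  show "w k < w (Suc k)"
  proof (rule ccontr)
    assume "\<not> w k < w (Suc k)"
    moreover have "w k \<noteq> w (Suc k)" using is_perm_eq_iff[OF grassmannian_of_perm] by simp
    ultimately have less: "w (Suc k) < w k" by simp
    have "lehmer w (Suc k) < lehmer w k"
      unfolding lehmer_def
    proof (rule psubset_card_mono[OF finite_lehmer_set])
      have "Suc k \<in> {j. k < j \<and> w j < w k} - {j. Suc k < j \<and> w j < w (Suc k)}"
        using less by simp
      moreover have "{j. Suc k < j \<and> w j < w (Suc k)} \<subseteq> {j. k < j \<and> w j < w k}"
        using less by auto
      ultimately show "{j. Suc k < j \<and> w j < w (Suc k)} \<subset> {j. k < j \<and> w j < w k}" by blast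
    qed
    moreover have "lehmer w k \<le> lehmer w (Suc k)"
      using part_entry_antimono[OF lam, of "n - k" "n + 1 - k"] k by (auto simp: lehmer_eq)
    ultimately show False by simp
  qed
qed

lemma grassmannian_of_value:
  assumes i: "1 \<le> i" "i \<le> n"
  shows "w i = i + part_entry lam (n + 1 - i)"
proof -
  have bij: "bij w" and w0: "w 0 = 0" using grassmannian_of_perm by (auto simp: is_perm_def)
  have less: "w j < w i" if "j < i" for j
  proof (cases "j = 0")
    case True
    then show ?thesis using is_perm_pos[OF grassmannian_of_perm i(1)] w0 by simp
  next
    case False
    then show ?thesis
      using grassmannian_low_diff[OF grassmannian_of_grassmannian, of j i] that i by simp
  qed
  \<comment> \<open>As 0 is both a position and a value, w i equals the number of positions with
    smaller value: the i positions before i, and those counted by the Lehmer code.\<close>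
  have "w ` {j. w j < w i} = {..<w i}"
    using bij_is_surj[OF bij] by (force simp: surj_def)
  then have "w i = card {j. w j < w i}"
    using card_image[OF inj_on_subset[OF bij_is_inj[OF bij]], of "{j. w j < w i}"] by simp
  also have "{j. w j < w i} = {..<i} \<union> {j. i < j \<and> w j < w i}"
    using less by (force simp: not_less le_less)
  also have "card \<dots> = i + lehmer w i"
    unfolding lehmer_def by (subst card_Un_disjoint) (auto simp: finite_lehmer_set)
  finally show ?thesis using i lehmer_eq by simp
qed

lemma grassmannian_of_shape: "grass_shape n w = diagram lam"
proof -
  have "(r, c) \<in> grass_shape n w \<longleftrightarrow> (r, c) \<in> diagram lam" for r c
  proof (cases "1 \<le> r \<and> r \<le> n")
    case True
    then have "w (n + 1 - r) = n + 1 - r + part_entry lam r"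
      using grassmannian_of_value[of "n + 1 - r"] by auto
    then show ?thesis using True by (auto simp: grass_shape_def diagram_conv_part_entry)
  next
    case False
    then show ?thesis using len by (auto simp: grass_shape_def diagram_def)
  qed
  then show ?thesis by auto
qed

lemma grassmannian_of_inv_count: "inv_count w = sum_list lam"
proof -
  have "{(i, j). 0 < i \<and> i < j \<and> w j < w i} = (SIGMA i:{1..n}. {j. i < j \<and> w j < w i})"
  proof -
    have "i \<le> n" if "0 < i" "i < j" "w j < w i" for i j
    proof (rule ccontr)
      assume "\<not> i \<le> n"
      then have "card {j. i < j \<and> w j < w i} = 0"
        using lehmer_eq[of i] that by (simp add: lehmer_def)
      then show False using finite_lehmer_set[of i] that by auto
    qed
    then show ?thesis by force
  qed
  then have "inv_count w = (\<Sum>i\<in>{1..n}. lehmer w i)"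
    unfolding inv_count_def lehmer_def by (simp add: finite_lehmer_set)
  also have "\<dots> = (\<Sum>i\<in>{1..n}. part_entry lam (n + 1 - i))"
    by (intro sum.cong) (auto simp: lehmer_eq)
  also have "\<dots> = (\<Sum>r\<in>{1..n}. part_entry lam r)"
    by (rule sum.reindex_bij_witness[of _ "\<lambda>r. n + 1 - r" "\<lambda>r. n + 1 - r"]) auto
  also have "\<dots> = (\<Sum>r\<in>{1..length lam}. lam ! (r - 1))"
    using len by (intro sum.mono_neutral_cong_right) (auto simp: part_entry_def)
  also have "\<dots> = (\<Sum>k<length lam. lam ! k)"
    by (rule sum.reindex_bij_witness[of _ Suc "\<lambda>r. r - 1"]) auto
  finally show ?thesis by (simp add: sum_list_sum_nth atLeast0LessThan)
qed

lemma PD_grassmannian: "PD w = cells n ` {T. is_svt n lam T}"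
proof (intro equalityI subsetI)
  fix P assume "P \<in> PD w"
  then have P: "is_pipe_dream P" "pd_perm P = w" by (simp_all add: PD_def)
  then obtain T where "svt_filling n T" "cells n T = P" "shape T = diagram lam"
    using ex_svt_filling_of_pipe_dream[OF P(1)] grassmannian_of_grassmannian grassmannian_of_shape P(2) by metis
  then show "P \<in> cells n ` {T. is_svt n lam T}" by (auto simp: is_svt_iff[OF lam])
next
  fix P assume "P \<in> cells n ` {T. is_svt n lam T}"
  then obtain T where T: "svt_filling n T" "shape T = diagram lam" "P = cells n T"
    by (auto simp: is_svt_iff[OF lam])
  then have "pd_perm P = w"
    using grassmannian_pd_perm_cells[OF T(1)] grassmannian_of_shape grassmannian_of_grassmannian
    by (intro grassmannian_eqI) auto
  then show "P \<in> PD w" using is_pipe_dream_cells[OF T(1)] T by (simp add: PD_def)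
qed

lemma groth_grassmannian:
  fixes \<beta> :: "'a::comm_ring_1" and x :: "nat \<Rightarrow> 'a"
  shows "groth w \<beta> x = (\<Sum>T | is_svt n lam T. \<beta> ^ (svt_size lam T - sum_list lam) *
           (\<Prod>b\<in>diagram lam. \<Prod>v\<in>T b. x (n + 1 - v)))"
proof -
  have "inj_on (cells n) {T. is_svt n lam T}"
    using cells_inj by (auto simp: is_svt_iff[OF lam] intro!: inj_onI)
  then have "groth w \<beta> x = (\<Sum>T | is_svt n lam T. \<beta> ^ (card (cells n T) - sum_list lam) *
               (\<Prod>(i, j)\<in>cells n T. x i))"
    unfolding groth_def PD_grassmannian grassmannian_of_inv_count by (simp add: sum.reindex)
  also have "\<dots> = (\<Sum>T | is_svt n lam T. \<beta> ^ (svt_size lam T - sum_list lam) *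
           (\<Prod>b\<in>diagram lam. \<Prod>v\<in>T b. x (n + 1 - v)))"
  proof (rule sum.cong[OF refl])
    fix T assume "T \<in> {T. is_svt n lam T}"
    then have T: "svt_filling n T" "shape T = diagram lam" by (simp_all add: is_svt_iff[OF lam])
    note fin = svt_filling_finite[OF T(1)]
    have "card (cells n T) = card (Sigma (diagram lam) T)"
      unfolding cells_conv_image T(2)[symmetric] by (rule card_image[OF inj_on_cell[OF T(1)]])
    also have "\<dots> = svt_size lam T" unfolding svt_size_def using fin by simp
    finally have card: "card (cells n T) = svt_size lam T" .
    have "(\<Prod>(i, j)\<in>cells n T. x i) = (\<Prod>(b, v)\<in>Sigma (diagram lam) T. x (n + 1 - v))"
      unfolding cells_conv_image T(2) prod.reindex[OF inj_on_cell[OF T(1), unfolded T(2)]]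
      by (intro prod.cong) auto
    also have "\<dots> = (\<Prod>b\<in>diagram lam. \<Prod>v\<in>T b. x (n + 1 - v))"
      using fin by (subst prod.Sigma) auto
    finally show "\<beta> ^ (card (cells n T) - sum_list lam) * (\<Prod>(i, j)\<in>cells n T. x i) =
        \<beta> ^ (svt_size lam T - sum_list lam) * (\<Prod>b\<in>diagram lam. \<Prod>v\<in>T b. x (n + 1 - v))"
      using card by simp
  qed
  finally show ?thesis .
qed

end

section \<open>Chains of sets and glides\<close>

text \<open>\<open>L k\<close> is the set that replaces the k-th entry of a merged tableau, and
  \<open>blk k\<close> is the value of that entry. Fixing \<open>L k\<close> to be empty from N on
  makes the function determined by its first N sets.\<close>

definition chains :: "nat \<Rightarrow> nat \<Rightarrow> (nat \<Rightarrow> nat) \<Rightarrow> (nat \<Rightarrow> nat set) set" where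
  "chains n N blk = {L. (\<forall>k\<ge>N. L k = {}) \<and> (\<forall>k<N. L k \<noteq> {} \<and> L k \<subseteq> {1..n}) \<and>
     (\<forall>k k' v v'. k < k' \<longrightarrow> k' < N \<longrightarrow> v \<in> L k \<longrightarrow> v' \<in> L k' \<longrightarrow>
        v \<le> v' \<and> (blk k \<noteq> blk k' \<longrightarrow> v < v'))}"

definition occ :: "(nat \<Rightarrow> nat set) \<Rightarrow> nat \<Rightarrow> nat" where
  "occ L v = card {k. v \<in> L k}"

definition overlaps :: "(nat \<Rightarrow> nat set) \<Rightarrow> nat set" where
  "overlaps L = {v. \<exists>k. v \<in> L k \<and> v < Max (L k)}"

text \<open>Glides indexed by values \<^term>\<open>v = n + 1 - k\<close> instead of positions \<^term>\<open>k\<close>: the thresholds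
  \<^term>\<open>t\<close> are the cut points \<^term>\<open>i\<close> read from the other end, so that ``first nonzero'' becomes
  ``last nonzero''.\<close>

definition value_glide :: "nat \<Rightarrow> nat \<Rightarrow> (nat \<Rightarrow> nat) \<Rightarrow> (nat \<Rightarrow> nat) \<Rightarrow> nat set \<Rightarrow> bool" where
  "value_glide n l D c S \<longleftrightarrow> (\<forall>v. v \<notin> {1..n} \<longrightarrow> c v = 0) \<and> (\<forall>v\<in>S. 0 < c v) \<and>
     (\<exists>t. 1 \<le> t 1 \<and> t (Suc l) = n + 1 \<and> (\<forall>q\<in>{1..l}. t q < t (Suc q)) \<and> (\<forall>v<t 1. c v = 0) \<and>
       (\<forall>q\<in>{1..l}.
          (\<Sum>v\<in>{t q..<t (Suc q)}. c v) = D q - D (q - 1) + card (S \<inter> {t q..<t (Suc q)}) \<and>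
          (\<exists>v\<in>{t q..<t (Suc q)}. 0 < c v \<and> v \<notin> S \<and> (\<forall>v'\<in>{v<..<t (Suc q)}. c v' = 0))))"

lemma down_closed_eq_lessThan:
  fixes A :: "nat set"
  assumes "finite A" "\<And>x y. x \<in> A \<Longrightarrow> y < x \<Longrightarrow> y \<in> A"
  shows "A = {..<card A}"
proof -
  define m where "m = (LEAST m. m \<notin> A)"
  have "\<exists>m. m \<notin> A" using assms(1) by (metis ex_new_if_finite infinite_UNIV_nat)
  then have "m \<notin> A" unfolding m_def by (rule LeastI_ex)
  moreover have "y \<in> A" if "y < m" for y using not_less_Least that unfolding m_def by blast
  ultimately have "A = {..<m}" using assms(2) by (metis lessThan_iff linorder_neqE_nat subsetI subset_antisym)
  then show ?thesis by simp
qed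

text \<open>In the application block q consists of the ranks of the entries of value q, and
  \<open>D q\<close> counts the entries of value at most q.\<close>

locale composition_blocks =
  fixes n l N :: nat and D blk :: "nat \<Rightarrow> nat"
  assumes D0: "D 0 = 0" and DN: "D l = N"
    and D_less: "\<And>q. q < l \<Longrightarrow> D q < D (Suc q)"
    and blk: "\<And>k. k < N \<Longrightarrow> 1 \<le> blk k \<and> blk k \<le> l \<and> D (blk k - 1) \<le> k \<and> k < D (blk k)"
begin

lemma D_mono: "q \<le> q' \<Longrightarrow> q' \<le> l \<Longrightarrow> D q \<le> D q'"
proof (induction q' rule: dec_induct)
  case (step q')
  then show ?case using D_less[of q'] by simp
qed simp

lemma D_pred: "1 \<le> q \<Longrightarrow> q \<le> l \<Longrightarrow> D (q - 1) < D q"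
  using D_less[of "q - 1"] by (cases q) auto

lemma blk_eqI: "1 \<le> q \<Longrightarrow> q \<le> l \<Longrightarrow> D (q - 1) \<le> k \<Longrightarrow> k < D q \<Longrightarrow> blk k = q"
proof -
  assume q: "1 \<le> q" "q \<le> l" "D (q - 1) \<le> k" "k < D q"
  then have "k < N" using D_mono[of q l] DN by simp
  then have b: "1 \<le> blk k" "blk k \<le> l" "D (blk k - 1) \<le> k" "k < D (blk k)" using blk by auto
  have "\<not> q < blk k"
  proof
    assume "q < blk k"
    then have "D q \<le> D (blk k - 1)" using b by (intro D_mono) linarith+
    then show False using b q by simp
  qed
  moreover have "\<not> blk k < q"
  proof
    assume "blk k < q"
    then have "D (blk k) \<le> D (q - 1)" using q by (intro D_mono) linarith+
    then show False using b q by simp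
  qed
  ultimately show ?thesis by simp
qed

context
  fixes L :: "nat \<Rightarrow> nat set"
  assumes L: "L \<in> chains n N blk"
begin

lemma chain_lt: "v \<in> L k \<Longrightarrow> k < N"
  using L unfolding chains_def by (metis (mono_tags, lifting) mem_Collect_eq empty_iff not_less)

lemma chain_range: "v \<in> L k \<Longrightarrow> 1 \<le> v \<and> v \<le> n"
proof -
  assume v: "v \<in> L k"
  then have "L k \<subseteq> {1..n}" using L chain_lt[OF v] unfolding chains_def by blast
  then show ?thesis using v by auto
qed

lemma chain_nonempty: "k < N \<Longrightarrow> L k \<noteq> {}"
  using L unfolding chains_def by blast

lemma chain_finite: "finite (L k)"
  by (rule finite_subset[of _ "{1..n}"]) (use chain_range in auto)

lemma chain_le: "v \<in> L k \<Longrightarrow> v' \<in> L k' \<Longrightarrow> k < k' \<Longrightarrow> v \<le> v'"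
  using L chain_lt[of v' k'] unfolding chains_def by blast

lemma chain_less: "v \<in> L k \<Longrightarrow> v' \<in> L k' \<Longrightarrow> k < k' \<Longrightarrow> blk k \<noteq> blk k' \<Longrightarrow> v < v'"
  using L chain_lt[of v' k'] unfolding chains_def by blast

lemma Max_mem: "k < N \<Longrightarrow> Max (L k) \<in> L k"
  using chain_nonempty chain_finite by (simp add: Max_in)

lemma Min_mem: "k < N \<Longrightarrow> Min (L k) \<in> L k"
  using chain_nonempty chain_finite by (simp add: Min_in)

lemma le_Max: "v \<in> L k \<Longrightarrow> v \<le> Max (L k)"
  using chain_finite by simp

lemma Min_le_mem: "v \<in> L k \<Longrightarrow> Min (L k) \<le> v"
  using chain_finite by simp

lemma finite_occ: "finite {k. v \<in> L k}"
  by (rule finite_subset[of _ "{..<N}"]) (use chain_lt in auto)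

lemma overlaps_range: "v \<in> overlaps L \<Longrightarrow> v \<in> {1..n}"
  using chain_range by (auto simp: overlaps_def)

text \<open>A value is non-maximal in at most one set: of two such sets the earlier would have a
  maximum above v, although v lies in the later one. Every other occurrence is a set ending in
  v.\<close>

lemma occ_eq: "occ L v = card {k. k < N \<and> Max (L k) = v} + (if v \<in> overlaps L then 1 else 0)"
proof -
  define A B where "A = {k. k < N \<and> Max (L k) = v}" and "B = {k. v \<in> L k \<and> v < Max (L k)}"
  have fin: "finite A" "finite B"
    by (auto simp: A_def B_def intro: finite_subset[OF _ finite_occ[of v]])
  have "{k. v \<in> L k} = A \<union> B"
    using Max_mem le_Max chain_lt by (fastforce simp: A_def B_def)
  moreover have "A \<inter> B = {}" by (auto simp: A_def B_def)
  ultimately have "occ L v = card A + card B"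
    using fin by (simp add: occ_def card_Un_disjoint)
  moreover have "card B = (if v \<in> overlaps L then 1 else 0)"
  proof (cases "v \<in> overlaps L")
    case True
    then obtain k where k: "k \<in> B" by (auto simp: overlaps_def B_def)
    have "k' = k" if "k' \<in> B" for k'
    proof (rule ccontr)
      assume "k' \<noteq> k"
      then have "k' < k \<or> k < k'" by linarith
      then show False
        using chain_le[of "Max (L k')" k' v k] chain_le[of "Max (L k)" k v k'] k that
          Max_mem chain_lt by (fastforce simp: B_def)
    qed
    then have "B = {k}" using k by blast
    then show ?thesis using True by simp
  next
    case False
    then have "B = {}" by (auto simp: overlaps_def B_def)
    then show ?thesis using False by simp
  qed
  ultimately show ?thesis by (simp add: A_def)
qed

lemma sum_occ:
  assumes "finite V"
  shows "(\<Sum>v\<in>V. occ L v) = card {k. k < N \<and> Max (L k) \<in> V} + card (overlaps L \<inter> V)"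
proof -
  have "(\<Sum>v\<in>V. occ L v) = (\<Sum>v\<in>V. card {k \<in> {..<N}. Max (L k) = v}) + (\<Sum>v\<in>V. if v \<in> overlaps L then 1 else 0)"
    by (simp add: occ_eq sum.distrib)
  also have "(\<Sum>v\<in>V. if v \<in> overlaps L then 1 else 0) = card (overlaps L \<inter> V)"
    using assms by (simp add: sum.If_cases Int_commute)
  also have "(\<Sum>v\<in>V. card {k \<in> {..<N}. Max (L k) = v}) = card (\<Union>v\<in>V. {k \<in> {..<N}. Max (L k) = v})"
    using assms by (intro card_UN_disjoint[symmetric]) auto
  also have "(\<Union>v\<in>V. {k \<in> {..<N}. Max (L k) = v}) = {k. k < N \<and> Max (L k) \<in> V}" by auto
  finally show ?thesis .
qed

lemma sum_occ_all: "(\<Sum>v\<in>{1..n}. occ L v) = N + card (overlaps L)"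
proof -
  have "{k. k < N \<and> Max (L k) \<in> {1..n}} = {..<N}"
    using chain_range[OF Max_mem] by auto
  moreover have "overlaps L \<inter> {1..n} = overlaps L" using overlaps_range by blast
  ultimately show ?thesis using sum_occ[of "{1..n}"] by simp
qed

text \<open>By \<open>sum_occ\<close> the lower bound counts the sets lying entirely below v; these
  form an initial segment \<open>A\<close> of the indices, as do the sets \<open>B\<close> whose
  minimum is at most v. If v occurs at all, every index in \<open>B\<close> but not in
  \<open>A\<close> carries v: before a set containing v the maximum is at most v, after it the
  minimum is at least v.\<close>

lemma chain_mem_iff:
  "v \<in> L k \<longleftrightarrow> (\<Sum>u<v. occ L u) - card (overlaps L \<inter> {..<v}) \<le> k \<and>
     k < (\<Sum>u<v. occ L u) - card (overlaps L \<inter> {..<v}) + occ L v"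
proof (cases "occ L v = 0")
  case True
  then have "v \<notin> L k" using finite_occ[of v] by (auto simp: occ_def)
  then show ?thesis using True by simp
next
  case False
  then obtain k0 where k0: "v \<in> L k0" unfolding occ_def by (metis card.empty empty_Collect_eq)
  define A B where "A = {k. k < N \<and> Max (L k) < v}" and "B = {k. k < N \<and> Min (L k) \<le> v}"
  have "finite A" "finite B" by (auto simp: A_def B_def)
  have "y \<in> A" if "x \<in> A" "y < x" for x y
    using chain_le[of "Max (L y)" y "Max (L x)" x] Max_mem that by (force simp: A_def)
  then obtain a where A: "A = {..<a}" using down_closed_eq_lessThan \<open>finite A\<close> by metis
  have "y \<in> B" if "x \<in> B" "y < x" for x y
    using chain_le[of "Min (L y)" y "Min (L x)" x] Min_mem that by (force simp: B_def)
  then obtain b where B: "B = {..<b}" using down_closed_eq_lessThan \<open>finite B\<close> by metis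
  have "v \<in> L k \<longleftrightarrow> k \<in> B - A" for k
  proof
    assume "v \<in> L k"
    then show "k \<in> B - A" using le_Max Min_le_mem chain_lt by (fastforce simp: A_def B_def)
  next
    assume k: "k \<in> B - A"
    then have k': "k < N" "Min (L k) \<le> v" "v \<le> Max (L k)" by (auto simp: A_def B_def)
    consider "k < k0" | "k = k0" | "k0 < k" by linarith
    then show "v \<in> L k"
    proof cases
      case 1
      then have "Max (L k) = v" using chain_le[OF Max_mem k0] k' by (simp add: antisym)
      then show ?thesis using Max_mem k' by blast
    next
      case 3
      then have "Min (L k) = v" using chain_le[OF k0 Min_mem] k' by (simp add: antisym)
      then show ?thesis using Min_mem k' by blast
    qed (use k0 in simp)
  qed
  then have eq: "v \<in> L k \<longleftrightarrow> a \<le> k \<and> k < b" for k using A B by auto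
  have "{k. v \<in> L k} = {a..<b}" by (intro set_eqI) (simp only: mem_Collect_eq eq atLeastLessThan_iff)
  then have "occ L v = b - a" by (simp add: occ_def)
  moreover have "(\<Sum>u<v. occ L u) - card (overlaps L \<inter> {..<v}) = a"
    using sum_occ[of "{..<v}"] A by (simp add: A_def)
  ultimately show ?thesis using False eq by auto
qed

lemma value_glide_of_chain: "value_glide n l D (occ L) (overlaps L)"
proof -
  \<comment> \<open>A block starts at the least element of its first set. Strictness between blocks
    makes this value separate the block from all earlier ones, which is \<open>t_le\<close>.\<close>
  define t where "t q = (if q = Suc l then n + 1 else Min (L (D (q - 1))))" for q
  have Dlt: "D (q - 1) < N" if "1 \<le> q" "q \<le> l" for q
    using D_mono[of q l] D_pred[of q] DN that by simp
  have t_le: "t q \<le> v \<longleftrightarrow> D (q - 1) \<le> k" if v: "v \<in> L k" and q: "1 \<le> q" "q \<le> Suc l" for q k v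
  proof (cases "q = Suc l")
    case True
    then show ?thesis using chain_range[OF v] chain_lt[OF v] DN by (auto simp: t_def)
  next
    case False
    then have q': "q \<le> l" and t: "t q = Min (L (D (q - 1)))" using q by (auto simp: t_def)
    note d = Dlt[OF q(1) q']
    have bd: "blk (D (q - 1)) = q"
      using q q' D_pred[of q] by (intro blk_eqI) auto
    consider "k < D (q - 1)" | "k = D (q - 1)" | "D (q - 1) < k" by linarith
    then show ?thesis
    proof cases
      case 1
      have "blk k \<noteq> q" using blk[OF chain_lt[OF v]] 1 by auto
      then have "v < t q" using chain_less[OF v Min_mem[OF d] 1] bd t by simp
      then show ?thesis using 1 by simp
    next
      case 2
      then show ?thesis using Min_le_mem[OF v] t by simp
    next
      case 3
      then show ?thesis using chain_le[OF Min_mem[OF d] v] t by simp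
    qed
  qed
  have occ_pos: "0 < occ L v \<longleftrightarrow> (\<exists>k. v \<in> L k)" for v
    using finite_occ[of v] by (auto simp: occ_def card_gt_0_iff)
  show ?thesis
    unfolding value_glide_def
  proof (intro conjI exI[of _ t] ballI allI impI)
    show "occ L v = 0" if "v \<notin> {1..n}" for v
      using occ_pos[of v] chain_range that by auto
    show "0 < occ L v" if "v \<in> overlaps L" for v
      using that by (auto simp: occ_pos overlaps_def)
    show "t (Suc l) = n + 1" by (simp add: t_def)
    show "1 \<le> t 1"
    proof (cases "l = 0")
      case False
      then have "0 < N" using Dlt[of 1] by simp
      then have "Min (L 0) \<in> L 0" by (rule Min_mem)
      then show ?thesis using False chain_range[of "Min (L 0)" 0] by (simp add: t_def D0)
    qed (simp add: t_def)
    show "t q < t (Suc q)" if "q \<in> {1..l}" for q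
    proof -
      have q: "1 \<le> q" "q \<le> l" using that by auto
      have "t q = Min (L (D (q - 1)))" using q by (simp add: t_def)
      moreover have "\<not> D q \<le> D (q - 1)" using D_pred[of q] q by simp
      ultimately show ?thesis
        using t_le[OF Min_mem[OF Dlt[OF q]], of "Suc q"] q by simp
    qed
    show "occ L v = 0" if "v < t 1" for v
      using t_le[of v _ 1] that occ_pos[of v] D0 by fastforce
    fix q assume "q \<in> {1..l}"
    then have q: "1 \<le> q" "q \<le> l" by auto
    have Dq: "D (q - 1) < D q" "D q \<le> N" using D_pred[of q] D_mono[of q l] DN q by auto
    have blk_iff: "Max (L k) \<in> {t q..<t (Suc q)} \<longleftrightarrow> D (q - 1) \<le> k \<and> k < D q" if "k < N" for k
      using t_le[OF Max_mem[OF that], of q] t_le[OF Max_mem[OF that], of "Suc q"] q by auto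
    have "k < N \<and> Max (L k) \<in> {t q..<t (Suc q)} \<longleftrightarrow> k \<in> {D (q - 1)..<D q}" for k
      using blk_iff[of k] Dq by (cases "k < N") auto
    then have "{k. k < N \<and> Max (L k) \<in> {t q..<t (Suc q)}} = {D (q - 1)..<D q}"
      by blast
    then show "(\<Sum>v\<in>{t q..<t (Suc q)}. occ L v) =
        D q - D (q - 1) + card (overlaps L \<inter> {t q..<t (Suc q)})"
      by (simp add: sum_occ)
    \<comment> \<open>The last set of block q ends in the largest value of the block. This value is
      black: a set containing it with a larger maximum cannot belong to a later block, nor can it
      precede index e.\<close>
    define e where "e = D q - 1"
    have e: "e < N" "D (q - 1) \<le> e" "e < D q" using Dq by (auto simp: e_def)
    show "\<exists>v\<in>{t q..<t (Suc q)}. 0 < occ L v \<and> v \<notin> overlaps L \<and> (\<forall>v'\<in>{v<..<t (Suc q)}. occ L v' = 0)"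
    proof (intro bexI[of _ "Max (L e)"] conjI ballI)
      show "Max (L e) \<in> {t q..<t (Suc q)}" using blk_iff e by blast
      show "0 < occ L (Max (L e))" using Max_mem e occ_pos by blast
      show "Max (L e) \<notin> overlaps L"
      proof
        assume "Max (L e) \<in> overlaps L"
        then obtain k where k: "Max (L e) \<in> L k" "Max (L e) < Max (L k)" by (auto simp: overlaps_def)
        have "\<not> D q \<le> k"
          using t_le[OF k(1), of "Suc q"] t_le[OF Max_mem[OF e(1)], of "Suc q"] e q by simp
        then have "k < e" using k by (cases "k = e") (auto simp: e_def)
        then show False using chain_le[OF Max_mem[OF chain_lt[OF k(1)]] Max_mem[OF e(1)]] k by simp
      qed
      show "occ L v' = 0" if "v' \<in> {Max (L e)<..<t (Suc q)}" for v'
      proof (rule ccontr)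
        assume "occ L v' \<noteq> 0"
        then obtain k where k: "v' \<in> L k" using occ_pos[of v'] by auto
        then have "\<not> D q \<le> k" using t_le[OF k, of "Suc q"] that q by simp
        then have "k \<le> e" by (auto simp: e_def)
        then have "v' \<le> Max (L e)"
          using le_Max[of v' e] chain_le[OF k Max_mem[OF e(1)]] k by (cases "k = e") auto
        then show False using that by simp
      qed
    qed
  qed
qed

end

lemma chain_inj:
  assumes "L \<in> chains n N blk" "L' \<in> chains n N blk" "occ L = occ L'" "overlaps L = overlaps L'"
  shows "L = L'"
proof (rule ext, rule set_eqI)
  show "v \<in> L k \<longleftrightarrow> v \<in> L' k" for k v
    unfolding chain_mem_iff[OF assms(1)] chain_mem_iff[OF assms(2)] assms(3,4) ..
qed

text \<open>By \<open>chain_mem_iff\<close> the chain is forced: v occupies the c v consecutive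
  indices from \<open>F v\<close> on. A black value stops before \<open>F (Suc v)\<close>, while a
  red one also takes the index \<open>F (Suc v)\<close> and shares it with the next occurring
  value.\<close>

lemma ex_chain_of_value_glide:
  assumes "value_glide n l D c S"
  shows "\<exists>L\<in>chains n N blk. occ L = c \<and> overlaps L = S"
proof -
  have c0: "\<And>v. v \<notin> {1..n} \<Longrightarrow> c v = 0" and S: "\<And>v. v \<in> S \<Longrightarrow> 0 < c v"
    using assms unfolding value_glide_def by blast+
  obtain t where t_last: "t (Suc l) = n + 1" and below: "\<And>v. v < t 1 \<Longrightarrow> c v = 0"
    and t: "\<forall>q\<in>{1..l}. t q < t (Suc q)"
      "\<forall>q\<in>{1..l}. (\<Sum>v\<in>{t q..<t (Suc q)}. c v) = D q - D (q - 1) + card (S \<inter> {t q..<t (Suc q)}) \<and>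
         (\<exists>v\<in>{t q..<t (Suc q)}. 0 < c v \<and> v \<notin> S \<and> (\<forall>v'\<in>{v<..<t (Suc q)}. c v' = 0))"
    using assms unfolding value_glide_def by blast
  have t_less: "t q < t (Suc q)"
    and block: "(\<Sum>v\<in>{t q..<t (Suc q)}. c v) = D q - D (q - 1) + card (S \<inter> {t q..<t (Suc q)})"
    and black: "\<exists>v\<in>{t q..<t (Suc q)}. 0 < c v \<and> v \<notin> S \<and> (\<forall>v'\<in>{v<..<t (Suc q)}. c v' = 0)"
    if "1 \<le> q" "q \<le> l" for q
    using t that by auto
  define g where "g v = c v - (if v \<in> S then 1 else 0)" for v
  define F where "F v = (\<Sum>u<v. g u)" for v
  define L where "L k = {v. F v \<le> k \<and> k < F v + c v}" for k
  have cg: "c v = g v + (if v \<in> S then 1 else 0)" for v using S[of v] by (auto simp: g_def)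
  have F_Suc: "F (Suc v) = F v + g v" for v by (simp add: F_def)
  have F_mono: "u \<le> v \<Longrightarrow> F u \<le> F v" for u v
    unfolding F_def by (intro sum_mono2) auto
  \<comment> \<open>A block sum without its red surplus is the length of the block, so the partial
    sums of g at the thresholds are those of the composition.\<close>
  have F_t: "F (t q) = D (q - 1)" if "1 \<le> q" "q \<le> Suc l" for q
    using that
  proof (induction q rule: dec_induct)
    case base
    have "F (t 1) = 0" unfolding F_def using below by (simp add: g_def)
    then show ?case by (simp add: D0)
  next
    case (step q)
    then have q: "1 \<le> q" "q \<le> l" by auto
    have "D q - D (q - 1) + card (S \<inter> {t q..<t (Suc q)}) =
        (\<Sum>v\<in>{t q..<t (Suc q)}. g v) + card (S \<inter> {t q..<t (Suc q)})"
      unfolding block[OF q, symmetric] by (simp add: cg sum.distrib sum.If_cases Int_commute)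
    then have "(\<Sum>v\<in>{t q..<t (Suc q)}. g v) = D q - D (q - 1)" by simp
    moreover have "F (t (Suc q)) = F (t q) + (\<Sum>v\<in>{t q..<t (Suc q)}. g v)"
    proof -
      have "{..<t (Suc q)} = {..<t q} \<union> {t q..<t (Suc q)}" using t_less[OF q] by auto
      then show ?thesis
        unfolding F_def by (simp add: sum.union_disjoint[symmetric] ivl_disj_int)
    qed
    moreover have "D (q - 1) \<le> D q" using q by (intro D_mono) auto
    ultimately show ?case using step.IH q by simp
  qed
  have F_end: "F (n + 1) = N" using F_t[of "Suc l"] t_last DN by simp
  have find_block: "\<exists>q. 1 \<le> q \<and> q \<le> l \<and> t q \<le> v \<and> v < t (Suc q)" if "0 < c v" for v
  proof -
    have v: "t 1 \<le> v" "v < t (Suc l)"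
    proof -
      have "v \<in> {1..n}" by (rule ccontr) (use c0[of v] that in simp)
      then show "v < t (Suc l)" using t_last by simp
      show "t 1 \<le> v" by (rule ccontr) (use below[of v] that in simp)
    qed
    have "\<exists>q. 1 \<le> q \<and> q \<le> m \<and> t q \<le> v \<and> v < t (Suc q)" if "v < t (Suc m)" for m
      using that
    proof (induction m)
      case 0
      then show ?case using v by simp
    next
      case (Suc m)
      show ?case
      proof (cases "v < t (Suc m)")
        case True
        then show ?thesis using Suc.IH le_SucI by blast
      next
        case False
        then show ?thesis using Suc.prems by (intro exI[of _ "Suc m"]) simp
      qed
    qed
    then show ?thesis using v by blast
  qed
  \<comment> \<open>The last occurring value e of a block is black. Hence the surplus index of a red
    value stays within the block, and each red value has an occurring successor there.\<close>
  have interval: "\<exists>q. 1 \<le> q \<and> q \<le> l \<and> D (q - 1) \<le> F v \<and> F v + c v \<le> D q"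
    and red_next: "v \<in> S \<Longrightarrow> \<exists>v'>v. 0 < c v' \<and> F v' = F (Suc v)" if v: "0 < c v" for v
  proof -
    obtain q where q: "1 \<le> q" "q \<le> l" "t q \<le> v" "v < t (Suc q)" using find_block[OF v] by blast
    obtain e where e: "t q \<le> e" "e < t (Suc q)" "0 < c e" "e \<notin> S"
      "\<And>v'. e < v' \<Longrightarrow> v' < t (Suc q) \<Longrightarrow> c v' = 0"
      using black[OF q(1,2)] by auto
    have "v \<le> e" using e(5)[of v] q v by force
    have "F (Suc e) \<le> F (t (Suc q))" using e by (intro F_mono) simp
    then have Fe: "F e + c e \<le> D q" using F_t[of "Suc q"] q e cg[of e] by (simp add: F_Suc)
    have "F v + c v \<le> D q"
    proof (cases "v = e")
      case False
      then have "F (Suc v) \<le> F e" using \<open>v \<le> e\<close> by (intro F_mono) simp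
      then show ?thesis using Fe e(3) cg[of v] by (auto simp: F_Suc split: if_splits)
    qed (use Fe in simp)
    moreover have "D (q - 1) \<le> F v" using F_mono[OF q(3)] F_t[of q] q by simp
    ultimately show "\<exists>q. 1 \<le> q \<and> q \<le> l \<and> D (q - 1) \<le> F v \<and> F v + c v \<le> D q" using q by blast
    show "\<exists>v'>v. 0 < c v' \<and> F v' = F (Suc v)" if "v \<in> S"
    proof -
      define v' where "v' = (LEAST v'. v < v' \<and> 0 < c v')"
      have "v < e" using \<open>v \<le> e\<close> e(4) that by (cases "v = e") auto
      then have v': "v < v' \<and> 0 < c v'" 
        using e(3) LeastI[of "\<lambda>v'. v < v' \<and> 0 < c v'" e] unfolding v'_def by simp
      have "c u = 0" if "v < u" "u < v'" for u
        using not_less_Least[of u "\<lambda>v'. v < v' \<and> 0 < c v'"] that by (auto simp: v'_def)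
      then have "F v' = F (Suc v)"
        unfolding F_def using v' by (intro sum.mono_neutral_right) (auto simp: g_def)
      then show ?thesis using v' by blast
    qed
  qed
  have L_blk: "k < N \<and> D (blk k - 1) \<le> F v \<and> F v + c v \<le> D (blk k)" if "v \<in> L k" for v k
  proof -
    have k: "F v \<le> k" "k < F v + c v" using that by (auto simp: L_def)
    then obtain q where q: "1 \<le> q" "q \<le> l" "D (q - 1) \<le> F v" "F v + c v \<le> D q"
      using interval[of v] by (metis add.right_neutral gr0I leD)
    then have "blk k = q" using k by (intro blk_eqI) auto
    then show ?thesis using q k D_mono[of q l] DN by auto
  qed
  have pos: "0 < c v" if "v \<in> L k" for v k using that by (auto simp: L_def intro: gr0I)
  have in_range: "1 \<le> v \<and> v \<le> n" if "v \<in> L k" for v k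
    using pos[OF that] c0[of v] by force
  have fin: "finite (L k)" for k by (rule finite_subset[of _ "{1..n}"]) (use in_range in auto)
  have nonempty: "L k \<noteq> {}" if "k < N" for k
  proof -
    \<comment> \<open>The last value whose index range starts by k. Its successor starts after k, so
      the range of v reaches k.\<close>
    define v where "v = Max {v. v \<le> n \<and> F v \<le> k}"
    have f: "finite {v. v \<le> n \<and> F v \<le> k}" by simp
    have "0 \<in> {v. v \<le> n \<and> F v \<le> k}" by (simp add: F_def)
    then have v: "v \<le> n" "F v \<le> k" using Max_in[OF f] unfolding v_def by blast+
    have "k < F (Suc v)"
    proof (rule ccontr)
      assume *: "\<not> k < F (Suc v)"
      show False
      proof (cases "v = n")
        case True
        then show ?thesis using * F_end that by simp
      next
        case False
        then have "Suc v \<le> v" unfolding v_def using * v by (intro Max_ge) (auto simp flip: v_def)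
        then show ?thesis by simp
      qed
    qed
    then have "v \<in> L k" using v cg[of v] by (auto simp: L_def F_Suc)
    then show ?thesis by blast
  qed
  have le: "v \<le> v'" if "v \<in> L k" "v' \<in> L k'" "k < k'" for v v' k k'
  proof (rule ccontr)
    assume "\<not> v \<le> v'"
    \<comment> \<open>The indices of v' go at most up to \<open>F (Suc v')\<close>, those of v start
      no earlier than that; this leaves no room for k < k'.\<close>
    then have "F (Suc v') \<le> F v" by (intro F_mono) simp
    then show False using that cg[of v'] by (auto simp: L_def F_Suc split: if_splits)
  qed
  have less: "v < v'" if "v \<in> L k" "v' \<in> L k'" "k < k'" "blk k \<noteq> blk k'" for v v' k k'
  proof (rule ccontr)
    assume "\<not> v < v'"
    then have [simp]: "v' = v" using le[OF that(1-3)] by simp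
    have "k < N" "k' < N" using L_blk that by blast+
    then have "blk k' = blk k"
      using L_blk[OF that(1)] that(2) blk[of k] by (intro blk_eqI) (auto simp: L_def)
    then show False using that by simp
  qed
  have "L \<in> chains n N blk"
  proof -
    have "L k = {}" if "k \<ge> N" for k using L_blk[of _ k] that by force
    moreover have "L k \<subseteq> {1..n}" for k using in_range by auto
    ultimately show ?thesis unfolding chains_def using nonempty le less by blast
  qed
  moreover have occ: "occ L = c"
  proof (rule ext)
    fix v
    have "{k. v \<in> L k} = {F v..<F v + c v}" by (auto simp: L_def)
    then show "occ L v = c v" by (simp add: occ_def)
  qed
  moreover have "overlaps L = S"
  proof (intro equalityI subsetI)
    fix v assume "v \<in> overlaps L"
    then obtain k where k: "v \<in> L k" "v < Max (L k)" by (auto simp: overlaps_def)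
    have "Max (L k) \<in> L k" using fin k by (intro Max_in) auto
    show "v \<in> S"
    proof (rule ccontr)
      assume "v \<notin> S"
      then have "F v + c v \<le> F (Max (L k))" using F_mono[of "Suc v" "Max (L k)"] k cg[of v] by (simp add: F_Suc)
      then show False using k(1) \<open>Max (L k) \<in> L k\<close> by (auto simp: L_def)
    qed
  next
    fix v assume v: "v \<in> S"
    then obtain v' where v': "v < v'" "0 < c v'" "F v' = F (Suc v)" using red_next[OF S] by blast
    define k where "k = F v'"
    have "v' \<in> L k" using v' by (simp add: L_def k_def)
    moreover have "v \<in> L k" using v v'(3) cg[of v] by (simp add: L_def k_def F_Suc)
    moreover have "v < Max (L k)" using Max_ge[OF fin \<open>v' \<in> L k\<close>] v' by simp
    ultimately show "v \<in> overlaps L" by (auto simp: overlaps_def)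
  qed
  ultimately show ?thesis by blast
qed

lemma bij_betw_chains_value_glides:
  "bij_betw (\<lambda>L. (occ L, overlaps L)) (chains n N blk) {(c, S). value_glide n l D c S}"
  unfolding bij_betw_def
proof
  show "inj_on (\<lambda>L. (occ L, overlaps L)) (chains n N blk)"
    using chain_inj by (auto intro!: inj_onI)
  show "(\<lambda>L. (occ L, overlaps L)) ` chains n N blk = {(c, S). value_glide n l D c S}"
    using value_glide_of_chain ex_chain_of_value_glide by force
qed

end

section \<open>Translating glides from positions to values\<close>

lemma bij_betw_reverse_interval:
  "j \<le> n \<Longrightarrow> bij_betw (\<lambda>k. n + 1 - k) {i<..j} {n + 1 - j..<n + 1 - i :: nat}"
  by (rule bij_betw_byWitness[of _ "\<lambda>k. n + 1 - k"]) auto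

text \<open>Models the reversed weight of a quasi-Yamanouchi tableau with values 1 to l: n - l
  zeros, followed by the sizes of the blocks l down to 1. Position n + 1 - v has list index
  \<open>n - v\<close>.\<close>

locale padded_composition = composition_blocks +
  fixes a :: "nat list"
  assumes length_a: "length a = n" and l_le: "l \<le> n"
    and a_nth: "\<And>v. 1 \<le> v \<Longrightarrow> v \<le> n \<Longrightarrow> a ! (n - v) = (if v \<le> l then D v - D (v - 1) else 0)"
begin

lemma a_nth_pos: "1 \<le> k \<Longrightarrow> k \<le> n \<Longrightarrow> 0 < a ! (k - 1) \<longleftrightarrow> n - l < k"
  using a_nth[of "n + 1 - k"] D_pred[of "n + 1 - k"] l_le by auto

lemma nz_positions_a: "nz_positions a = [n - l + 1..<n + 1]"
proof -
  have "[1..<n + 1] = [1..<n - l + 1] @ [n - l + 1..<n + 1]"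
    using l_le upt_add_eq_append[of 1 "n - l + 1" l] by simp
  moreover have "filter (\<lambda>k. 0 < a ! (k - 1)) [1..<n - l + 1] = []"
  proof (rule filter_False, rule ballI)
    fix k assume "k \<in> set [1..<n - l + 1]"
    then show "\<not> 0 < a ! (k - 1)" using a_nth_pos[of k] by auto
  qed
  moreover have "filter (\<lambda>k. 0 < a ! (k - 1)) [n - l + 1..<n + 1] = [n - l + 1..<n + 1]"
  proof (rule filter_True, rule ballI)
    fix k assume "k \<in> set [n - l + 1..<n + 1]"
    then show "0 < a ! (k - 1)" using a_nth_pos[of k] by auto
  qed
  ultimately show ?thesis unfolding nz_positions_def length_a by (simp only: filter_append append_Nil)
qed

lemma flat_a: "flat a = drop (n - l) a"
proof -
  have pos: "0 < a ! k \<longleftrightarrow> n - l \<le> k" if "k < n" for k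
    using a_nth_pos[of "Suc k"] that by auto
  have "filter (\<lambda>v. 0 < v) (take (n - l) a) = []"
  proof (rule filter_False, rule ballI)
    fix v assume "v \<in> set (take (n - l) a)"
    then obtain k where "k < n - l" "v = a ! k" by (auto simp: in_set_conv_nth)
    then show "\<not> 0 < v" using pos[of k] by simp
  qed
  moreover have "filter (\<lambda>v. 0 < v) (drop (n - l) a) = drop (n - l) a"
  proof (rule filter_True, rule ballI)
    fix v assume "v \<in> set (drop (n - l) a)"
    then obtain k where "k < l" "v = a ! (n - l + k)"
      using length_a l_le by (auto simp: in_set_conv_nth)
    then show "0 < v" using pos[of "n - l + k"] l_le by simp
  qed
  ultimately show ?thesis
    unfolding flat_def by (metis append_Nil append_take_drop_id filter_append)
qed

lemma is_glide_iff:
  "is_glide a b R \<longleftrightarrow> length b = n \<and> R \<subseteq> {k. 1 \<le> k \<and> k \<le> n \<and> 0 < b ! (k - 1)} \<and>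
     (\<exists>i. i 0 = 0 \<and> (\<forall>j<l. i j < i (Suc j)) \<and> (\<forall>j\<in>{1..l}. i j \<le> n - l + j) \<and>
        (\<forall>k. i l < k \<and> k \<le> n \<longrightarrow> b ! (k - 1) = 0) \<and>
        (\<forall>j\<in>{1..l}.
           (\<Sum>k\<in>{i (j - 1)<..i j}. b ! (k - 1)) = D (l + 1 - j) - D (l - j) + card (R \<inter> {i (j - 1)<..i j}) \<and>
           (\<exists>k\<in>{i (j - 1)<..i j}. 0 < b ! (k - 1) \<and> k \<notin> R \<and>
              (\<forall>k'\<in>{i (j - 1)<..<k}. b ! (k' - 1) = 0))))"
proof -
  have len: "length (flat a) = l" using l_le by (simp add: flat_a length_a)
  have ps: "nz_positions a ! (j - 1) = n - l + j" if "j \<in> {1..l}" for j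
  proof -
    have "[n - l + 1..<n + 1] ! (j - 1) = n - l + 1 + (j - 1)"
      using that l_le by (intro nth_upt) auto
    then show ?thesis using that by (simp add: nz_positions_a del: upt_Suc)
  qed
  have fl: "flat a ! (j - 1) = D (l + 1 - j) - D (l - j)" if "j \<in> {1..l}" for j
  proof -
    have "flat a ! (j - 1) = a ! (n - (l + 1 - j))"
      using that l_le by (simp add: flat_a length_a)
    also have "\<dots> = D (l + 1 - j) - D (l - j)"
      using that l_le by (subst a_nth) auto
    finally show ?thesis .
  qed
  have ps_all: "(\<forall>j\<in>{1..l}. i j \<le> nz_positions a ! (j - 1)) \<longleftrightarrow> (\<forall>j\<in>{1..l}. i j \<le> n - l + j)" for i
    by (rule ball_cong) (simp_all only: ps)
  have fl_all: "(\<forall>j\<in>{1..l}. s j = flat a ! (j - 1) + r j \<and> P j) \<longleftrightarrow>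
      (\<forall>j\<in>{1..l}. s j = D (l + 1 - j) - D (l - j) + r j \<and> P j)" for s r P
    by (rule ball_cong) (simp_all only: fl)
  show ?thesis
    unfolding is_glide_def Let_def len length_a ps_all fl_all
    by (simp only: cong: conj_cong)
qed

lemma block_reverse:
  fixes b :: "nat list" and c :: "nat \<Rightarrow> nat"
  assumes c: "\<And>k. 1 \<le> k \<Longrightarrow> k \<le> n \<Longrightarrow> c (n + 1 - k) = b ! (k - 1)"
    and R: "R \<subseteq> {1..n}" and ij: "j \<le> n"
  defines "S \<equiv> (\<lambda>k. n + 1 - k) ` R"
  shows "(\<Sum>v\<in>{n + 1 - j..<n + 1 - i}. c v) = (\<Sum>k\<in>{i<..j}. b ! (k - 1))"
    "card (S \<inter> {n + 1 - j..<n + 1 - i}) = card (R \<inter> {i<..j})"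
    "(\<exists>v\<in>{n + 1 - j..<n + 1 - i}. 0 < c v \<and> v \<notin> S \<and> (\<forall>v'\<in>{v<..<n + 1 - i}. c v' = 0)) \<longleftrightarrow>
     (\<exists>k\<in>{i<..j}. 0 < b ! (k - 1) \<and> k \<notin> R \<and> (\<forall>k'\<in>{i<..<k}. b ! (k' - 1) = 0))"
proof -
  have S_iff: "n + 1 - k \<in> S \<longleftrightarrow> k \<in> R" if "1 \<le> k" "k \<le> n" for k
  proof
    assume "n + 1 - k \<in> S"
    then obtain k' where k': "k' \<in> R" "n + 1 - k = n + 1 - k'" by (auto simp: S_def)
    then have "k' = k" using R that by auto
    then show "k \<in> R" using k' by simp
  qed (simp add: S_def)
  have rev: "{n + 1 - j..<n + 1 - i} = (\<lambda>k. n + 1 - k) ` {i<..j}"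
    using bij_betw_reverse_interval[OF ij, of i] by (simp add: bij_betw_def)
  show "(\<Sum>v\<in>{n + 1 - j..<n + 1 - i}. c v) = (\<Sum>k\<in>{i<..j}. b ! (k - 1))"
    using sum.reindex_bij_betw[OF bij_betw_reverse_interval[OF ij], of c i] c ij by simp
  have "S \<inter> {n + 1 - j..<n + 1 - i} = (\<lambda>k. n + 1 - k) ` (R \<inter> {i<..j})"
    unfolding rev using S_iff ij by force
  moreover have "inj_on (\<lambda>k. n + 1 - k) (R \<inter> {i<..j})"
    using ij by (auto intro!: inj_onI)
  ultimately show "card (S \<inter> {n + 1 - j..<n + 1 - i}) = card (R \<inter> {i<..j})"
    by (simp add: card_image)
  have "(\<forall>v'\<in>{n + 1 - k<..<n + 1 - i}. c v' = 0) \<longleftrightarrow> (\<forall>k'\<in>{i<..<k}. b ! (k' - 1) = 0)"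
    if "k \<in> {i<..j}" for k
  proof -
    have "{n + 1 - k<..<n + 1 - i} = (\<lambda>k. n + 1 - k) ` {i<..<k}"
    proof (intro equalityI subsetI)
      fix v assume "v \<in> {n + 1 - k<..<n + 1 - i}"
      then have "v = n + 1 - (n + 1 - v)" "n + 1 - v \<in> {i<..<k}" using that ij by auto
      then show "v \<in> (\<lambda>k. n + 1 - k) ` {i<..<k}" by blast
    qed (use that ij in auto)
    then show ?thesis using that ij c by simp
  qed
  then show "(\<exists>v\<in>{n + 1 - j..<n + 1 - i}. 0 < c v \<and> v \<notin> S \<and> (\<forall>v'\<in>{v<..<n + 1 - i}. c v' = 0)) \<longleftrightarrow>
     (\<exists>k\<in>{i<..j}. 0 < b ! (k - 1) \<and> k \<notin> R \<and> (\<forall>k'\<in>{i<..<k}. b ! (k' - 1) = 0))"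
    unfolding rev using S_iff c ij by (simp cong: bex_cong_simp)
qed

text \<open>Cut points and thresholds determine each other through
  \<open>t q = n + 1 - i (l + 1 - q)\<close>, and block j of positions becomes block l + 1 - j of
  values.\<close>

lemma is_glide_iff_value_glide:
  assumes len: "length b = n" and R: "R \<subseteq> {1..n}" and c0: "\<And>v. v \<notin> {1..n} \<Longrightarrow> c v = 0"
    and c: "\<And>k. 1 \<le> k \<Longrightarrow> k \<le> n \<Longrightarrow> c (n + 1 - k) = b ! (k - 1)"
  shows "is_glide a b R \<longleftrightarrow> value_glide n l D c ((\<lambda>k. n + 1 - k) ` R)"
proof
  assume "is_glide a b R"
  then obtain i where Rb: "R \<subseteq> {k. 1 \<le> k \<and> k \<le> n \<and> 0 < b ! (k - 1)}"
    and i0: "i 0 = 0" and i_less: "\<And>j. j < l \<Longrightarrow> i j < i (Suc j)"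
    and i_le: "\<And>j. 1 \<le> j \<Longrightarrow> j \<le> l \<Longrightarrow> i j \<le> n - l + j"
    and zero: "\<And>k. i l < k \<Longrightarrow> k \<le> n \<Longrightarrow> b ! (k - 1) = 0"
    and block: "\<And>j. 1 \<le> j \<Longrightarrow> j \<le> l \<Longrightarrow> (\<Sum>k\<in>{i (j - 1)<..i j}. b ! (k - 1)) =
        D (l + 1 - j) - D (l - j) + card (R \<inter> {i (j - 1)<..i j}) \<and>
           (\<exists>k\<in>{i (j - 1)<..i j}. 0 < b ! (k - 1) \<and> k \<notin> R \<and>
              (\<forall>k'\<in>{i (j - 1)<..<k}. b ! (k' - 1) = 0))"
    unfolding is_glide_iff by auto
  define t where "t q = n + 1 - i (l + 1 - q)" for q
  have i_n: "i j \<le> n" if "j \<le> l" for j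
    using i_le[of j] i0 that l_le by (cases "j = 0") auto
  have t_Suc: "t (Suc q) = n + 1 - i (l + 1 - q - 1)" for q by (simp add: t_def)
  show "value_glide n l D c ((\<lambda>k. n + 1 - k) ` R)"
    unfolding value_glide_def
  proof (intro conjI exI[of _ t] ballI allI impI)
    show "c v = 0" if "v \<notin> {1..n}" for v using c0 that .
    show "0 < c v" if "v \<in> (\<lambda>k. n + 1 - k) ` R" for v using that Rb c by auto
    show "1 \<le> t 1" using i_n[of l] by (simp add: t_def)
    show "t (Suc l) = n + 1" by (simp add: t_def i0)
    show "t q < t (Suc q)" if "q \<in> {1..l}" for q
    proof -
      have "i (l - q) < i (Suc (l - q))" using that by (intro i_less) auto
      moreover have "i (Suc (l - q)) \<le> n" using that by (intro i_n) auto
      ultimately show ?thesis using that by (simp add: t_def Suc_diff_le)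
    qed
    show "c v = 0" if "v < t 1" for v
    proof (cases "v = 0")
      case False
      then show ?thesis using zero[of "n + 1 - v"] c[of "n + 1 - v"] that c0[of v]
        by (cases "v \<le> n") (auto simp: t_def)
    qed (use c0 in simp)
    fix q assume q: "q \<in> {1..l}"
    define j where "j = l + 1 - q"
    have j: "1 \<le> j" "j \<le> l" "l + 1 - j = q" "l - j = q - 1" using q by (auto simp: j_def)
    have tt: "t q = n + 1 - i j" "t (Suc q) = n + 1 - i (j - 1)" by (simp_all add: t_def j_def)
    note br = block_reverse[OF c R i_n[OF j(2)], of "i (j - 1)", folded tt]
    show "(\<Sum>v\<in>{t q..<t (Suc q)}. c v) = D q - D (q - 1) + card ((\<lambda>k. n + 1 - k) ` R \<inter> {t q..<t (Suc q)})"
      using br(1,2) block[OF j(1,2)] j by simp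
    show "\<exists>v\<in>{t q..<t (Suc q)}. 0 < c v \<and> v \<notin> (\<lambda>k. n + 1 - k) ` R \<and> (\<forall>v'\<in>{v<..<t (Suc q)}. c v' = 0)"
      using br(3) block[OF j(1,2)] by blast
  qed
next
  let ?S = "(\<lambda>k. n + 1 - k) ` R"
  assume vg: "value_glide n l D c ?S"
  obtain t where t1: "1 \<le> t 1" and t_last: "t (Suc l) = n + 1" and below: "\<And>v. v < t 1 \<Longrightarrow> c v = 0"
    and t: "\<forall>q\<in>{1..l}. t q < t (Suc q)"
      "\<forall>q\<in>{1..l}. (\<Sum>v\<in>{t q..<t (Suc q)}. c v) = D q - D (q - 1) + card (?S \<inter> {t q..<t (Suc q)}) \<and>
         (\<exists>v\<in>{t q..<t (Suc q)}. 0 < c v \<and> v \<notin> ?S \<and> (\<forall>v'\<in>{v<..<t (Suc q)}. c v' = 0))"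
    using vg unfolding value_glide_def by blast
  have S_pos: "0 < c v" if "v \<in> ?S" for v using vg that unfolding value_glide_def by blast
  \<comment> \<open>Source of the bound i j \<le> n - l + j: the thresholds start at 1 or later and
    grow strictly, while the positive entries of \<open>a\<close> fill its last l positions.\<close>
  have t_ge: "q \<le> t q" if "1 \<le> q" "q \<le> Suc l" for q
    using that
  proof (induction q rule: dec_induct)
    case (step q)
    then have "t q < t (Suc q)" using t(1) by simp
    then show ?case using step by simp
  qed (use t1 in simp)
  have t_mono: "q \<le> q' \<Longrightarrow> 1 \<le> q \<Longrightarrow> q' \<le> Suc l \<Longrightarrow> t q \<le> t q'" for q q'
  proof (induction q' rule: dec_induct)
    case (step q')
    then have "t q' < t (Suc q')" using t(1) by simp
    then show ?case using step by simp
  qed simp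
  define i where "i j = n + 1 - t (l + 1 - j)" for j
  have t_i: "t q = n + 1 - i (l + 1 - q)" if "1 \<le> q" "q \<le> Suc l" for q
    using that t_mono[of q "Suc l"] t_last by (simp add: i_def)
  have i_n: "i j \<le> n" if "j \<le> l" for j
  proof -
    have "l + 1 - j \<le> t (l + 1 - j)" using that by (intro t_ge) auto
    then show ?thesis using that unfolding i_def by linarith
  qed
  show "is_glide a b R"
    unfolding is_glide_iff
  proof (intro conjI exI[of _ i] ballI allI impI)
    show "length b = n" by (rule len)
    show "R \<subseteq> {k. 1 \<le> k \<and> k \<le> n \<and> 0 < b ! (k - 1)}"
    proof
      fix k assume k: "k \<in> R"
      then have "0 < c (n + 1 - k)" using S_pos by blast
      then show "k \<in> {k. 1 \<le> k \<and> k \<le> n \<and> 0 < b ! (k - 1)}" using k R c[of k] by auto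
    qed
    show "i 0 = 0" using t_last by (simp add: i_def)
    show "i j < i (Suc j)" if "j < l" for j
    proof -
      have "t (l - j) < t (Suc (l - j))" using t(1) that by simp
      moreover have "t (Suc (l - j)) \<le> n + 1" using t_mono[of "Suc (l - j)" "Suc l"] t_last by simp
      ultimately show ?thesis using that by (simp add: i_def Suc_diff_le)
    qed
    show "i j \<le> n - l + j" if "j \<in> {1..l}" for j
    proof -
      have "l + 1 - j \<le> t (l + 1 - j)" using that by (intro t_ge) auto
      moreover have "1 \<le> j" "j \<le> l" using that by auto
      ultimately show ?thesis using l_le unfolding i_def by linarith
    qed
    show "b ! (k - 1) = 0" if "i l < k \<and> k \<le> n" for k
    proof -
      have "n + 1 - t 1 < k" "k \<le> n" using that by (simp_all add: i_def)
      then have "n + 1 - k < t 1" "1 \<le> k" using t1 by linarith+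
      then show ?thesis using below[of "n + 1 - k"] c[of k] that by simp
    qed
    fix j assume j': "j \<in> {1..l}"
    define q where "q = l + 1 - j"
    have q: "1 \<le> q" "q \<le> l" "l + 1 - q = j" "l - j = q - 1" using j' by (auto simp: q_def)
    have tt: "t q = n + 1 - i j" "t (Suc q) = n + 1 - i (j - 1)"
      using t_i[of q] t_i[of "Suc q"] q by auto
    have jl: "j \<le> l" using j' by simp
    note br = block_reverse[OF c R i_n[OF jl], of "i (j - 1)", folded tt]
    show "(\<Sum>k\<in>{i (j - 1)<..i j}. b ! (k - 1)) =
        D (l + 1 - j) - D (l - j) + card (R \<inter> {i (j - 1)<..i j})"
      using br(1,2) t(2) q by (simp add: q_def)
    show "\<exists>k\<in>{i (j - 1)<..i j}. 0 < b ! (k - 1) \<and> k \<notin> R \<and> (\<forall>k'\<in>{i (j - 1)<..<k}. b ! (k' - 1) = 0)"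
    proof -
      have "q \<in> {1..l}" using q by simp
      with t(2) have "\<exists>v\<in>{t q..<t (Suc q)}. 0 < c v \<and> v \<notin> ?S \<and> (\<forall>v'\<in>{v<..<t (Suc q)}. c v' = 0)"
        by blast
      with br(3) show ?thesis by (rule iffD1)
    qed
  qed
qed

lemma glide_poly_eq_sum_chains:
  fixes \<beta> :: "'a::comm_ring_1" and x :: "nat \<Rightarrow> 'a"
  shows "glide_poly a \<beta> x =
    (\<Sum>L\<in>chains n N blk. \<beta> ^ card (overlaps L) * (\<Prod>v\<in>{1..n}. x (n + 1 - v) ^ occ L v))"
proof -
  define to_value :: "nat list \<times> nat set \<Rightarrow> (nat \<Rightarrow> nat) \<times> nat set"
    where "to_value = (\<lambda>(b, R). (\<lambda>v. if v \<in> {1..n} then b ! (n - v) else 0, (\<lambda>k. n + 1 - k) ` R))"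
  define of_value :: "(nat \<Rightarrow> nat) \<times> nat set \<Rightarrow> nat list \<times> nat set"
    where "of_value = (\<lambda>(c, S). (map (\<lambda>k. c (n - k)) [0..<n], (\<lambda>k. n + 1 - k) ` S))"
  have rev_rev: "(\<lambda>k. n + 1 - k) ` (\<lambda>k. n + 1 - k) ` V = V" if "V \<subseteq> {1..n}" for V
    using that by (force simp: image_image)
  have glideD: "length b = n \<and> R \<subseteq> {1..n}" if "is_glide a b R" for b R
    using that by (auto simp: is_glide_iff)
  have valueD: "S \<subseteq> {1..n} \<and> (\<forall>v. v \<notin> {1..n} \<longrightarrow> c v = 0)" if "value_glide n l D c S" for c S
  proof -
    have "\<forall>v. v \<notin> {1..n} \<longrightarrow> c v = 0" "\<forall>v\<in>S. 0 < c v" using that unfolding value_glide_def by blast+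
    then show ?thesis by (metis less_irrefl subsetI)
  qed
  have "glide_poly a \<beta> x =
      (\<Sum>(b, R)\<in>{(b, R). is_glide a b R}. \<beta> ^ card R * (\<Prod>k\<in>{1..length b}. x k ^ (b ! (k - 1))))"
    by (simp add: glide_poly_def)
  also have "\<dots> = (\<Sum>(c, S)\<in>{(c, S). value_glide n l D c S}.
      \<beta> ^ card S * (\<Prod>v\<in>{1..n}. x (n + 1 - v) ^ c v))"
  proof (rule sum.reindex_bij_witness[of _ of_value to_value])
    fix p assume "p \<in> {(b, R). is_glide a b R}"
    then obtain b R where p: "p = (b, R)" and bR: "is_glide a b R" by auto
    note g = glideD[OF bR]
    let ?c = "\<lambda>v. if v \<in> {1..n} then b ! (n - v) else 0"
    show "of_value (to_value p) = p"
      using g rev_rev[of R] by (auto simp: p of_value_def to_value_def intro!: nth_equalityI)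
    have "is_glide a b R \<longleftrightarrow> value_glide n l D ?c ((\<lambda>k. n + 1 - k) ` R)"
      by (rule is_glide_iff_value_glide) (use g in auto)
    then show "to_value p \<in> {(c, S). value_glide n l D c S}"
      using bR by (simp add: p to_value_def)
    have "card ((\<lambda>k. n + 1 - k) ` R) = card R"
      using g by (intro card_image inj_onI) force
    moreover have "(\<Prod>v\<in>{1..n}. x (n + 1 - v) ^ ?c v) = (\<Prod>k\<in>{1..n}. x k ^ (b ! (k - 1)))"
      by (rule prod.reindex_bij_witness[of _ "\<lambda>k. n + 1 - k" "\<lambda>k. n + 1 - k"]) auto
    ultimately show "(case to_value p of (c, S) \<Rightarrow> \<beta> ^ card S * (\<Prod>v\<in>{1..n}. x (n + 1 - v) ^ c v)) =
        (case p of (b, R) \<Rightarrow> \<beta> ^ card R * (\<Prod>k\<in>{1..length b}. x k ^ (b ! (k - 1))))"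
      using g by (simp add: p to_value_def)
  next
    fix p assume "p \<in> {(c, S). value_glide n l D c S}"
    then obtain c S where p: "p = (c, S)" and cS: "value_glide n l D c S" by auto
    note v = valueD[OF cS]
    show "to_value (of_value p) = p"
      using v rev_rev[of S] by (auto simp: p of_value_def to_value_def)
    have "is_glide a (map (\<lambda>k. c (n - k)) [0..<n]) ((\<lambda>k. n + 1 - k) ` S) \<longleftrightarrow>
        value_glide n l D c ((\<lambda>k. n + 1 - k) ` (\<lambda>k. n + 1 - k) ` S)"
    proof (rule is_glide_iff_value_glide)
      show "(\<lambda>k. n + 1 - k) ` S \<subseteq> {1..n}" using v by force
    qed (use v in auto)
    then show "of_value p \<in> {(b, R). is_glide a b R}"
      using cS rev_rev[of S] v by (simp add: p of_value_def)
  qed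
  also have "\<dots> = (\<Sum>L\<in>chains n N blk. \<beta> ^ card (overlaps L) * (\<Prod>v\<in>{1..n}. x (n + 1 - v) ^ occ L v))"
    by (subst sum.reindex_bij_betw[OF bij_betw_chains_value_glides, symmetric]) simp
  finally show ?thesis .
qed

end

section \<open>Merging values of a set-valued tableau\<close>

text \<open>\<^term>\<open>\<psi> v\<close> is the entry into which \<^term>\<open>v\<close> is merged; the last clause makes the merged tableau
  quasi-Yamanouchi.\<close>

definition qy_labelling :: "(nat \<times> nat \<Rightarrow> nat set) \<Rightarrow> (nat \<Rightarrow> nat) \<Rightarrow> bool" where
  "qy_labelling T \<psi> \<longleftrightarrow>
     (\<forall>b v. v \<in> T b \<longrightarrow> 1 \<le> \<psi> v) \<and>
     (\<forall>b v b' v'. v \<in> T b \<longrightarrow> v' \<in> T b' \<longrightarrow> v \<le> v' \<longrightarrow> \<psi> v \<le> \<psi> v') \<and>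
     (\<forall>b v b' v'. v \<in> T b \<longrightarrow> v' \<in> T b' \<longrightarrow> v < v' \<longrightarrow> \<psi> v = \<psi> v' \<longrightarrow> b = b' \<or> snd b < snd b') \<and>
     (\<forall>b v. v \<in> T b \<longrightarrow> 1 < \<psi> v \<longrightarrow>
        (\<exists>b1 b2 x y. x \<in> T b1 \<and> y \<in> T b2 \<and> \<psi> x = \<psi> v \<and> \<psi> y = \<psi> v - 1 \<and> b1 \<noteq> b2 \<and> snd b1 \<le> snd b2))"

lemma qy_labelling_pos: "qy_labelling T \<psi> \<Longrightarrow> v \<in> T b \<Longrightarrow> 1 \<le> \<psi> v"
  unfolding qy_labelling_def by blast

lemma qy_labelling_mono:
  "qy_labelling T \<psi> \<Longrightarrow> v \<in> T b \<Longrightarrow> v' \<in> T b' \<Longrightarrow> v \<le> v' \<Longrightarrow> \<psi> v \<le> \<psi> v'"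
  unfolding qy_labelling_def by blast

lemma qy_labelling_strip:
  "qy_labelling T \<psi> \<Longrightarrow> v \<in> T b \<Longrightarrow> v' \<in> T b' \<Longrightarrow> v < v' \<Longrightarrow> \<psi> v = \<psi> v' \<Longrightarrow> b = b' \<or> snd b < snd b'"
  unfolding qy_labelling_def by blast

lemma qy_labelling_descent:
  assumes "qy_labelling T \<psi>" "v \<in> T b" "1 < \<psi> v"
  obtains b1 b2 x y where "x \<in> T b1" "y \<in> T b2" "\<psi> x = \<psi> v" "\<psi> y = \<psi> v - 1" "b1 \<noteq> b2" "snd b1 \<le> snd b2"
  using assms unfolding qy_labelling_def by blast

text \<open>A label above 1 requires its predecessor, by monotonicity on a smaller value, so labels
  cannot outgrow values. This keeps the merged entries within 1 to n.\<close>

lemma qy_labelling_le: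
  assumes \<psi>: "qy_labelling T \<psi>" and pos: "\<And>b v. v \<in> T b \<Longrightarrow> 1 \<le> v"
  shows "v \<in> T b \<Longrightarrow> \<psi> v \<le> v"
proof (induction v arbitrary: b rule: less_induct)
  case (less v)
  show ?case
  proof (cases "1 < \<psi> v")
    case True
    then obtain b2 y where y: "y \<in> T b2" "\<psi> y = \<psi> v - 1"
      using qy_labelling_descent[OF \<psi> less.prems(1)] by blast
    then have "y < v" using qy_labelling_mono[OF \<psi> less.prems(1) y(1)] True by force
    then show ?thesis using less.IH[OF _ y(1)] y by simp
  qed (use pos[OF less.prems] in simp)
qed

text \<open>Labels are assigned greedily to increasing values, hence the induction over truncations
  of T. The new value v needs comparison only with the largest earlier value u: it either takes the
  label of u or opens the next label.\<close>

lemma ex_qy_labelling_upto: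
  assumes pos: "\<And>b v. v \<in> T b \<Longrightarrow> (1::nat) \<le> v"
  shows "\<exists>\<psi>. qy_labelling (\<lambda>b. T b \<inter> {..m}) \<psi>"
proof (induction m)
  case 0
  have "T b \<inter> {..0} = {}" for b using pos[of 0 b] by auto
  then show ?case by (simp add: qy_labelling_def)
next
  case (Suc m)
  then obtain \<psi> where \<psi>: "qy_labelling (\<lambda>b. T b \<inter> {..m}) \<psi>" by blast
  define v where "v = Suc m"
  define V where "V = {u. u \<le> m \<and> (\<exists>b. u \<in> T b)}"
  have T_Suc: "x \<in> T b \<inter> {..Suc m} \<longleftrightarrow> x \<in> T b \<and> (x = v \<or> x \<le> m)" for x b
    by (auto simp: v_def)
  show ?case
  proof (cases "V = {}")
    case True
    then have only_v: "x = v" if "x \<in> T b \<inter> {..Suc m}" for x b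
      using that unfolding T_Suc V_def by blast
    have "qy_labelling (\<lambda>b. T b \<inter> {..Suc m}) (\<lambda>_. 1)"
      unfolding qy_labelling_def
    proof (intro conjI allI impI)
      show "b = b' \<or> snd b < snd b'"
        if "x \<in> T b \<inter> {..Suc m}" "y \<in> T b' \<inter> {..Suc m}" "x < y" for x y b b'
        using only_v[OF that(1)] only_v[OF that(2)] that(3) by simp
    qed simp_all
    then show ?thesis by blast
  next
    case False
    have "finite V" by (simp add: V_def)
    define u where "u = Max V"
    have "u \<in> V" unfolding u_def using \<open>finite V\<close> False by (rule Max_in)
    then obtain h0 where u: "u \<le> m" "u \<in> T h0" by (auto simp: V_def)
    have le_u: "x \<le> u" if "x \<in> T b" "x \<le> m" for x b
    proof -
      have "x \<in> V" using that unfolding V_def by blast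
      then show ?thesis unfolding u_def using \<open>finite V\<close> by simp
    qed
    have pos_m: "1 \<le> \<psi> x" if "x \<in> T b" "x \<le> m" for x b
      using qy_labelling_pos[OF \<psi>, of x b] that by simp
    have mono_m: "\<psi> x \<le> \<psi> y" if "x \<in> T b" "y \<in> T b'" "x \<le> m" "y \<le> m" "x \<le> y" for x y b b'
      using qy_labelling_mono[OF \<psi>, of x b y b'] that by simp
    have strip_m: "b = b' \<or> snd b < snd b'"
      if "x \<in> T b" "y \<in> T b'" "x \<le> m" "y \<le> m" "x < y" "\<psi> x = \<psi> y" for x y b b'
      using qy_labelling_strip[OF \<psi>, of x b y b'] that by simp
    \<comment> \<open>A v-box weakly left of a different u-box forbids a common label by the column
      clause, and the same two boxes witness the last clause for the new label.\<close>
    define brk where "brk \<longleftrightarrow> (\<exists>b b'. v \<in> T b \<and> u \<in> T b' \<and> b \<noteq> b' \<and> snd b \<le> snd b')"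
    define \<psi>' where "\<psi>' x = (if x = v then \<psi> u + (if brk then 1 else 0) else \<psi> x)" for x
    have low: "\<psi>' x = \<psi> x" if "x \<le> m" for x using that by (simp add: \<psi>'_def v_def)
    have "qy_labelling (\<lambda>b. T b \<inter> {..Suc m}) \<psi>'"
      unfolding qy_labelling_def T_Suc
    proof (intro conjI allI impI)
      show "1 \<le> \<psi>' x" if "x \<in> T b \<and> (x = v \<or> x \<le> m)" for x b
        using that pos_m[of x b] pos_m[OF u(2,1)] low[of x] by (auto simp: \<psi>'_def)
      show "\<psi>' x \<le> \<psi>' y"
        if x: "x \<in> T b \<and> (x = v \<or> x \<le> m)" and y: "y \<in> T b' \<and> (y = v \<or> y \<le> m)" and xy: "x \<le> y"
        for x y b b'
      proof (cases "y = v")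
        case True
        show ?thesis
        proof (cases "x = v")
          case False
          then have "\<psi> x \<le> \<psi> u" using x le_u[of x b] u by (intro mono_m[of _ b _ h0]) auto
          then show ?thesis using True False by (simp add: \<psi>'_def)
        qed (use True in simp)
      next
        case False
        then have "x \<le> m" "y \<le> m" using x y xy by (auto simp: v_def)
        then show ?thesis using mono_m x y xy low by simp
      qed
      show "b = b' \<or> snd b < snd b'"
        if x: "x \<in> T b \<and> (x = v \<or> x \<le> m)" and y: "y \<in> T b' \<and> (y = v \<or> y \<le> m)"
          and xy: "x < y" "\<psi>' x = \<psi>' y" for x y b b'
      proof (cases "y = v")
        case True
        then have x': "x \<in> T b" "x \<le> m" "x \<le> u" using x xy le_u[of x b] by auto
        then have "\<psi> x \<le> \<psi> u" using u by (intro mono_m[of _ b _ h0]) auto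
        then have nb: "\<not> brk" and eq: "\<psi> x = \<psi> u"
          using xy(2) True low[OF x'(2)] by (auto simp: \<psi>'_def split: if_splits)
        have nb': "h = b' \<or> snd h < snd b'" if "u \<in> T h" for h
        proof (rule ccontr)
          assume "\<not> (h = b' \<or> snd h < snd b')"
          then have "b' \<noteq> h" "snd b' \<le> snd h" by auto
          moreover have "v \<in> T b'" using y True by blast
          ultimately show False using nb that unfolding brk_def by blast
        qed
        show ?thesis
        proof (cases "x = u")
          case True
          then show ?thesis using nb'[of b] x' by simp
        next
          case False
          \<comment> \<open>A smaller value with the label of u is compared with v through the u-box
            h0: its box is h0 or lies left of it, and h0 is the v-box or lies left of that.\<close>
          then have "b = h0 \<or> snd b < snd h0" using strip_m[OF x'(1) u(2)] x' u eq by simp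
          then show ?thesis using nb'[OF u(2)] by auto
        qed
      next
        case False
        then have "x \<le> m" "y \<le> m" using x y xy by (auto simp: v_def)
        then show ?thesis using strip_m[of x b y b'] x y xy low by simp
      qed
      have wit: "\<exists>b1 b2 x y. (x \<in> T b1 \<and> (x = v \<or> x \<le> m)) \<and> (y \<in> T b2 \<and> (y = v \<or> y \<le> m)) \<and>
          \<psi>' x = \<psi> z \<and> \<psi>' y = \<psi> z - 1 \<and> b1 \<noteq> b2 \<and> snd b1 \<le> snd b2"
        if z: "z \<in> T b" "z \<le> m" "1 < \<psi> z" for z b
      proof -
        have "z \<in> T b \<inter> {..m}" using z by simp
        from qy_labelling_descent[OF \<psi> this z(3)] obtain b1 b2 x y where
          w: "x \<in> T b1 \<inter> {..m}" "y \<in> T b2 \<inter> {..m}" "\<psi> x = \<psi> z" "\<psi> y = \<psi> z - 1"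
            "b1 \<noteq> b2" "snd b1 \<le> snd b2" .
        then have "x \<in> T b1" "x \<le> m" "y \<in> T b2" "y \<le> m" by auto
        moreover from this have "\<psi>' x = \<psi> z" "\<psi>' y = \<psi> z - 1"
          unfolding low[OF \<open>x \<le> m\<close>] low[OF \<open>y \<le> m\<close>] using w by blast+
        ultimately show ?thesis using w(5,6) by blast
      qed
      show "\<exists>b1 b2 x y. (x \<in> T b1 \<and> (x = v \<or> x \<le> m)) \<and> (y \<in> T b2 \<and> (y = v \<or> y \<le> m)) \<and>
          \<psi>' x = \<psi>' z \<and> \<psi>' y = \<psi>' z - 1 \<and> b1 \<noteq> b2 \<and> snd b1 \<le> snd b2"
        if z: "z \<in> T b \<and> (z = v \<or> z \<le> m)" "1 < \<psi>' z" for z b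
      proof (cases "z = v")
        case True
        show ?thesis
        proof (cases brk)
          case brk: True
          then obtain b1 b2 where "v \<in> T b1" "u \<in> T b2" "b1 \<noteq> b2" "snd b1 \<le> snd b2"
            unfolding brk_def by blast
          then show ?thesis
            using True u brk low[OF u(1)]
            by (intro exI[of _ b1] exI[of _ b2] exI[of _ v] exI[of _ u]) (simp add: \<psi>'_def)
        next
          case False
          then have "\<psi>' z = \<psi> u" using True by (simp add: \<psi>'_def)
          then show ?thesis using wit[OF u(2,1)] z by simp
        qed
      next
        case False
        then have z': "z \<in> T b" "z \<le> m" "1 < \<psi> z" using z low[of z] by auto
        show ?thesis using wit[OF z'] unfolding low[OF z'(2)] .
      qed
    qed
    then show ?thesis by blast
  qed
qed

lemma ex_qy_labelling:
  assumes T: "svt_filling n T"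
  shows "\<exists>\<psi>. qy_labelling T \<psi>"
proof -
  have "T b \<inter> {..n} = T b" for b
  proof -
    have "T b \<subseteq> {1..n}" using T unfolding svt_filling_def by blast
    then show ?thesis by auto
  qed
  moreover have "1 \<le> v" if "v \<in> T b" for v b
    using svt_filling_memD(1)[OF T, of v "fst b" "snd b"] that by simp
  ultimately show ?thesis using ex_qy_labelling_upto[of T n] by simp
qed

text \<open>Take the least value v labelled differently. The larger label has a witness: a box c
  weakly left of a different box d. The other labelling gives v the label of the value y in d, so d
  equals or lies left of the box b of v; the first labelling places b at or left of c unless v
  itself is the value in c, where d and c are compared directly. Either way the witness is
  contradicted.\<close>

lemma qy_labelling_unique:
  assumes \<psi>: "qy_labelling T \<psi>" and \<psi>': "qy_labelling T \<psi>'"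
  shows "v \<in> T b \<Longrightarrow> \<psi> v = \<psi>' v"
proof (induction v arbitrary: b rule: less_induct)
  case (less v)
  have not_less: "\<not> \<psi> v < \<psi>' v"
    if \<psi>: "qy_labelling T \<psi>" and \<psi>': "qy_labelling T \<psi>'"
      and eq: "\<And>u c. u < v \<Longrightarrow> u \<in> T c \<Longrightarrow> \<psi> u = \<psi>' u" for \<psi> \<psi>'
  proof
    assume less': "\<psi> v < \<psi>' v"
    then have "1 < \<psi>' v" using qy_labelling_pos[OF \<psi> less.prems] by simp
    then obtain c d x y where d: "x \<in> T c" "y \<in> T d" "\<psi>' x = \<psi>' v" "\<psi>' y = \<psi>' v - 1" "c \<noteq> d" "snd c \<le> snd d"
      using qy_labelling_descent[OF \<psi>' less.prems] by metis
    have "y < v" using qy_labelling_mono[OF \<psi>' less.prems d(2)] d(4) \<open>1 < \<psi>' v\<close> by force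
    then have \<psi>y: "\<psi> y = \<psi>' v - 1" using eq d by simp
    moreover have "\<psi> y \<le> \<psi> v" using qy_labelling_mono[OF \<psi> d(2) less.prems] \<open>y < v\<close> by simp
    ultimately have \<psi>v: "\<psi> v = \<psi> y" using less' by simp
    have "v \<le> x"
    proof (rule ccontr)
      assume "\<not> v \<le> x"
      then have "\<psi> x = \<psi>' v" "\<psi> x \<le> \<psi> v"
        using eq[of x c] d qy_labelling_mono[OF \<psi> d(1) less.prems] by auto
      then show False using less' by simp
    qed
    have "d = b \<or> snd d < snd b"
      using qy_labelling_strip[OF \<psi> d(2) less.prems \<open>y < v\<close>] \<psi>v by simp
    moreover have "b = c \<or> snd b < snd c \<or> v = x"
      using qy_labelling_strip[OF \<psi>' less.prems d(1) _ d(3)[symmetric]] \<open>v \<le> x\<close> by linarith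
    moreover have "d = c \<or> snd d < snd c" if "v = x"
      using qy_labelling_strip[OF \<psi> d(2) d(1)] \<open>y < v\<close> \<psi>v[symmetric] unfolding that by blast
    ultimately show False using d(5,6) by auto
  qed
  show ?case
    using not_less[OF \<psi> \<psi>'] not_less[OF \<psi>' \<psi>] less.IH by (metis linorder_neqE_nat)
qed

section \<open>Ranking the entries of a tableau and spreading them into sets\<close>

definition entries :: "(nat \<times> nat \<Rightarrow> nat set) \<Rightarrow> (nat \<times> nat \<times> nat) set" where
  "entries Q = {(q, b). q \<in> Q b}"

text \<open>Value and column suffice for a total order on entries, since a value occurs at most once
  in a column (\<open>same_column_eq\<close>).\<close>

definition entry_less :: "nat \<times> nat \<times> nat \<Rightarrow> nat \<times> nat \<times> nat \<Rightarrow> bool" where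
  "entry_less e e' \<longleftrightarrow> fst e < fst e' \<or> fst e = fst e' \<and> snd (snd e) < snd (snd e')"

definition entry_rank :: "(nat \<times> nat \<Rightarrow> nat set) \<Rightarrow> nat \<times> nat \<times> nat \<Rightarrow> nat" where
  "entry_rank Q e = card {e' \<in> entries Q. entry_less e' e}"

definition entry_label :: "(nat \<times> nat \<Rightarrow> nat set) \<Rightarrow> nat \<Rightarrow> nat" where
  "entry_label Q k = fst (inv_into (entries Q) (entry_rank Q) k)"

definition entries_upto :: "(nat \<times> nat \<Rightarrow> nat set) \<Rightarrow> nat \<Rightarrow> nat" where
  "entries_upto Q q = card {e \<in> entries Q. fst e \<le> q}"

text \<open>The inverse of merging: each entry is replaced by the set that the chain holds at its
  rank.\<close>

definition spread :: "(nat \<times> nat \<Rightarrow> nat set) \<Rightarrow> (nat \<Rightarrow> nat set) \<Rightarrow> nat \<times> nat \<Rightarrow> nat set" where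
  "spread Q L b = (\<Union>q\<in>Q b. L (entry_rank Q (q, b)))"

lemma mem_spreadI: "q \<in> Q b \<Longrightarrow> v \<in> L (entry_rank Q (q, b)) \<Longrightarrow> v \<in> spread Q L b"
  by (auto simp: spread_def)

lemma mem_entries [simp]: "(q, b) \<in> entries Q \<longleftrightarrow> q \<in> Q b"
  by (simp add: entries_def)

lemma bij_betw_rank:
  assumes fin: "finite E" and irrefl: "\<And>e. \<not> lt e e"
    and trans: "\<And>x y z. lt x y \<Longrightarrow> lt y z \<Longrightarrow> lt x z"
    and total: "\<And>x y. x \<in> E \<Longrightarrow> y \<in> E \<Longrightarrow> x = y \<or> lt x y \<or> lt y x"
  defines "rk \<equiv> \<lambda>e. card {e' \<in> E. lt e' e}"
  shows "bij_betw rk E {..<card E}" "\<And>x y. x \<in> E \<Longrightarrow> y \<in> E \<Longrightarrow> rk x < rk y \<longleftrightarrow> lt x y"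
proof -
  have less: "rk x < rk y" if "x \<in> E" "lt x y" for x y
    unfolding rk_def
  proof (rule psubset_card_mono)
    have "x \<in> {e' \<in> E. lt e' y}" "x \<notin> {e' \<in> E. lt e' x}" using that irrefl by auto
    moreover have "{e' \<in> E. lt e' x} \<subseteq> {e' \<in> E. lt e' y}" using that trans by blast
    ultimately show "{e' \<in> E. lt e' x} \<subset> {e' \<in> E. lt e' y}" by blast
  qed (use fin in simp)
  show iff: "rk x < rk y \<longleftrightarrow> lt x y" if "x \<in> E" "y \<in> E" for x y
    using less[of x y] less[of y x] total[OF that] that by (metis less_asym less_irrefl)
  have "inj_on rk E"
    using less total by (intro inj_onI) (metis less_irrefl)
  moreover have "rk ` E = {..<card E}"
  proof (rule card_subset_eq)
    show "rk ` E \<subseteq> {..<card E}"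
    proof
      fix k assume "k \<in> rk ` E"
      then obtain e where e: "e \<in> E" "k = rk e" by blast
      have "{e' \<in> E. lt e' e} \<subset> E" using e irrefl by blast
      then show "k \<in> {..<card E}" using e fin by (simp add: rk_def psubset_card_mono)
    qed
    show "card (rk ` E) = card {..<card E}" using \<open>inj_on rk E\<close> by (simp add: card_image)
  qed simp
  ultimately show "bij_betw rk E {..<card E}" by (simp add: bij_betw_def)
qed

lemma same_column_eq:
  assumes T: "svt_filling n T" and v: "v \<in> T b" "v \<in> T b'" and "snd b = snd b'"
  shows "b = b'"
proof -
  obtain r c r' where [simp]: "b = (r, c)" "b' = (r', c)"
    using assms(4) by (cases b; cases b') auto
  have "r = r'"
    using svt_filling_entry_le[OF T, of v r c v r' c] svt_filling_entry_le[OF T, of v r' c v r c] v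
    by (cases r r' rule: linorder_cases) auto
  then show ?thesis by simp
qed

context
  fixes n :: nat and Q :: "nat \<times> nat \<Rightarrow> nat set"
  assumes Q: "svt_filling n Q"
begin

lemma finite_entries: "finite (entries Q)"
proof -
  have "entries Q = (\<lambda>(b, q). (q, b)) ` Sigma (shape Q) Q"
    by (auto simp: entries_def shape_def image_iff)
  moreover have "finite (Sigma (shape Q) Q)"
    using Q svt_filling_finite[OF Q] by (auto simp: svt_filling_def)
  ultimately show ?thesis by simp
qed

lemma entry_less_total: "e \<in> entries Q \<Longrightarrow> e' \<in> entries Q \<Longrightarrow> e = e' \<or> entry_less e e' \<or> entry_less e' e"
  using same_column_eq[OF Q] by (cases e; cases e') (fastforce simp: entry_less_def)

lemma bij_betw_entry_rank: "bij_betw (entry_rank Q) (entries Q) {..<card (entries Q)}"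
  and entry_rank_less_iff: "e \<in> entries Q \<Longrightarrow> e' \<in> entries Q \<Longrightarrow>
    entry_rank Q e < entry_rank Q e' \<longleftrightarrow> entry_less e e'"
proof -
  have irr: "\<not> entry_less e e" for e by (simp add: entry_less_def)
  have tr: "entry_less x y \<Longrightarrow> entry_less y z \<Longrightarrow> entry_less x z" for x y z
    by (auto simp: entry_less_def)
  note * = bij_betw_rank[OF finite_entries, of entry_less, OF irr tr entry_less_total]
  show "bij_betw (entry_rank Q) (entries Q) {..<card (entries Q)}"
    using *(1) by (simp add: entry_rank_def[abs_def])
  show "e \<in> entries Q \<Longrightarrow> e' \<in> entries Q \<Longrightarrow>
    entry_rank Q e < entry_rank Q e' \<longleftrightarrow> entry_less e e'"
    using *(2) by (simp add: entry_rank_def)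
qed

lemma entry_rank_inj: "e \<in> entries Q \<Longrightarrow> e' \<in> entries Q \<Longrightarrow> entry_rank Q e = entry_rank Q e' \<Longrightarrow> e = e'"
  using bij_betw_entry_rank by (auto simp: bij_betw_def inj_on_def)

lemma entry_rank_lt: "e \<in> entries Q \<Longrightarrow> entry_rank Q e < card (entries Q)"
  using bij_betw_entry_rank by (auto simp: bij_betw_def)

lemma entry_rank_surj: "k < card (entries Q) \<Longrightarrow> \<exists>e\<in>entries Q. entry_rank Q e = k"
  using bij_betw_entry_rank unfolding bij_betw_def by (metis imageE lessThan_iff)

lemma entry_label_rank: "e \<in> entries Q \<Longrightarrow> entry_label Q (entry_rank Q e) = fst e"
  using bij_betw_entry_rank by (simp add: entry_label_def bij_betw_def)

lemma entries_pos: "(q, b) \<in> entries Q \<Longrightarrow> 1 \<le> q \<and> q \<le> n"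
  using svt_filling_memD(1,2)[OF Q, of q "fst b" "snd b"] by simp

lemma entries_upto_diff:
  assumes "1 \<le> q"
  shows "entries_upto Q q = entries_upto Q (q - 1) + card {b. q \<in> Q b}"
proof -
  have "{e \<in> entries Q. fst e \<le> q} = {e \<in> entries Q. fst e \<le> q - 1} \<union> Pair q ` {b. q \<in> Q b}"
  proof (intro equalityI subsetI)
    fix e assume e: "e \<in> {e \<in> entries Q. fst e \<le> q}"
    obtain p b where "e = (p, b)" by (cases e) blast
    then show "e \<in> {e \<in> entries Q. fst e \<le> q - 1} \<union> Pair q ` {b. q \<in> Q b}"
      using e by (cases "p = q") auto
  qed (use assms in auto)
  moreover have "card (Pair q ` {b. q \<in> Q b}) = card {b. q \<in> Q b}"
    by (rule card_image) (simp add: inj_on_def)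
  moreover have "finite (Pair q ` {b. q \<in> Q b})"
    by (rule finite_subset[OF _ finite_entries]) auto
  moreover have "{e \<in> entries Q. fst e \<le> q - 1} \<inter> Pair q ` {b. q \<in> Q b} = {}" using assms by auto
  moreover have "finite {e \<in> entries Q. fst e \<le> q - 1}" using finite_entries by simp
  ultimately show ?thesis unfolding entries_upto_def by (simp add: card_Un_disjoint)
qed

text \<open>Ranks compare values first, so the entries of value q occupy consecutive ranks from
  \<open>entries_upto Q (q - 1)\<close> on; the block is nonempty because q occurs.\<close>

lemma composition_blocks_entries:
  assumes labels: "\<And>q. (\<exists>b. q \<in> Q b) \<longleftrightarrow> 1 \<le> q \<and> q \<le> l"
  shows "composition_blocks l (card (entries Q)) (entries_upto Q) (entry_label Q)"
proof
  show "entries_upto Q 0 = 0"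
    unfolding entries_upto_def using entries_pos by (fastforce simp: card_eq_0_iff)
  have "fst e \<le> l" if "e \<in> entries Q" for e
    using labels[of "fst e"] that by (cases e) auto
  then have "{e \<in> entries Q. fst e \<le> l} = entries Q" by blast
  then show "entries_upto Q l = card (entries Q)" by (simp add: entries_upto_def)
  show "entries_upto Q q < entries_upto Q (Suc q)" if "q < l" for q
  proof -
    have "\<exists>b. Suc q \<in> Q b" using labels[of "Suc q"] that by (simp del: split_paired_Ex)
    then obtain b where "Suc q \<in> Q b" by blast
    moreover have "finite {b. Suc q \<in> Q b}"
      by (rule finite_subset[of _ "shape Q"]) (use Q in \<open>auto simp: svt_filling_def shape_def\<close>)
    ultimately have "0 < card {b. Suc q \<in> Q b}"
      unfolding card_gt_0_iff by blast
    then show ?thesis using entries_upto_diff[of "Suc q"] by simp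
  qed
  fix k assume "k < card (entries Q)"
  then obtain q b where e: "(q, b) \<in> entries Q" "entry_rank Q (q, b) = k"
    using entry_rank_surj by force
  then have "\<exists>b. q \<in> Q b" unfolding mem_entries by blast
  then have q: "1 \<le> q" "q \<le> l" using labels[of q] by blast+
  have lab: "entry_label Q k = q" using entry_label_rank[OF e(1)] e(2) by simp
  have "entries_upto Q (q - 1) \<le> k"
    unfolding entries_upto_def e(2)[symmetric] entry_rank_def
    using finite_entries q by (intro card_mono) (auto simp: entry_less_def)
  moreover have "k < entries_upto Q q"
    unfolding entries_upto_def e(2)[symmetric] entry_rank_def
  proof (rule psubset_card_mono)
    have "(q, b) \<in> {e \<in> entries Q. fst e \<le> q}" using e(1) by simp
    moreover have "(q, b) \<notin> {e' \<in> entries Q. entry_less e' (q, b)}" by (simp add: entry_less_def)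
    moreover have "{e' \<in> entries Q. entry_less e' (q, b)} \<subseteq> {e \<in> entries Q. fst e \<le> q}"
      by (auto simp: entry_less_def)
    ultimately show "{e' \<in> entries Q. entry_less e' (q, b)} \<subset> {e \<in> entries Q. fst e \<le> q}" by blast
  qed (use finite_entries in simp)
  ultimately show "1 \<le> entry_label Q k \<and> entry_label Q k \<le> l \<and>
      entries_upto Q (entry_label Q k - 1) \<le> k \<and> k < entries_upto Q (entry_label Q k)"
    using lab q by simp
qed

end

context
  fixes n :: nat and Q :: "nat \<times> nat \<Rightarrow> nat set" and L :: "nat \<Rightarrow> nat set"
  assumes Q: "svt_filling n Q" and L: "L \<in> chains n (card (entries Q)) (entry_label Q)"
begin

lemma chains_nonempty: "q \<in> Q b \<Longrightarrow> L (entry_rank Q (q, b)) \<noteq> {}"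
  using L entry_rank_lt[OF Q, of "(q, b)"] by (simp add: chains_def)

lemma chains_range: "v \<in> L k \<Longrightarrow> 1 \<le> v \<and> v \<le> n"
proof -
  assume v: "v \<in> L k"
  then have "k < card (entries Q)"
    using L unfolding chains_def by (metis (mono_tags, lifting) mem_Collect_eq empty_iff not_less)
  then have "L k \<subseteq> {1..n}" using L unfolding chains_def by blast
  then show ?thesis using v by auto
qed

lemma chains_less:
  assumes "q \<in> Q b" "q' \<in> Q b'" "v \<in> L (entry_rank Q (q, b))" "v' \<in> L (entry_rank Q (q', b'))" "q < q'"
  shows "v < v'"
proof -
  have "entry_rank Q (q, b) < entry_rank Q (q', b')"
    using assms entry_rank_less_iff[OF Q, of "(q, b)" "(q', b')"] by (simp add: entry_less_def)
  moreover have "entry_label Q (entry_rank Q (q, b)) \<noteq> entry_label Q (entry_rank Q (q', b'))"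
    using assms entry_label_rank[OF Q] by simp
  moreover have "entry_rank Q (q', b') < card (entries Q)"
    using assms entry_rank_lt[OF Q] by simp
  ultimately show ?thesis using L assms unfolding chains_def by blast
qed

lemma chains_le:
  assumes "q \<in> Q b" "q \<in> Q b'" "v \<in> L (entry_rank Q (q, b))" "v' \<in> L (entry_rank Q (q, b'))" "snd b < snd b'"
  shows "v \<le> v'"
proof -
  have "entry_rank Q (q, b) < entry_rank Q (q, b')"
    using assms entry_rank_less_iff[OF Q, of "(q, b)" "(q, b')"] by (simp add: entry_less_def)
  moreover have "entry_rank Q (q, b') < card (entries Q)"
    using assms entry_rank_lt[OF Q] by simp
  ultimately show ?thesis using L assms unfolding chains_def by blast
qed

lemma shape_spread: "shape (spread Q L) = shape Q"
proof -
  have "spread Q L b = {} \<longleftrightarrow> Q b = {}" for b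
    using chains_nonempty by (auto simp: spread_def)
  then show ?thesis by (simp add: shape_def)
qed

lemma mem_spreadE:
  assumes "v \<in> spread Q L b"
  obtains q where "q \<in> Q b" "v \<in> L (entry_rank Q (q, b))"
  using assms by (auto simp: spread_def)

text \<open>Distinct values of Q receive strictly separated sets, which gives strict columns. Equal
  values in neighbouring boxes of a row are ranked from left to right, which gives weak
  rows.\<close>

lemma svt_filling_spread: "svt_filling n (spread Q L)"
  unfolding svt_filling_def shape_spread
proof (intro conjI allI impI)
  show "finite (shape Q)" using Q by (simp add: svt_filling_def)
  show "spread Q L b \<subseteq> {1..n}" for b
    using chains_range by (auto simp: spread_def)
  show "1 \<le> r" "1 \<le> c" if "(r, c) \<in> shape Q" for r c
    using svt_filling_shape_pos[OF Q that] by auto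
  show "(r', c') \<in> shape Q" if "(r, c) \<in> shape Q" "1 \<le> r'" "r' \<le> r" "1 \<le> c'" "c' \<le> c" for r c r' c'
    using svt_filling_shapeD[OF Q that] .
  show "v \<le> v'" if v: "v \<in> spread Q L (r, c)" "v' \<in> spread Q L (r, Suc c)" for r c v v'
  proof -
    obtain q q' where q: "q \<in> Q (r, c)" "v \<in> L (entry_rank Q (q, (r, c)))"
      "q' \<in> Q (r, Suc c)" "v' \<in> L (entry_rank Q (q', (r, Suc c)))"
      using v by (metis mem_spreadE)
    then have "q \<le> q'" using Q unfolding svt_filling_def by blast
    then show ?thesis
      using chains_less[OF q(1,3,2,4)] chains_le[OF q(1) _ q(2)] q(3,4) by (cases "q = q'") auto
  qed
  show "v < v'" if v: "v \<in> spread Q L (r, c)" "v' \<in> spread Q L (Suc r, c)" for r c v v'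
  proof -
    obtain q q' where q: "q \<in> Q (r, c)" "v \<in> L (entry_rank Q (q, (r, c)))"
      "q' \<in> Q (Suc r, c)" "v' \<in> L (entry_rank Q (q', (Suc r, c)))"
      using v by (metis mem_spreadE)
    then have "q < q'" using Q unfolding svt_filling_def by blast
    then show ?thesis using chains_less[OF q(1,3,2,4)] by simp
  qed
qed

text \<open>The description is unique on the spread tableau because sets assigned to different
  values of Q are disjoint (\<open>chains_less\<close>).\<close>

definition spread_label :: "nat \<Rightarrow> nat" where
  "spread_label v = (THE q. \<exists>b. q \<in> Q b \<and> v \<in> L (entry_rank Q (q, b)))"

lemma spread_label_eq:
  assumes "q \<in> Q b" "v \<in> L (entry_rank Q (q, b))"
  shows "spread_label v = q"
  unfolding spread_label_def
proof (rule the_equality)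
  fix q' assume "\<exists>b. q' \<in> Q b \<and> v \<in> L (entry_rank Q (q', b))"
  then obtain b' where "q' \<in> Q b'" "v \<in> L (entry_rank Q (q', b'))" by blast
  then show "q' = q"
    using chains_less[of q b q' b' v v] chains_less[of q' b' q b v v] assms by (metis less_irrefl linorder_neqE_nat)
qed (use assms in blast)

lemma spread_label_image: "spread_label ` spread Q L b = Q b"
proof (intro equalityI subsetI)
  fix q assume "q \<in> spread_label ` spread Q L b"
  then obtain v where v: "v \<in> spread Q L b" "q = spread_label v" by blast
  then show "q \<in> Q b" using spread_label_eq by (metis mem_spreadE)
next
  fix q assume q: "q \<in> Q b"
  then obtain v where "v \<in> L (entry_rank Q (q, b))" using chains_nonempty by blast
  then show "q \<in> spread_label ` spread Q L b"
    using mem_spreadI[of q Q b _ L] spread_label_eq[OF q] q by (metis image_eqI)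
qed

lemma chain_conv_spread:
  assumes "q \<in> Q b"
  shows "L (entry_rank Q (q, b)) = {v \<in> spread Q L b. spread_label v = q}"
proof (intro equalityI subsetI)
  fix v assume "v \<in> L (entry_rank Q (q, b))"
  then show "v \<in> {v \<in> spread Q L b. spread_label v = q}"
    using mem_spreadI[of q Q b v L] spread_label_eq[OF assms] assms by simp
next
  fix v assume v: "v \<in> {v \<in> spread Q L b. spread_label v = q}"
  then obtain q' where q': "q' \<in> Q b" "v \<in> L (entry_rank Q (q', b))" by (auto elim: mem_spreadE)
  then have "q' = q" using v spread_label_eq by auto
  then show "v \<in> L (entry_rank Q (q, b))" using q' by simp
qed

text \<open>The spread tableau remembers Q: together with \<open>qy_labelling_unique\<close> this
  yields injectivity. The pair of boxes required by the quasi-Yamanouchi condition for Q supplies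
  the witness in the last clause.\<close>

lemma qy_labelling_spread:
  assumes qy: "\<And>q b. q \<in> Q b \<Longrightarrow> 1 < q \<Longrightarrow> \<exists>b1 b2. b1 \<noteq> b2 \<and> q \<in> Q b1 \<and> q - 1 \<in> Q b2 \<and> snd b1 \<le> snd b2"
  shows "qy_labelling (spread Q L) spread_label"
  unfolding qy_labelling_def
proof (intro conjI allI impI)
  fix b v assume v: "v \<in> spread Q L b"
  then obtain q where q: "q \<in> Q b" "v \<in> L (entry_rank Q (q, b))" by (rule mem_spreadE)
  have lab: "spread_label v = q" using spread_label_eq q by blast
  show "1 \<le> spread_label v" using entries_pos[OF Q, of q b] q lab by simp
  show "\<exists>b1 b2 x y. x \<in> spread Q L b1 \<and> y \<in> spread Q L b2 \<and> spread_label x = spread_label v \<and>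
      spread_label y = spread_label v - 1 \<and> b1 \<noteq> b2 \<and> snd b1 \<le> snd b2" if "1 < spread_label v"
  proof -
    have "1 < q" using that lab by simp
    from qy[OF q(1) this] obtain b1 b2
      where b: "b1 \<noteq> b2" "q \<in> Q b1" "q - 1 \<in> Q b2" "snd b1 \<le> snd b2" by (elim exE conjE)
    obtain x y where "x \<in> L (entry_rank Q (q, b1))" "y \<in> L (entry_rank Q (q - 1, b2))"
      using chains_nonempty b(2,3) by blast
    then have "x \<in> spread Q L b1" "y \<in> spread Q L b2" "spread_label x = q" "spread_label y = q - 1"
      using b spread_label_eq mem_spreadI[of _ Q _ _ L] by blast+
    then show ?thesis
      unfolding lab using b by (intro exI[of _ b1] exI[of _ b2] exI[of _ x] exI[of _ y] conjI)
  qed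
next
  fix b v b' v' assume v: "v \<in> spread Q L b" "v' \<in> spread Q L b'"
  obtain q where q: "q \<in> Q b" "v \<in> L (entry_rank Q (q, b))" using v(1) by (rule mem_spreadE)
  obtain q' where q': "q' \<in> Q b'" "v' \<in> L (entry_rank Q (q', b'))" using v(2) by (rule mem_spreadE)
  have lab: "spread_label v = q" "spread_label v' = q'" using spread_label_eq q q' by blast+
  show "spread_label v \<le> spread_label v'" if "v \<le> v'"
    using chains_less[OF q'(1) q(1) q'(2) q(2)] that lab by (cases "q' < q") auto
  show "b = b' \<or> snd b < snd b'" if "v < v'" "spread_label v = spread_label v'"
  proof -
    have "q' = q" using that lab by simp
    then have "\<not> snd b' < snd b" using chains_le[of q b' b v' v] q q' that by auto
    moreover have "snd b = snd b' \<Longrightarrow> b = b'" using same_column_eq[OF Q] q q' \<open>q' = q\<close> by blast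
    ultimately show ?thesis by linarith
  qed
qed

text \<open>All sets containing v belong to entries with one common value, so box and rank determine
  each other.\<close>

lemma occ_spread: "occ L v = card {b. v \<in> spread Q L b}"
proof -
  have "{k. v \<in> L k} = (\<lambda>b. entry_rank Q (spread_label v, b)) ` {b. v \<in> spread Q L b}"
  proof (intro equalityI subsetI)
    fix k assume k: "k \<in> {k. v \<in> L k}"
    then have "k < card (entries Q)"
      using L unfolding chains_def by (metis (mono_tags, lifting) mem_Collect_eq empty_iff not_less)
    then obtain q b where e: "q \<in> Q b" "entry_rank Q (q, b) = k"
      using entry_rank_surj[OF Q] by force
    then have "v \<in> spread Q L b" "spread_label v = q"
      using k mem_spreadI[of q Q b v L] spread_label_eq[of q b v] by auto
    then show "k \<in> (\<lambda>b. entry_rank Q (spread_label v, b)) ` {b. v \<in> spread Q L b}" using e by blast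
  next
    fix k assume "k \<in> (\<lambda>b. entry_rank Q (spread_label v, b)) ` {b. v \<in> spread Q L b}"
    then obtain b where b: "v \<in> spread Q L b" "k = entry_rank Q (spread_label v, b)" by blast
    then show "k \<in> {k. v \<in> L k}" using spread_label_eq by (metis mem_Collect_eq mem_spreadE)
  qed
  moreover have "inj_on (\<lambda>b. entry_rank Q (spread_label v, b)) {b. v \<in> spread Q L b}"
  proof (rule inj_onI)
    fix b b' assume b: "b \<in> {b. v \<in> spread Q L b}" "b' \<in> {b. v \<in> spread Q L b}"
      and eq: "entry_rank Q (spread_label v, b) = entry_rank Q (spread_label v, b')"
    have "spread_label v \<in> Q b" "spread_label v \<in> Q b'" using b spread_label_image by blast+
    then show "b = b'" using entry_rank_inj[OF Q _ _ eq] by simp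
  qed
  ultimately show ?thesis by (simp add: occ_def card_image)
qed

end

section \<open>Merging a tableau along its labelling\<close>

context
  fixes n :: nat and T :: "nat \<times> nat \<Rightarrow> nat set" and \<psi> :: "nat \<Rightarrow> nat"
  assumes T: "svt_filling n T" and \<psi>: "qy_labelling T \<psi>"
begin

text \<open>Two vertically adjacent entries are different values in different boxes of one column,
  so the column clause denies them a common label and columns stay strict.\<close>

lemma svt_filling_relabel: "svt_filling n (\<lambda>b. \<psi> ` T b)" "shape (\<lambda>b. \<psi> ` T b) = shape T"
proof -
  show sh: "shape (\<lambda>b. \<psi> ` T b) = shape T" by (simp add: shape_def)
  have pos: "1 \<le> v" "v \<le> n" if "v \<in> T b" for v b
    using svt_filling_memD(1,2)[OF T, of v "fst b" "snd b"] that by auto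
  show "svt_filling n (\<lambda>b. \<psi> ` T b)"
    unfolding svt_filling_def sh
  proof (intro conjI allI impI)
    show "finite (shape T)" using T by (simp add: svt_filling_def)
    show "\<psi> ` T b \<subseteq> {1..n}" for b
    proof (rule image_subsetI)
      fix v assume v: "v \<in> T b"
      have "\<psi> v \<le> v" by (rule qy_labelling_le[OF \<psi> _ v]) (rule pos(1))
      then show "\<psi> v \<in> {1..n}"
        using qy_labelling_pos[OF \<psi> v] pos(2)[OF v] by simp
    qed
    show "1 \<le> r" "1 \<le> c" if "(r, c) \<in> shape T" for r c
      using svt_filling_shape_pos[OF T that] by auto
    show "(r', c') \<in> shape T" if "(r, c) \<in> shape T" "1 \<le> r'" "r' \<le> r" "1 \<le> c'" "c' \<le> c" for r c r' c'
      using svt_filling_shapeD[OF T that] .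
    show "q \<le> q'" if q: "q \<in> \<psi> ` T (r, c)" "q' \<in> \<psi> ` T (r, Suc c)" for r c q q'
    proof -
      obtain v v' where v: "v \<in> T (r, c)" "v' \<in> T (r, Suc c)" "q = \<psi> v" "q' = \<psi> v'" using q by blast
      then have "v \<le> v'" using T unfolding svt_filling_def by blast
      then show ?thesis using qy_labelling_mono[OF \<psi> v(1,2)] v by simp
    qed
    show "q < q'" if q: "q \<in> \<psi> ` T (r, c)" "q' \<in> \<psi> ` T (Suc r, c)" for r c q q'
    proof -
      obtain v v' where v: "v \<in> T (r, c)" "v' \<in> T (Suc r, c)" "q = \<psi> v" "q' = \<psi> v'" using q by blast
      then have "v < v'" using T unfolding svt_filling_def by blast
      then show ?thesis
        using qy_labelling_mono[OF \<psi> v(1,2)] qy_labelling_strip[OF \<psi> v(1,2)] v by fastforce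
    qed
  qed
qed

lemma ex_chain_relabel:
  defines "Q \<equiv> \<lambda>b. \<psi> ` T b"
  shows "\<exists>L\<in>chains n (card (entries Q)) (entry_label Q). spread Q L = T"
proof -
  have Q: "svt_filling n Q" using svt_filling_relabel(1) by (simp add: Q_def)
  \<comment> \<open>The values in the box of the k-th entry that merge into that entry.\<close>
  define L where "L k = {v. \<exists>q b. q \<in> Q b \<and> entry_rank Q (q, b) = k \<and> v \<in> T b \<and> \<psi> v = q}" for k
  have "v \<le> v' \<and> (entry_label Q k \<noteq> entry_label Q k' \<longrightarrow> v < v')"
    if k: "k < k'" "v \<in> L k" "v' \<in> L k'" for k k' v v'
  proof -
    obtain b where b: "\<psi> v \<in> Q b" "entry_rank Q (\<psi> v, b) = k" "v \<in> T b"
      using k(2) by (auto simp: L_def)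
    obtain b' where b': "\<psi> v' \<in> Q b'" "entry_rank Q (\<psi> v', b') = k'" "v' \<in> T b'"
      using k(3) by (auto simp: L_def)
    have "entry_less (\<psi> v, b) (\<psi> v', b')"
      using entry_rank_less_iff[OF Q, of "(\<psi> v, b)" "(\<psi> v', b')"] b b' k(1) by simp
    then consider "\<psi> v < \<psi> v'" | "\<psi> v = \<psi> v'" "snd b < snd b'" by (auto simp: entry_less_def)
    then show ?thesis
    proof cases
      case 1
      then have "v < v'" using qy_labelling_mono[OF \<psi> b'(3) b(3)] by linarith
      then show ?thesis by simp
    next
      case 2
      then have "v \<le> v'"
        using qy_labelling_strip[OF \<psi> b'(3) b(3)] by (metis less_asym less_irrefl not_le)
      moreover have "entry_label Q k = entry_label Q k'"
        using entry_label_rank[OF Q, of "(\<psi> v, b)"] entry_label_rank[OF Q, of "(\<psi> v', b')"] b b' 2 by simp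
      ultimately show ?thesis by blast
    qed
  qed
  moreover have "L k = {}" if "k \<ge> card (entries Q)" for k
    using entry_rank_lt[OF Q] that by (force simp: L_def)
  moreover have "L k \<noteq> {} \<and> L k \<subseteq> {1..n}" if "k < card (entries Q)" for k
  proof
    obtain q b where "q \<in> Q b" "entry_rank Q (q, b) = k"
      using entry_rank_surj[OF Q \<open>k < card (entries Q)\<close>] by force
    moreover from this obtain v where "v \<in> T b" "\<psi> v = q" by (auto simp: Q_def)
    ultimately have "v \<in> L k" unfolding L_def by blast
    then show "L k \<noteq> {}" by blast
    have "T b \<subseteq> {1..n}" for b using T unfolding svt_filling_def by blast
    then show "L k \<subseteq> {1..n}" unfolding L_def by blast
  qed
  ultimately have "L \<in> chains n (card (entries Q)) (entry_label Q)"
    unfolding chains_def by blast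
  moreover have "spread Q L = T"
  proof (rule ext, intro equalityI subsetI)
    fix b v assume "v \<in> spread Q L b"
    then obtain q where q: "q \<in> Q b" "v \<in> L (entry_rank Q (q, b))" by (auto simp: spread_def)
    then obtain b' where b': "\<psi> v \<in> Q b'" "entry_rank Q (\<psi> v, b') = entry_rank Q (q, b)" "v \<in> T b'"
      by (auto simp: L_def)
    then have "b' = b" using entry_rank_inj[OF Q _ _ b'(2)] q by simp
    then show "v \<in> T b" using b' by simp
  next
    fix b v assume v: "v \<in> T b"
    then have "\<psi> v \<in> Q b" by (simp add: Q_def)
    moreover have "v \<in> L (entry_rank Q (\<psi> v, b))" using v \<open>\<psi> v \<in> Q b\<close> unfolding L_def by blast
    ultimately show "v \<in> spread Q L b" by (rule mem_spreadI)
  qed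
  ultimately show ?thesis by blast
qed

end

section \<open>The expansion\<close>

lemma finite_chains: "finite (chains n N blk)"
proof (rule finite_subset)
  show "chains n N blk \<subseteq>
      {L. \<forall>k. (k \<in> {..<N} \<longrightarrow> L k \<in> Pow {1..n}) \<and> (k \<notin> {..<N} \<longrightarrow> L k = {})}"
    unfolding chains_def by auto
  show "finite {L :: nat \<Rightarrow> nat set. \<forall>k. (k \<in> {..<N} \<longrightarrow> L k \<in> Pow {1..n}) \<and> (k \<notin> {..<N} \<longrightarrow> L k = {})}"
    by (rule finite_set_of_finite_funs) auto
qed

lemma card_diagram: "card (diagram lam) = sum_list lam"
proof -
  have "diagram lam = (SIGMA r:{1..length lam}. {1..lam ! (r - 1)})"
    by (auto simp: diagram_def)
  then have "card (diagram lam) = (\<Sum>r\<in>{1..length lam}. lam ! (r - 1))" by simp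
  also have "\<dots> = (\<Sum>k<length lam. lam ! k)"
    by (rule sum.reindex_bij_witness[of _ Suc "\<lambda>r. r - 1"]) auto
  finally show ?thesis by (simp add: sum_list_sum_nth atLeast0LessThan)
qed

context
  fixes n :: nat and lam :: "nat list"
  assumes lam: "is_partition lam"
begin

lemma QSV_iff: "Q \<in> QSV n lam \<longleftrightarrow> svt_filling n Q \<and> shape Q = diagram lam \<and>
    (\<forall>q b. q \<in> Q b \<longrightarrow> 1 < q \<longrightarrow> (\<exists>b1 b2. b1 \<noteq> b2 \<and> q \<in> Q b1 \<and> q - 1 \<in> Q b2 \<and> snd b1 \<le> snd b2))"
proof -
  have "quasi_yamanouchi lam Q \<longleftrightarrow>
      (\<forall>q b. q \<in> Q b \<longrightarrow> 1 < q \<longrightarrow> (\<exists>b1 b2. b1 \<noteq> b2 \<and> q \<in> Q b1 \<and> q - 1 \<in> Q b2 \<and> snd b1 \<le> snd b2))"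
    if sh: "shape Q = diagram lam"
  proof -
    have mem: "b \<in> diagram lam" if "q \<in> Q b" for q b using mem_shapeI[of q Q b, OF that] sh by simp
    show ?thesis
    proof (intro iffI allI impI)
      fix q b assume "quasi_yamanouchi lam Q" "q \<in> Q b" "1 < q"
      then obtain b1 b2 where "b1 \<noteq> b2" "q \<in> Q b1" "q - 1 \<in> Q b2" "snd b1 \<le> snd b2"
        using mem[of q b] unfolding quasi_yamanouchi_def by blast
      then show "\<exists>b1 b2. b1 \<noteq> b2 \<and> q \<in> Q b1 \<and> q - 1 \<in> Q b2 \<and> snd b1 \<le> snd b2" by blast
    next
      assume *: "\<forall>q b. q \<in> Q b \<longrightarrow> 1 < q \<longrightarrow>
        (\<exists>b1 b2. b1 \<noteq> b2 \<and> q \<in> Q b1 \<and> q - 1 \<in> Q b2 \<and> snd b1 \<le> snd b2)"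
      show "quasi_yamanouchi lam Q"
        unfolding quasi_yamanouchi_def
      proof (intro allI impI)
        fix q assume q: "1 < q" "\<exists>b\<in>diagram lam. q \<in> Q b"
        then obtain b1 b2 where b: "b1 \<noteq> b2" "q \<in> Q b1" "q - 1 \<in> Q b2" "snd b1 \<le> snd b2"
          using * by blast
        show "\<exists>b\<in>diagram lam. \<exists>b'\<in>diagram lam. b \<noteq> b' \<and> q \<in> Q b \<and> q - 1 \<in> Q b' \<and> snd b \<le> snd b'"
          by (rule bexI[OF bexI[of _ b2] mem[OF b(2)]]) (use b mem[OF b(3)] in auto)
      qed
    qed
  qed
  then show ?thesis unfolding QSV_def is_svt_iff[OF lam] by blast
qed

text \<open>The quasi-Yamanouchi condition at q > 1 demands an occurrence of q - 1, so no value is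
  skipped.\<close>

lemma QSV_labels:
  assumes "Q \<in> QSV n lam"
  shows "\<exists>l\<le>n. \<forall>q. (\<exists>b. q \<in> Q b) \<longleftrightarrow> 1 \<le> q \<and> q \<le> l"
proof -
  define A where "A = {q. \<exists>b. q \<in> Q b}"
  have Q: "svt_filling n Q" using assms by (simp add: QSV_iff)
  have A: "A \<subseteq> {1..n}" using Q unfolding A_def svt_filling_def by blast
  then have finA: "finite A" by (rule finite_subset) simp
  have down: "1 \<le> y \<Longrightarrow> y \<le> x \<Longrightarrow> x \<in> A \<Longrightarrow> y \<in> A" for x y
  proof (induction x)
    case (Suc x)
    show ?case
    proof (cases "y = Suc x")
      case False
      then have "1 < Suc x" using Suc.prems by simp
      moreover obtain b where "Suc x \<in> Q b" using Suc.prems unfolding A_def by blast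
      ultimately have "Suc x - 1 \<in> A" using assms unfolding QSV_iff A_def by blast
      then show ?thesis using Suc False by simp
    qed (use Suc.prems in simp)
  qed simp
  \<comment> \<open>Entries start at 1; adding 0 makes the value set an initial segment of the
    natural numbers and raises its cardinality by one.\<close>
  have "insert 0 A = {..<card (insert 0 A)}"
  proof (rule down_closed_eq_lessThan)
    show "y \<in> insert 0 A" if "x \<in> insert 0 A" "y < x" for x y
      using that down[of y x] by (cases "y = 0") auto
  qed (use finA in simp)
  moreover have "0 \<notin> A" using A by auto
  ultimately have eq: "insert 0 A = {..card A}" using finA by (simp add: lessThan_Suc_atMost)
  have "q \<in> A \<longleftrightarrow> 1 \<le> q \<and> q \<le> card A" for q
  proof (cases "q = 0")
    case False
    then have "q \<in> A \<longleftrightarrow> q \<in> insert 0 A" by simp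
    then show ?thesis unfolding eq using False by simp
  qed (use \<open>0 \<notin> A\<close> in simp)
  moreover have "card A \<le> n" using card_mono[OF _ A] by simp
  ultimately show ?thesis unfolding A_def mem_Collect_eq by blast
qed

text \<open>A tableau determines its labelling; the labels of the values in each box form Q, and the
  fibres of the labelling in each box form L. Conversely, merging along an existing labelling
  produces a preimage.\<close>

lemma bij_betw_spread:
  "bij_betw (\<lambda>(Q, L). spread Q L) (SIGMA Q:QSV n lam. chains n (card (entries Q)) (entry_label Q))
     {T. is_svt n lam T}"
  unfolding bij_betw_def
proof
  show "inj_on (\<lambda>(Q, L). spread Q L) (SIGMA Q:QSV n lam. chains n (card (entries Q)) (entry_label Q))"
  proof (rule inj_onI, clarify)
    fix Q L Q' L'
    assume "Q \<in> QSV n lam" and L: "L \<in> chains n (card (entries Q)) (entry_label Q)"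
      and "Q' \<in> QSV n lam" and L': "L' \<in> chains n (card (entries Q')) (entry_label Q')"
      and eq: "spread Q L = spread Q' L'"
    then have Q: "svt_filling n Q" and Q': "svt_filling n Q'"
      and qy: "\<And>q b. q \<in> Q b \<Longrightarrow> 1 < q \<Longrightarrow> \<exists>b1 b2. b1 \<noteq> b2 \<and> q \<in> Q b1 \<and> q - 1 \<in> Q b2 \<and> snd b1 \<le> snd b2"
      and qy': "\<And>q b. q \<in> Q' b \<Longrightarrow> 1 < q \<Longrightarrow> \<exists>b1 b2. b1 \<noteq> b2 \<and> q \<in> Q' b1 \<and> q - 1 \<in> Q' b2 \<and> snd b1 \<le> snd b2"
      unfolding QSV_iff by blast+
    have \<psi>: "qy_labelling (spread Q L) (spread_label Q L)"
      by (rule qy_labelling_spread[OF Q L]) (rule qy)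
    have \<psi>': "qy_labelling (spread Q L) (spread_label Q' L')"
      unfolding eq by (rule qy_labelling_spread[OF Q' L']) (rule qy')
    have lab: "spread_label Q L v = spread_label Q' L' v" if "v \<in> spread Q L b" for v b
      using qy_labelling_unique[OF \<psi> \<psi>' that] .
    have "Q b = Q' b" for b
    proof -
      have "spread_label Q L ` spread Q L b = spread_label Q' L' ` spread Q L b"
        using lab by (intro image_cong) auto
      then show ?thesis
        using spread_label_image[OF Q L, of b] spread_label_image[OF Q' L', of b] eq by simp
    qed
    then have QQ: "Q = Q'" by blast
    have "L k = L' k" for k
    proof (cases "k < card (entries Q)")
      case True
      then obtain e where "e \<in> entries Q" "entry_rank Q e = k" using entry_rank_surj[OF Q True] by blast
      then obtain q b where q: "q \<in> Q b" "entry_rank Q (q, b) = k" by (cases e) auto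
      have "L k = {v \<in> spread Q L b. spread_label Q L v = q}"
        using chain_conv_spread[OF Q L q(1)] q(2) by simp
      moreover have "L' k = {v \<in> spread Q L b. spread_label Q' L' v = q}"
        using chain_conv_spread[OF Q' L', of q b] q eq QQ by simp
      ultimately show ?thesis using lab[of _ b] by auto
    next
      case False
      then have "L k = {}" using L unfolding chains_def by (simp add: not_less)
      moreover have "L' k = {}" using False L' QQ unfolding chains_def by (simp add: not_less)
      ultimately show ?thesis by simp
    qed
    then show "Q = Q' \<and> L = L'" using QQ by blast
  qed
  show "(\<lambda>(Q, L). spread Q L) ` (SIGMA Q:QSV n lam. chains n (card (entries Q)) (entry_label Q)) =
      {T. is_svt n lam T}"
  proof (intro equalityI subsetI)
    fix T assume "T \<in> (\<lambda>(Q, L). spread Q L) ` (SIGMA Q:QSV n lam. chains n (card (entries Q)) (entry_label Q))"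
    then obtain Q L where T: "T = spread Q L" and Q: "Q \<in> QSV n lam"
      and L: "L \<in> chains n (card (entries Q)) (entry_label Q)" by auto
    have "svt_filling n Q" "shape Q = diagram lam" using Q by (simp_all add: QSV_iff)
    then show "T \<in> {T. is_svt n lam T}"
      using svt_filling_spread[of n Q L] shape_spread[of n Q L] L by (simp add: T is_svt_iff[OF lam])
  next
    fix T assume "T \<in> {T. is_svt n lam T}"
    then have T: "svt_filling n T" "shape T = diagram lam" by (simp_all add: is_svt_iff[OF lam])
    obtain \<psi> where \<psi>: "qy_labelling T \<psi>" using ex_qy_labelling[OF T(1)] by blast
    define Q where "Q b = \<psi> ` T b" for b
    have Q: "svt_filling n Q" "shape Q = shape T"
      using svt_filling_relabel[OF T(1) \<psi>] by (simp_all add: Q_def[abs_def])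
    have "\<exists>b1 b2. b1 \<noteq> b2 \<and> q \<in> Q b1 \<and> q - 1 \<in> Q b2 \<and> snd b1 \<le> snd b2" if q: "q \<in> Q b" "1 < q" for q b
    proof -
      obtain v where v: "v \<in> T b" "q = \<psi> v" using q(1) by (auto simp: Q_def)
      then have "1 < \<psi> v" using q(2) by simp
      from qy_labelling_descent[OF \<psi> v(1) this] obtain b1 b2 x y where
        "x \<in> T b1" "y \<in> T b2" "\<psi> x = \<psi> v" "\<psi> y = \<psi> v - 1" "b1 \<noteq> b2" "snd b1 \<le> snd b2" .
      moreover from this have "\<psi> v \<in> \<psi> ` T b1" "\<psi> v - 1 \<in> \<psi> ` T b2" by (metis imageI)+
      ultimately show ?thesis unfolding Q_def v(2) by blast
    qed
    then have "Q \<in> QSV n lam" using Q T(2) unfolding QSV_iff by blast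
    moreover obtain L where "L \<in> chains n (card (entries Q)) (entry_label Q)" "spread Q L = T"
      using ex_chain_relabel[OF T(1) \<psi>] by (auto simp: Q_def[abs_def])
    ultimately show "T \<in> (\<lambda>(Q, L). spread Q L) ` (SIGMA Q:QSV n lam. chains n (card (entries Q)) (entry_label Q))"
      by force
  qed
qed

lemma svt_size_eq_card_entries:
  assumes "svt_filling n Q" "shape Q = diagram lam"
  shows "svt_size lam Q = card (entries Q)"
proof -
  have "entries Q = (\<lambda>(b, q). (q, b)) ` Sigma (diagram lam) Q"
    by (auto simp: entries_def assms(2)[symmetric] shape_def image_iff)
  moreover have "inj_on (\<lambda>(b, q). (q, b)) (Sigma (diagram lam) Q)" by (auto intro: inj_onI)
  ultimately show ?thesis
    using svt_filling_finite[OF assms(1)] by (simp add: card_image svt_size_def)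
qed

lemma sum_list_le_svt_size:
  assumes "svt_filling n Q" "shape Q = diagram lam"
  shows "sum_list lam \<le> svt_size lam Q"
proof -
  have "1 \<le> card (Q b)" if "b \<in> diagram lam" for b
    using that svt_filling_finite[OF assms(1)] by (simp add: assms(2)[symmetric] shape_def Suc_le_eq card_gt_0_iff)
  then have "(\<Sum>b\<in>diagram lam. 1) \<le> svt_size lam Q"
    unfolding svt_size_def by (rule sum_mono)
  then show ?thesis by (simp add: card_diagram)
qed

lemma QSV_composition:
  assumes "Q \<in> QSV n lam"
  obtains l where "padded_composition n l (card (entries Q)) (entries_upto Q) (entry_label Q) (rev (svt_wt n lam Q))"
proof -
  have Q: "svt_filling n Q" and sh: "shape Q = diagram lam" using assms by (simp_all add: QSV_iff)
  obtain l where l: "l \<le> n" "\<And>q. (\<exists>b. q \<in> Q b) \<longleftrightarrow> 1 \<le> q \<and> q \<le> l"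
    using QSV_labels[OF assms] by metis
  have wt: "{b \<in> diagram lam. v \<in> Q b} = {b. v \<in> Q b}" for v
    unfolding sh[symmetric] shape_def by blast
  have len: "length (svt_wt n lam Q) = n" by (simp add: svt_wt_def)
  have "padded_composition n l (card (entries Q)) (entries_upto Q) (entry_label Q) (rev (svt_wt n lam Q))"
    unfolding padded_composition_def padded_composition_axioms_def
  proof (intro conjI allI impI)
    show "composition_blocks l (card (entries Q)) (entries_upto Q) (entry_label Q)"
      by (rule composition_blocks_entries[OF Q l(2)])
    show "length (rev (svt_wt n lam Q)) = n" using len by simp
    show "l \<le> n" by (rule l(1))
    fix v assume v: "1 \<le> v" "v \<le> n"
    have "rev (svt_wt n lam Q) ! (n - v) = svt_wt n lam Q ! (v - 1)"
      using v len by (simp add: rev_nth Suc_diff_le)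
    also have "\<dots> = card {b. v \<in> Q b}"
      using v nth_upt[of 1 "v - 1" "n + 1"] by (simp add: svt_wt_def wt del: upt_Suc)
    also have "\<dots> = (if v \<le> l then entries_upto Q v - entries_upto Q (v - 1) else 0)"
    proof (cases "v \<le> l")
      case True
      then show ?thesis using entries_upto_diff[OF Q v(1)] by simp
    next
      case False
      then have "{b. v \<in> Q b} = {}" using l(2)[of v] by blast
      then show ?thesis using False by (simp only: card.empty if_False)
    qed
    finally show "rev (svt_wt n lam Q) ! (n - v) =
        (if v \<le> l then entries_upto Q v - entries_upto Q (v - 1) else 0)" .
  qed
  then show ?thesis by (rule that)
qed

text \<open>Double counting of pairs of a box and a value in it, first by boxes and then by values.
  By \<open>sum_occ_all\<close> the number of entries grows by one for each red value.\<close>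

lemma spread_weight:
  fixes y :: "nat \<Rightarrow> 'a::comm_ring_1"
  assumes Q: "Q \<in> QSV n lam" and L: "L \<in> chains n (card (entries Q)) (entry_label Q)"
  shows "svt_size lam (spread Q L) = svt_size lam Q + card (overlaps L)"
    "(\<Prod>b\<in>diagram lam. \<Prod>v\<in>spread Q L b. y v) = (\<Prod>v\<in>{1..n}. y v ^ occ L v)"
proof -
  have fQ: "svt_filling n Q" and sh: "shape Q = diagram lam" using Q by (simp_all add: QSV_iff)
  note fT = svt_filling_spread[OF fQ L]
  have shT: "shape (spread Q L) = diagram lam" using shape_spread[OF fQ L] sh by simp
  have T: "spread Q L b = {v \<in> {1..n}. v \<in> spread Q L b}" for b
    using fT unfolding svt_filling_def by blast
  have occ: "occ L v = card {b \<in> diagram lam. v \<in> spread Q L b}" for v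
  proof -
    have "{b \<in> diagram lam. v \<in> spread Q L b} = {b. v \<in> spread Q L b}"
      unfolding shT[symmetric] shape_def by blast
    then show ?thesis using occ_spread[OF fQ L] by simp
  qed
  obtain l where "padded_composition n l (card (entries Q)) (entries_upto Q) (entry_label Q) (rev (svt_wt n lam Q))"
    using QSV_composition[OF Q] .
  then interpret padded_composition n l "card (entries Q)" "entries_upto Q" "entry_label Q" "rev (svt_wt n lam Q)" .
  have "svt_size lam (spread Q L) = (\<Sum>b\<in>diagram lam. \<Sum>v | v \<in> {1..n} \<and> v \<in> spread Q L b. 1)"
    unfolding svt_size_def using T by simp
  also have "\<dots> = (\<Sum>v\<in>{1..n}. occ L v)"
    by (subst sum.swap_restrict) (simp_all add: occ)
  also have "\<dots> = svt_size lam Q + card (overlaps L)"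
    using sum_occ_all[OF L] svt_size_eq_card_entries[OF fQ sh] by simp
  finally show "svt_size lam (spread Q L) = svt_size lam Q + card (overlaps L)" .
  have "(\<Prod>b\<in>diagram lam. \<Prod>v\<in>spread Q L b. y v) =
      (\<Prod>b\<in>diagram lam. \<Prod>v | v \<in> {1..n} \<and> v \<in> spread Q L b. y v)"
    using T by simp
  also have "\<dots> = (\<Prod>v\<in>{1..n}. y v ^ occ L v)"
    by (subst prod.swap_restrict) (simp_all add: occ)
  finally show "(\<Prod>b\<in>diagram lam. \<Prod>v\<in>spread Q L b. y v) = (\<Prod>v\<in>{1..n}. y v ^ occ L v)" .
qed

lemma sum_svt_eq_sum_QSV_glide_poly:
  fixes \<beta> :: "'a::comm_ring_1" and x :: "nat \<Rightarrow> 'a"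
  shows "(\<Sum>T | is_svt n lam T. \<beta> ^ (svt_size lam T - sum_list lam) *
      (\<Prod>b\<in>diagram lam. \<Prod>v\<in>T b. x (n + 1 - v))) =
    (\<Sum>Q\<in>QSV n lam. \<beta> ^ (svt_size lam Q - sum_list lam) * glide_poly (rev (svt_wt n lam Q)) \<beta> x)"
    (is "?lhs = ?rhs")
proof -
  let ?C = "\<lambda>Q. chains n (card (entries Q)) (entry_label Q)"
  have fin: "finite (QSV n lam)" by (rule finite_subset[OF _ finite_is_svt[of n lam]]) (auto simp: QSV_def)
  have "?lhs = (\<Sum>(Q, L)\<in>Sigma (QSV n lam) ?C. \<beta> ^ (svt_size lam (spread Q L) - sum_list lam) *
      (\<Prod>b\<in>diagram lam. \<Prod>v\<in>spread Q L b. x (n + 1 - v)))"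
    by (subst sum.reindex_bij_betw[OF bij_betw_spread, symmetric]) (simp add: case_prod_beta)
  also have "\<dots> = (\<Sum>Q\<in>QSV n lam. \<Sum>L\<in>?C Q. \<beta> ^ (svt_size lam (spread Q L) - sum_list lam) *
      (\<Prod>b\<in>diagram lam. \<Prod>v\<in>spread Q L b. x (n + 1 - v)))"
    using fin finite_chains by (subst sum.Sigma) auto
  also have "\<dots> = ?rhs"
  proof (rule sum.cong[OF refl])
    fix Q assume Q: "Q \<in> QSV n lam"
    then have "svt_filling n Q" "shape Q = diagram lam" by (simp_all add: QSV_iff)
    \<comment> \<open>Lets the truncated exponent split as the excess of Q plus
      \<open>card (overlaps L)\<close>.\<close>
    then have le: "sum_list lam \<le> svt_size lam Q" by (rule sum_list_le_svt_size)
    obtain l where pc: "padded_composition n l (card (entries Q)) (entries_upto Q) (entry_label Q) (rev (svt_wt n lam Q))"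
      using QSV_composition[OF Q] .
    have "(\<Sum>L\<in>?C Q. \<beta> ^ (svt_size lam (spread Q L) - sum_list lam) *
        (\<Prod>b\<in>diagram lam. \<Prod>v\<in>spread Q L b. x (n + 1 - v))) =
      (\<Sum>L\<in>?C Q. \<beta> ^ (svt_size lam Q - sum_list lam) *
        (\<beta> ^ card (overlaps L) * (\<Prod>v\<in>{1..n}. x (n + 1 - v) ^ occ L v)))"
      using le by (intro sum.cong refl)
        (simp add: spread_weight[OF Q] power_add[symmetric] mult.assoc[symmetric])
    also have "\<dots> = \<beta> ^ (svt_size lam Q - sum_list lam) * glide_poly (rev (svt_wt n lam Q)) \<beta> x"
      unfolding padded_composition.glide_poly_eq_sum_chains[OF pc] sum_distrib_left ..
    finally show "(\<Sum>L\<in>?C Q. \<beta> ^ (svt_size lam (spread Q L) - sum_list lam) *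
        (\<Prod>b\<in>diagram lam. \<Prod>v\<in>spread Q L b. x (n + 1 - v))) =
      \<beta> ^ (svt_size lam Q - sum_list lam) * glide_poly (rev (svt_wt n lam Q)) \<beta> x" .
  qed
  finally show ?thesis .
qed

end

theorem mainTheorem5:
  fixes n :: nat and lam :: "nat list" and w :: "nat \<Rightarrow> nat"
    and \<beta> :: "'a::comm_ring_1" and x :: "nat \<Rightarrow> 'a"
  assumes "is_partition lam" and "lam \<noteq> []" and "length lam \<le> n"
    and "grassmannian_of n lam w"
  shows "groth w \<beta> x =
    (\<Sum>T\<in>QSV n lam. \<beta> ^ (svt_size lam T - sum_list lam) * glide_poly (rev (svt_wt n lam T)) \<beta> x)"
  unfolding groth_grassmannian[OF assms(1,3,4)] by (rule sum_svt_eq_sum_QSV_glide_poly[OF assms(1)])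

end
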